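(* Over finite structures, $\mathsf{InqBT}$ can express $\mathrm{coNP}$-complete problems: there exists a formula $\varphi$ of $\mathsf{InqBT}$ (over a finite relational vocabulary) such that the problem of deciding, given a finite structure $\mathcal{M}$ and a team $X$ over it (whose domain includes the free variables of $\varphi$), whether $\mathcal{M}\models_X\varphi$, is $\mathrm{coNP}$-complete.
   Context: Syntax of $\mathsf{InqBT}$: $\phi ::= p \mid \bot \mid (\phi\wedge\phi)\mid(\phi\veebar\phi)\mid(\phi\to\phi)\mid\forall x\phi\mid\exists^{\mathrm{i}}x\phi$, with $p$ first-order atoms. Models $\mathcal{M}=(D,I)$ are ordinary first-order structures; a team $X$ is a set of assignments with a common variable domain; $X[x\mapsto d]=\{g[x\mapsto d]: g\in X\}$. Support $\mathcal{M}\models_X\phi$: atoms iff true under every $g\in X$; $\bot$ iff $X=\emptyset$; $\wedge$ conjunction; $\phi\veebar\psi$ iff $\phi$ or $\psi$ supported; $\phi\to\psi$ iff every $Y\subseteq X$ supporting $\phi$ supports $\psi$; $\forall x\phi$ iff $X[x\mapsto d]$ supports $\phi$ for all $d\in D$; $\exists^{\mathrm{i}}x\phi$ iff $X[x\mapsto d]$ supports $\phi$ for some $d\in D$. *)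

theory Defs
  imports Complex_Main "HOL-Computational_Algebra.Polynomial"
begin

section \<open>Inquisitive team logic\<close>

text \<open>A finite relational vocabulary is the list of the arities of its relation symbols;
  the symbols themselves are the positions in that list.\<close>

type_synonym vocabulary = "nat list"
type_synonym var = nat

datatype form =
    Rel nat "var list"
  | Eq var var
  | Bot
  | Conj form form
  | IDisj form form
  | Impl form form
  | Forall var form
  | IExists var form

fun over_voc :: "vocabulary \<Rightarrow> form \<Rightarrow> bool" where
  "over_voc \<tau> (Rel R xs) \<longleftrightarrow> R < length \<tau> \<and> length xs = \<tau> ! R"
| "over_voc \<tau> (Eq x y) \<longleftrightarrow> True"
| "over_voc \<tau> Bot \<longleftrightarrow> True"
| "over_voc \<tau> (Conj \<phi> \<psi>) \<longleftrightarrow> over_voc \<tau> \<phi> \<and> over_voc \<tau> \<psi>"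
| "over_voc \<tau> (IDisj \<phi> \<psi>) \<longleftrightarrow> over_voc \<tau> \<phi> \<and> over_voc \<tau> \<psi>"
| "over_voc \<tau> (Impl \<phi> \<psi>) \<longleftrightarrow> over_voc \<tau> \<phi> \<and> over_voc \<tau> \<psi>"
| "over_voc \<tau> (Forall x \<phi>) \<longleftrightarrow> over_voc \<tau> \<phi>"
| "over_voc \<tau> (IExists x \<phi>) \<longleftrightarrow> over_voc \<tau> \<phi>"

fun fv :: "form \<Rightarrow> var set" where
  "fv (Rel R xs) = set xs"
| "fv (Eq x y) = {x, y}"
| "fv Bot = {}"
| "fv (Conj \<phi> \<psi>) = fv \<phi> \<union> fv \<psi>"
| "fv (IDisj \<phi> \<psi>) = fv \<phi> \<union> fv \<psi>"
| "fv (Impl \<phi> \<psi>) = fv \<phi> \<union> fv \<psi>"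
| "fv (Forall x \<phi>) = fv \<phi> - {x}"
| "fv (IExists x \<phi>) = fv \<phi> - {x}"

record 'a struct =
  universe :: "'a set"
  interp :: "nat \<Rightarrow> 'a list set"

definition is_struct :: "vocabulary \<Rightarrow> 'a struct \<Rightarrow> bool" where
  "is_struct \<tau> M \<longleftrightarrow> universe M \<noteq> {} \<and>
     (\<forall>R < length \<tau>. \<forall>ts \<in> interp M R. length ts = \<tau> ! R \<and> set ts \<subseteq> universe M)"

type_synonym 'a assignment = "var \<Rightarrow> 'a option"

definition is_team :: "'a struct \<Rightarrow> var set \<Rightarrow> 'a assignment set \<Rightarrow> bool" where
  "is_team M V X \<longleftrightarrow> finite V \<and> (\<forall>g \<in> X. dom g = V \<and> ran g \<subseteq> universe M)"

definition team_upd :: "'a assignment set \<Rightarrow> var \<Rightarrow> 'a \<Rightarrow> 'a assignment set" where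
  "team_upd X x d = (\<lambda>g. g(x \<mapsto> d)) ` X"

fun support :: "'a struct \<Rightarrow> 'a assignment set \<Rightarrow> form \<Rightarrow> bool" where
  "support M X (Rel R xs) \<longleftrightarrow> (\<forall>g \<in> X. map (\<lambda>x. the (g x)) xs \<in> interp M R)"
| "support M X (Eq x y) \<longleftrightarrow> (\<forall>g \<in> X. the (g x) = the (g y))"
| "support M X Bot \<longleftrightarrow> X = {}"
| "support M X (Conj \<phi> \<psi>) \<longleftrightarrow> support M X \<phi> \<and> support M X \<psi>"
| "support M X (IDisj \<phi> \<psi>) \<longleftrightarrow> support M X \<phi> \<or> support M X \<psi>"
| "support M X (Impl \<phi> \<psi>) \<longleftrightarrow> (\<forall>Y \<subseteq> X. support M Y \<phi> \<longrightarrow> support M Y \<psi>)"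
| "support M X (Forall x \<phi>) \<longleftrightarrow> (\<forall>d \<in> universe M. support M (team_upd X x d) \<phi>)"
| "support M X (IExists x \<phi>) \<longleftrightarrow> (\<exists>d \<in> universe M. support M (team_upd X x d) \<phi>)"

section \<open>Turing machines and polynomial time\<close>

text \<open>Deterministic multi-tape machines with two-way infinite tapes. Tape symbols and states are
  initial segments of the naturals; symbol 0 is the blank, symbols 1 and 2 are the input bits.\<close>

datatype dir = MoveLeft | Stay | MoveRight

fun offset :: "dir \<Rightarrow> int" where
  "offset MoveLeft = -1"
| "offset Stay = 0"
| "offset MoveRight = 1"

record tm =
  tm_tapes :: nat
  tm_symbols :: nat
  tm_states :: nat
  tm_start :: nat
  tm_halt :: nat
  tm_delta :: "nat \<Rightarrow> nat list \<Rightarrow> nat \<times> (nat \<times> dir) list"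

definition wf_tm :: "tm \<Rightarrow> bool" where
  "wf_tm M \<longleftrightarrow> tm_tapes M \<ge> 1 \<and> tm_symbols M \<ge> 3 \<and>
     tm_start M < tm_states M \<and> tm_halt M < tm_states M \<and>
     (\<forall>q ss. q < tm_states M \<and> length ss = tm_tapes M \<and> set ss \<subseteq> {..<tm_symbols M} \<longrightarrow>
        (case tm_delta M q ss of (q', acts) \<Rightarrow>
           q' < tm_states M \<and> length acts = tm_tapes M \<and> fst ` set acts \<subseteq> {..<tm_symbols M}))"

type_synonym tape = "int \<Rightarrow> nat"

text \<open>A configuration consists of the state and, for each tape, the head position and the content.\<close>

type_synonym config = "nat \<times> (int \<times> tape) list"

definition tm_step :: "tm \<Rightarrow> config \<Rightarrow> config" where
  "tm_step M c = (case c of (q, ts) \<Rightarrow>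
     if q = tm_halt M then c
     else (case tm_delta M q (map (\<lambda>(h, tp). tp h) ts) of (q', acts) \<Rightarrow>
       (q', map2 (\<lambda>(s, d) (h, tp). (h + offset d, tp(h := s))) acts ts)))"

fun bit_symbol :: "bool \<Rightarrow> nat" where
  "bit_symbol False = 1"
| "bit_symbol True = 2"

definition tape_of :: "bool list \<Rightarrow> tape" where
  "tape_of w = (\<lambda>i. if 0 \<le> i \<and> i < int (length w) then bit_symbol (w ! nat i) else 0)"

text \<open>The inputs are placed on the first tapes; all other tapes are blank.\<close>

definition tm_init :: "tm \<Rightarrow> bool list list \<Rightarrow> config" where
  "tm_init M ws = (tm_start M,
     map (\<lambda>i. (0, tape_of (if i < length ws then ws ! i else []))) [0..<tm_tapes M])"

text \<open>The output is read from the last tape. Halted configurations do not change, so halting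
  after exactly \<open>t\<close> iterations means halting within \<open>t\<close> steps.\<close>

definition tm_outputs :: "tm \<Rightarrow> bool list list \<Rightarrow> bool list \<Rightarrow> nat \<Rightarrow> bool" where
  "tm_outputs M ws w t \<longleftrightarrow> (case (tm_step M ^^ t) (tm_init M ws) of (q, ts) \<Rightarrow>
     q = tm_halt M \<and> snd (last ts) = tape_of w)"

definition polytime_fun :: "(bool list \<Rightarrow> bool list) \<Rightarrow> bool" where
  "polytime_fun f \<longleftrightarrow> (\<exists>M (p :: nat poly). wf_tm M \<and>
     (\<forall>x. tm_outputs M [x] (f x) (poly p (length x))))"

definition polytime_rel :: "(bool list \<Rightarrow> bool list \<Rightarrow> bool) \<Rightarrow> bool" where
  "polytime_rel r \<longleftrightarrow> (\<exists>M (p :: nat poly). wf_tm M \<and> tm_tapes M \<ge> 2 \<and>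
     (\<forall>x u. tm_outputs M [x, u] [r x u] (poly p (length x + length u))))"

section \<open>The class coNP\<close>

type_synonym language = "bool list set"

definition NP :: "language set" where
  "NP = {L. \<exists>r (p :: nat poly). polytime_rel r \<and>
     (\<forall>x. x \<in> L \<longleftrightarrow> (\<exists>u. length u \<le> poly p (length x) \<and> r x u))}"

definition coNP :: "language set" where
  "coNP = {L. - L \<in> NP}"

definition polytime_reducible :: "language \<Rightarrow> language \<Rightarrow> bool" where
  "polytime_reducible L L' \<longleftrightarrow> (\<exists>f. polytime_fun f \<and> (\<forall>x. x \<in> L \<longleftrightarrow> f x \<in> L'))"

definition coNP_complete :: "language \<Rightarrow> bool" where
  "coNP_complete L \<longleftrightarrow> L \<in> coNP \<and> (\<forall>L' \<in> coNP. polytime_reducible L' L)"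

section \<open>The model checking problem of a formula\<close>

definition enc_nat :: "nat \<Rightarrow> bool list" where
  "enc_nat n = replicate n True @ [False]"

definition enc_list :: "('b \<Rightarrow> bool list) \<Rightarrow> 'b list \<Rightarrow> bool list" where
  "enc_list e xs = enc_nat (length xs) @ concat (map e xs)"

definition enc_tuple :: "nat list \<Rightarrow> bool list" where
  "enc_tuple ts = concat (map enc_nat ts)"

text \<open>As usual, input structures have universe \<open>{0, \<dots>, n - 1}\<close>. Each relation and the team are
  written as lists of tuples, in any order and possibly with repetitions; an assignment is the
  tuple of its values on the increasingly ordered domain \<open>V\<close>. Numbers are written in unary, hence
  the size of the universe is bounded by the length of the encoding. The code is prefix-free, so
  that \<open>w\<close> determines \<open>V\<close>, \<open>X\<close> and \<open>M\<close> up to symbols outside the vocabulary.\<close>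

definition encodes ::
  "vocabulary \<Rightarrow> bool list \<Rightarrow> nat struct \<Rightarrow> var set \<Rightarrow> nat assignment set \<Rightarrow> bool" where
  "encodes \<tau> w M V X \<longleftrightarrow> (\<exists>n rs gs.
     universe M = {..<n} \<and>
     length rs = length \<tau> \<and> (\<forall>R < length \<tau>. set (rs ! R) = interp M R) \<and>
     set gs = X \<and>
     w = enc_nat n @ concat (map (enc_list enc_tuple) rs) @
         enc_list enc_nat (sorted_list_of_set V) @
         enc_list (\<lambda>g. enc_tuple (map (\<lambda>x. the (g x)) (sorted_list_of_set V))) gs)"

definition mc_problem :: "vocabulary \<Rightarrow> form \<Rightarrow> language" where
  "mc_problem \<tau> \<phi> = {w. \<exists>M V X.
     is_struct \<tau> M \<and> is_team M V X \<and> fv \<phi> \<subseteq> V \<and> encodes \<tau> w M V X \<and> support M X \<phi>}"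

end

theory Submission
  imports Defs
begin

text \<open>
  The formula speaks about teams of triples \<open>(c, v, s)\<close> over the empty vocabulary. It fails iff some
  subteam satisfies the dependence of \<open>s\<close> on \<open>v\<close> and takes every element of the universe as a value
  of \<open>c\<close>. Reading \<open>(c, v, s)\<close> as ``the literal \<open>v = s\<close> occurs in clause \<open>c\<close>'', such a subteam is a
  choice of one literal per clause that is consistent with an assignment, so non-support is
  satisfiability of a set of clauses over many-valued variables. The subteam is the
  certificate for membership in coNP, and the Cook-Levin tableau of a verifier is an instance.

  Polynomial time is reached through counter programs, in which a register is the head position of
  a tape. The functions computed by them within polynomial bounds are closed under arithmetic, bounded
  sums and bounded quantifiers, and this suffices to define both the verifier (a number in the unary
  code is found by counting the zeros before it) and the bits of the reduction.
\<close>

section \<open>Counter programs\<close>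

text \<open>Numbers are held in unary as head positions, which costs nothing here: the code of an
  instance is unary as well, and every number in the reduction is polynomial in the input length.
  Programs never store a word, so composing them needs no intermediate tape; in exchange everything
  is recomputed from the input by bounded sums. A subteam refuting the formula must hit every
  element of the universe. The universe therefore serves at once as the set of clauses, of variables
  and of values, and its size must be large enough for all three; elements that encode no constraint
  become clauses that hold trivially. Many-valued variables keep the tableau small. A head position
  is one variable, clauses with at most three literals suffice, and no uniqueness constraints are
  needed because the dependence already gives each variable at most one value.\<close>

datatype com =
    Skip
  | Inc nat
  | Dec nat
  | Out bool
  | Seq com com
  | If nat "nat \<Rightarrow> bool" com com
  | While nat "nat \<Rightarrow> bool" com

type_synonym store = "(nat \<Rightarrow> nat) \<times> bool list"

definition symbol_at :: "bool list \<Rightarrow> nat \<Rightarrow> nat" where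
  "symbol_at w i = (if i < length w then bit_symbol (w ! i) else 0)"

lemma bit_symbol_bounds: "bit_symbol b \<in> {1, 2}"
  by (cases b) auto

lemma symbol_at_le_2: "symbol_at w i \<le> 2"
  using bit_symbol_bounds[of "w ! i"] by (auto simp: symbol_at_def)

lemma symbol_at_eq_0_iff: "symbol_at w i = 0 \<longleftrightarrow> length w \<le> i"
  using bit_symbol_bounds[of "w ! i"] by (auto simp: symbol_at_def)

lemma symbol_at_eq_1_iff: "symbol_at w i = 1 \<longleftrightarrow> i < length w \<and> \<not> w ! i"
  by (cases "w ! i") (auto simp: symbol_at_def)

lemma symbol_at_eq_2_iff: "symbol_at w i = 2 \<longleftrightarrow> i < length w \<and> w ! i"
  by (cases "w ! i") (auto simp: symbol_at_def)

text \<open>Cell 0 of every register tape carries a mark, coded by adding 3 to its symbol.\<close>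

definition view :: "(nat \<Rightarrow> bool list) \<Rightarrow> (nat \<Rightarrow> nat) \<Rightarrow> nat \<Rightarrow> nat" where
  "view I \<sigma> r = symbol_at (I r) (\<sigma> r) + (if \<sigma> r = 0 then 3 else 0)"

fun next_com :: "(nat \<Rightarrow> nat) \<Rightarrow> com \<Rightarrow> com" where
  "next_com s (Seq a b) = (if a = Skip then b else Seq (next_com s a) b)"
| "next_com s (If r P a b) = (if P (s r) then a else b)"
| "next_com s (While r P a) = (if P (s r) then Seq a (While r P a) else Skip)"
| "next_com s _ = Skip"

text \<open>The atomic instruction carried out by the current step. Tests and loop unfoldings change
  only the control, so a program step always fits into one machine move.\<close>

fun active :: "com \<Rightarrow> com" where
  "active (Seq a b) = active a"
| "active (If r P a b) = Skip"
| "active (While r P a) = Skip"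
| "active c = c"

fun effect :: "com \<Rightarrow> store \<Rightarrow> store" where
  "effect (Inc r) (\<sigma>, w) = (\<sigma>(r := Suc (\<sigma> r)), w)"
| "effect (Dec r) (\<sigma>, w) = (\<sigma>(r := \<sigma> r - 1), w)"
| "effect (Out b) (\<sigma>, w) = (\<sigma>, w @ [b])"
| "effect _ s = s"

definition com_step :: "(nat \<Rightarrow> bool list) \<Rightarrow> com \<times> store \<Rightarrow> com \<times> store" where
  "com_step I = (\<lambda>(c, s). (next_com (view I (fst s)) c, effect (active c) s))"

definition runs :: "(nat \<Rightarrow> bool list) \<Rightarrow> com \<Rightarrow> store \<Rightarrow> nat \<Rightarrow> store \<Rightarrow> bool" where
  "runs I c s t s' \<longleftrightarrow> (com_step I ^^ t) (c, s) = (Skip, s')"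

lemma com_step_Skip [simp]: "com_step I (Skip, s) = (Skip, s)"
  by (simp add: com_step_def)

lemma com_steps_Skip [simp]: "(com_step I ^^ n) (Skip, s) = (Skip, s)"
  by (induction n) auto

text \<open>\<open>Skip\<close> is a fixed point of \<open>com_step\<close>, so the time in
  \<open>runs\<close> is only an upper bound. Later time bounds are rounded up freely by
  this.\<close>

lemma runs_mono:
  assumes "runs I c s t s'" "t \<le> t'"
  shows "runs I c s t' s'"
proof -
  obtain d where "t' = d + t" using assms(2) by (metis le_Suc_ex add.commute)
  then show ?thesis
    using assms(1) by (simp add: runs_def funpow_add)
qed

lemma runs_step:
  assumes "com_step I (c, s) = (c', s'')" "runs I c' s'' t s'"
  shows "runs I c s (Suc t) s'"
  using assms by (simp add: runs_def funpow_swap1)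

lemma runs_Skip: "runs I Skip s t s"
  by (simp add: runs_def)

lemma runs_Inc: "runs I (Inc r) (\<sigma>, w) 1 (\<sigma>(r := Suc (\<sigma> r)), w)"
  by (simp add: runs_def com_step_def)

lemma runs_Dec: "runs I (Dec r) (\<sigma>, w) 1 (\<sigma>(r := \<sigma> r - 1), w)"
  by (simp add: runs_def com_step_def)

lemma runs_Out: "runs I (Out b) (\<sigma>, w) 1 (\<sigma>, w @ [b])"
  by (simp add: runs_def com_step_def)

text \<open>The extra step is the one that discards \<open>Skip\<close> in front of
  \<open>b\<close>. If \<open>a\<close> finishes early, the time left over is passed on to
  \<open>b\<close>.\<close>

lemma runs_Seq:
  assumes "runs I a s t s1" "runs I b s1 t' s'"
  shows "runs I (Seq a b) s (t + t' + 1) s'"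
  using assms(1)
proof (induction t arbitrary: a s)
  case 0
  then have "a = Skip" "s = s1" by (auto simp: runs_def)
  then show ?case
    using assms(2) by (auto intro!: runs_step simp: com_step_def)
next
  case (Suc t)
  show ?case
  proof (cases "a = Skip")
    case True
    then have "s = s1" using Suc.prems by (simp add: runs_def del: funpow.simps)
    have "runs I b s1 (Suc t + t') s'"
      using assms(2) by (rule runs_mono) simp
    then show ?thesis
      using True \<open>s = s1\<close> runs_step[of I "Seq a b" s b s1 "Suc t + t'"]
      by (simp add: com_step_def)
  next
    case False
    obtain a' s'' where st: "com_step I (a, s) = (a', s'')"
      by (cases "com_step I (a, s)")
    then have "runs I a' s'' t s1"
      using Suc.prems by (simp add: runs_def funpow_swap1)
    then have "runs I (Seq a' b) s'' (t + t' + 1) s'" by (rule Suc.IH)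
    moreover have "com_step I (Seq a b, s) = (Seq a' b, s'')"
      using st False by (simp add: com_step_def)
    ultimately show ?thesis
      using runs_step by fastforce
  qed
qed

lemma runs_If:
  assumes "runs I (if P (view I (fst s) r) then a else b) s t s'"
  shows "runs I (If r P a b) s (t + 1) s'"
  using assms by (auto intro!: runs_step simp: com_step_def)

text \<open>\<open>S i\<close> is the store after \<open>i\<close> rounds. A round costs
  \<open>t\<close> for the body, one step for the unfolding and one to drop the \<open>Skip\<close>
  left in front of the loop; the final 1 is the failing test.\<close>

lemma runs_While:
  assumes "\<And>i. i < n \<Longrightarrow> P (view I (fst (S i)) r)"
    and "\<And>i. i < n \<Longrightarrow> runs I a (S i) t (S (Suc i))"
    and "\<not> P (view I (fst (S n)) r)"
  shows "runs I (While r P a) (S 0) (n * (t + 2) + 1) (S n)"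
  using assms
proof (induction n arbitrary: S)
  case 0
  then show ?case by (auto intro!: runs_step runs_Skip simp: com_step_def)
next
  case (Suc n)
  have "runs I (While r P a) (S (Suc 0)) (n * (t + 2) + 1) (S (Suc n))"
    using Suc.IH[of "\<lambda>i. S (Suc i)"] Suc.prems by simp
  then have "runs I (Seq a (While r P a)) (S 0) (t + (n * (t + 2) + 1) + 1) (S (Suc n))"
    using Suc.prems(2)[of 0] by (intro runs_Seq) auto
  moreover have "com_step I (While r P a, S 0) = (Seq a (While r P a), S 0)"
    using Suc.prems(1)[of 0] by (simp add: com_step_def)
  ultimately have "runs I (While r P a) (S 0) (Suc (t + (n * (t + 2) + 1) + 1)) (S (Suc n))"
    by (rule runs_step[rotated])
  then show ?case by (simp add: algebra_simps)
qed

section \<open>Finiteness of the control and of the set of registers\<close>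

fun residuals :: "com \<Rightarrow> com set" where
  "residuals (Seq a b) = (\<lambda>a'. Seq a' b) ` residuals a \<union> residuals b"
| "residuals (If r P a b) = insert (If r P a b) (residuals a \<union> residuals b)"
| "residuals (While r P a) = {While r P a, Skip} \<union> (\<lambda>a'. Seq a' (While r P a)) ` residuals a"
| "residuals c = {c, Skip}"

fun regs :: "com \<Rightarrow> nat set" where
  "regs (Inc r) = {r}"
| "regs (Dec r) = {r}"
| "regs (Seq a b) = regs a \<union> regs b"
| "regs (If r P a b) = insert r (regs a \<union> regs b)"
| "regs (While r P a) = insert r (regs a)"
| "regs _ = {}"

lemma finite_residuals: "finite (residuals c)"
  by (induction c) auto

lemma self_in_residuals: "c \<in> residuals c"
  by (induction c) auto

lemma Skip_in_residuals: "Skip \<in> residuals c"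
  by (induction c) auto

text \<open>Unfolding a loop only puts residuals of its body in front of the same loop. Thus a
  finite set of programs is closed under execution and can serve as the set of control
  states.\<close>

lemma residuals_closed: "c' \<in> residuals c \<Longrightarrow> next_com s c' \<in> residuals c"
  by (induction c arbitrary: c') (auto simp: self_in_residuals Skip_in_residuals split: if_splits)

lemma finite_regs: "finite (regs c)"
  by (induction c) auto

lemma regs_residuals: "c' \<in> residuals c \<Longrightarrow> regs c' \<subseteq> regs c"
  by (induction c arbitrary: c') fastforce+

text \<open>The next control state depends only on registers that the program mentions, so a machine
  with finitely many register tapes can determine it.\<close>

lemma next_com_cong:
  "(\<And>r. r \<in> regs c \<Longrightarrow> s r = s' r) \<Longrightarrow> next_com s c = next_com s' c"
  by (induction c) auto

lemma regs_active: "regs (active c) \<subseteq> regs c"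
  by (induction c) auto

lemma active_cases:
  obtains (Skip) "active c = Skip" | (Inc) r where "active c = Inc r"
  | (Dec) r where "active c = Dec r" | (Out) b where "active c = Out b"
  by (induction c) auto

section \<open>Turing machines for counter programs\<close>

text \<open>Symbols from 3 on are the marked ones, found only on cell 0, so the test
  \<open>ss ! i < 3\<close> stops a head there and \<open>Dec\<close> becomes truncated subtraction.
  Only \<open>Out\<close> changes a symbol, on the output tape.\<close>

fun action :: "nat \<Rightarrow> com \<Rightarrow> nat list \<Rightarrow> nat \<Rightarrow> nat \<times> dir" where
  "action k (Inc r) ss i = (ss ! i, if i = r \<and> i < k then MoveRight else Stay)"
| "action k (Dec r) ss i = (ss ! i, if i = r \<and> i < k \<and> ss ! i < 3 then MoveLeft else Stay)"
| "action k (Out b) ss i = (if i = k then (bit_symbol b, MoveRight) else (ss ! i, Stay))"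
| "action k _ ss i = (ss ! i, Stay)"

text \<open>Tapes \<open>0, \<dots>, k - 1\<close> are the registers, tape \<open>k\<close> is the output. The states below
  \<open>card (residuals c)\<close> are the codes \<open>h\<close> of the residual programs; the extra start state
  marks cell 0 of the register tapes.\<close>

definition com_tm :: "nat \<Rightarrow> com \<Rightarrow> (com \<Rightarrow> nat) \<Rightarrow> tm" where
  "com_tm k c h = \<lparr>
     tm_tapes = Suc k, tm_symbols = 6, tm_states = Suc (card (residuals c)),
     tm_start = card (residuals c), tm_halt = h Skip,
     tm_delta = (\<lambda>q ss.
       if q = card (residuals c)
       then (h c, map (\<lambda>i. (if i < k \<and> ss ! i < 3 then ss ! i + 3 else ss ! i, Stay)) [0..<Suc k])
       else let a = inv_into (residuals c) h q
            in (h (next_com (\<lambda>r. ss ! r) a), map (action k (active a) ss) [0..<Suc k])) \<rparr>"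

definition reg_tape :: "(nat \<Rightarrow> bool list) \<Rightarrow> nat \<Rightarrow> tape" where
  "reg_tape I r = (tape_of (I r))(0 := tape_of (I r) 0 + 3)"

definition com_config ::
  "nat \<Rightarrow> (com \<Rightarrow> nat) \<Rightarrow> (nat \<Rightarrow> bool list) \<Rightarrow> com \<times> store \<Rightarrow> config" where
  "com_config k h I = (\<lambda>(c, \<sigma>, w).
     (h c, map (\<lambda>i. if i < k then (int (\<sigma> i), reg_tape I i) else (int (length w), tape_of w)) [0..<Suc k]))"

lemma tape_of_nat: "tape_of w (int i) = symbol_at w i"
  by (simp add: tape_of_def symbol_at_def)

lemma reg_tape_view: "reg_tape I r (int (\<sigma> r)) = view I \<sigma> r"
  using tape_of_nat[of "I r" 0] by (auto simp: reg_tape_def view_def tape_of_nat)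

lemma tape_of_end [simp]: "tape_of w (int (length w)) = 0"
  by (simp add: tape_of_def)

lemma tape_of_snoc: "tape_of (w @ [b]) = (tape_of w)(int (length w) := bit_symbol b)"
  by (auto simp: tape_of_def fun_eq_iff nth_append)

text \<open>The six symbols are the blank and the two bits, each with a marked version.
  Well-formedness also speaks about marked symbols scanned in the start state; the guard
  \<open>ss ! i < 3\<close> before adding 3 covers them.\<close>

lemma wf_com_tm:
  assumes "bij_betw h (residuals c) {..<card (residuals c)}"
  shows "wf_tm (com_tm k c h)"
proof -
  have h: "h a < card (residuals c)" if "a \<in> residuals c" for a
    using assms that by (auto simp: bij_betw_def)
  have inv: "inv_into (residuals c) h q \<in> residuals c" if "q < card (residuals c)" for q
    using assms that by (metis bij_betw_imp_surj_on inv_into_into lessThan_iff)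
  have act: "fst (action k a ss i) < 6"
    if "set ss \<subseteq> {..<6}" "length ss = Suc k" "i < Suc k" for a ss i
  proof -
    have "ss ! i < 6" using that by (metis lessThan_iff nth_mem subsetD)
    moreover have "bit_symbol b < 6" for b by (cases b) auto
    ultimately show ?thesis by (cases a) auto
  qed
  have len: "ss ! i < 6" if "set ss \<subseteq> {..<6}" "length ss = Suc k" "i < Suc k" for ss i
    using that by (metis lessThan_iff nth_mem subsetD)
  have delta: "case tm_delta (com_tm k c h) q ss of (q', acts) \<Rightarrow>
      q' < Suc (card (residuals c)) \<and> length acts = Suc k \<and> fst ` set acts \<subseteq> {..<6}"
    if "q < Suc (card (residuals c))" "length ss = Suc k" "set ss \<subseteq> {..<6}" for q ss
  proof (cases "q = card (residuals c)")
    case True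
    then show ?thesis
      using h[OF self_in_residuals] len[OF that(3,2)]
      by (auto simp: com_tm_def simp del: upt_Suc)
  next
    case False
    then have "inv_into (residuals c) h q \<in> residuals c" using that(1) inv by simp
    then have "h (next_com (\<lambda>r. ss ! r) (inv_into (residuals c) h q)) < card (residuals c)"
      by (intro h residuals_closed)
    moreover have "fst (action k (active (inv_into (residuals c) h q)) ss i) < 6" if "i < Suc k" for i
      using act that \<open>length ss = Suc k\<close> \<open>set ss \<subseteq> {..<6}\<close> by blast
    ultimately show ?thesis
      using False by (auto simp: com_tm_def Let_def simp del: upt_Suc)
  qed
  show ?thesis
    unfolding wf_tm_def using delta h[OF self_in_residuals] h[OF Skip_in_residuals]
    by (simp add: com_tm_def)
qed

text \<open>The simulation is step by step: \<open>view\<close> is by construction the symbol under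
  a register head, and injectivity of \<open>h\<close> lets the machine recover the residual program
  from its state.\<close>

lemma com_tm_step:
  assumes h: "bij_betw h (residuals c) {..<card (residuals c)}"
    and regs: "\<And>r. r \<in> regs c \<Longrightarrow> r < k"
    and a: "a \<in> residuals c"
  shows "tm_step (com_tm k c h) (com_config k h I (a, s)) = com_config k h I (com_step I (a, s))"
proof (cases "a = Skip")
  case True
  then show ?thesis
    by (cases s) (simp add: tm_step_def com_config_def com_tm_def)
next
  case False
  obtain \<sigma> w where s: "s = (\<sigma>, w)" by (cases s)
  define ss where "ss = map (\<lambda>i. if i < k then view I \<sigma> i else 0) [0..<Suc k]"
  have inj: "inj_on h (residuals c)" using h by (simp add: bij_betw_def)
  have "h a \<noteq> h Skip"
    using False inj a Skip_in_residuals by (metis inj_onD)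
  moreover have "h a < card (residuals c)" using h a by (auto simp: bij_betw_def)
  moreover have "inv_into (residuals c) h (h a) = a" using inj a by simp
  moreover have "map (\<lambda>(h, tp). tp h) (snd (com_config k h I (a, s))) = ss"
    by (simp add: com_config_def s ss_def reg_tape_view)
  moreover have nxt: "next_com (\<lambda>r. ss ! r) a = next_com (view I \<sigma>) a"
  proof (rule next_com_cong)
    fix r assume "r \<in> regs a"
    then have "r < k" using regs regs_residuals[OF a] by blast
    then show "ss ! r = view I \<sigma> r" by (simp add: ss_def nth_append)
  qed
  moreover have "map2 (\<lambda>(s, d) (h, tp). (h + offset d, tp(h := s)))
       (map (action k (active a) ss) [0..<Suc k]) (snd (com_config k h I (a, s))) =
     snd (com_config k h I (com_step I (a, s)))"
  proof (rule nth_equalityI)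
    show "length (map2 (\<lambda>(s, d) (h, tp). (h + offset d, tp(h := s)))
       (map (action k (active a) ss) [0..<Suc k]) (snd (com_config k h I (a, s)))) =
     length (snd (com_config k h I (com_step I (a, s))))"
      by (simp add: com_config_def s com_step_def split: prod.splits)
  next
    fix i
    assume "i < length (map2 (\<lambda>(s, d) (h, tp). (h + offset d, tp(h := s)))
       (map (action k (active a) ss) [0..<Suc k]) (snd (com_config k h I (a, s))))"
    then have i: "i < Suc k" by (simp add: com_config_def s split: prod.splits)
    have ssi: "ss ! i = (if i < k then view I \<sigma> i else 0)"
      using i by (simp add: ss_def del: upt_Suc)
    have ar: "regs (active a) \<subseteq> {..<k}"
      using regs regs_active[of a] regs_residuals[OF a] by blast
    have v: "view I \<sigma> r < 3 \<longleftrightarrow> \<sigma> r \<noteq> 0" for r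
      using symbol_at_le_2[of "I r" "\<sigma> r"] by (auto simp: view_def)
    show "map2 (\<lambda>(s, d) (h, tp). (h + offset d, tp(h := s)))
       (map (action k (active a) ss) [0..<Suc k]) (snd (com_config k h I (a, s))) ! i =
     snd (com_config k h I (com_step I (a, s))) ! i"
      by (cases rule: active_cases[of a])
        (use i ar ssi in \<open>auto simp: com_config_def s com_step_def reg_tape_view[symmetric]
          tape_of_snoc v[unfolded reg_tape_view[symmetric]] simp del: upt_Suc\<close>)
  qed
  ultimately show ?thesis
    by (auto simp: tm_step_def com_tm_def com_config_def s com_step_def Let_def
        simp del: upt_Suc split: prod.splits)
qed

text \<open>The start state is not the halting one, so a first move takes place and marks the
  register tapes. It accounts for the \<open>Suc t\<close> in \<open>com_tm_outputs\<close>.\<close>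

lemma com_tm_start:
  assumes "h Skip \<noteq> card (residuals c)" "length ws \<le> k"
  shows "tm_step (com_tm k c h) (tm_init (com_tm k c h) ws) =
    com_config k h (\<lambda>i. if i < length ws then ws ! i else []) (c, \<lambda>_. 0, [])"
proof -
  have "tape_of w 0 < 3" for w using symbol_at_le_2[of w 0] tape_of_nat[of w 0] by simp
  moreover have "tape_of [] = (\<lambda>_. 0)" by (auto simp: tape_of_def)
  ultimately show ?thesis
    using assms
    by (auto simp: tm_step_def com_tm_def com_config_def tm_init_def reg_tape_def
        map2_map_map o_def fun_eq_iff simp del: upt_Suc)
qed

lemma com_tm_steps:
  assumes h: "bij_betw h (residuals c) {..<card (residuals c)}"
    and regs: "\<And>r. r \<in> regs c \<Longrightarrow> r < k"
  shows "(tm_step (com_tm k c h) ^^ t) (com_config k h I (c, s)) =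
      com_config k h I ((com_step I ^^ t) (c, s)) \<and>
    fst ((com_step I ^^ t) (c, s)) \<in> residuals c"
proof (induction t)
  case 0
  then show ?case by (simp add: self_in_residuals)
next
  case (Suc t)
  obtain a s' where "(com_step I ^^ t) (c, s) = (a, s')"
    by (cases "(com_step I ^^ t) (c, s)")
  with Suc com_tm_step[OF h regs, of a I s'] show ?case
    by (auto simp: com_step_def intro: residuals_closed)
qed

lemma com_tm_outputs:
  assumes "\<And>r. r \<in> regs c \<Longrightarrow> r < k"
  shows "\<exists>M. wf_tm M \<and> tm_tapes M = Suc k \<and>
    (\<forall>ws \<sigma> w t. length ws \<le> k \<longrightarrow>
       runs (\<lambda>i. if i < length ws then ws ! i else []) c (\<lambda>_. 0, []) t (\<sigma>, w) \<longrightarrow>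
       tm_outputs M ws w (Suc t))"
proof -
  obtain h where h: "bij_betw h (residuals c) {..<card (residuals c)}"
    using ex_bij_betw_finite_nat[OF finite_residuals] by (metis atLeast0LessThan)
  have "h Skip < card (residuals c)"
    using h Skip_in_residuals by (auto simp: bij_betw_def)
  then have "tm_outputs (com_tm k c h) ws w (Suc t)"
    if ws: "length ws \<le> k" and
      r: "runs (\<lambda>i. if i < length ws then ws ! i else []) c (\<lambda>_. 0, []) t (\<sigma>, w)" for ws \<sigma> w t
  proof -
    let ?I = "\<lambda>i. if i < length ws then ws ! i else []"
    have "(tm_step (com_tm k c h) ^^ Suc t) (tm_init (com_tm k c h) ws) =
        (tm_step (com_tm k c h) ^^ t) (com_config k h ?I (c, \<lambda>_. 0, []))"
      using com_tm_start[OF _ ws] \<open>h Skip < _\<close> by (simp add: funpow_swap1)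
    also have "\<dots> = com_config k h ?I (Skip, \<sigma>, w)"
      using com_tm_steps[OF h assms] r by (simp add: runs_def)
    finally show ?thesis
      by (simp add: tm_outputs_def com_config_def com_tm_def)
  qed
  then show ?thesis
    using wf_com_tm[OF h] by (intro exI[of _ "com_tm k c h"]) (auto simp: com_tm_def)
qed

section \<open>Polynomially bounded definable functions\<close>

text \<open>Coefficients are natural numbers, hence nonnegative. Monotonicity is what allows
  polynomial bounds to be composed.\<close>

lemma poly_mono_nat:
  fixes p :: "nat poly"
  assumes "m \<le> n"
  shows "poly p m \<le> poly p n"
proof (induction p)
  case (pCons a p)
  then show ?case using assms by (simp add: mult_le_mono)
qed simp

definition poly_bounded :: "(nat \<Rightarrow> nat) \<Rightarrow> bool" where
  "poly_bounded T \<longleftrightarrow> (\<exists>p :: nat poly. \<forall>n. T n \<le> poly p n)"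

lemma poly_bounded_const: "poly_bounded (\<lambda>_. k)"
  unfolding poly_bounded_def by (rule exI[of _ "[:k:]"]) simp

lemma poly_bounded_id: "poly_bounded (\<lambda>n. n)"
  unfolding poly_bounded_def by (rule exI[of _ "[:0, 1:]"]) simp

lemma poly_bounded_poly: "poly_bounded (poly p)"
  unfolding poly_bounded_def by blast

lemma poly_bounded_add:
  assumes "poly_bounded S" "poly_bounded T"
  shows "poly_bounded (\<lambda>n. S n + T n)"
proof -
  obtain p q :: "nat poly" where "\<And>n. S n \<le> poly p n" "\<And>n. T n \<le> poly q n"
    using assms by (auto simp: poly_bounded_def)
  then show ?thesis
    unfolding poly_bounded_def by (intro exI[of _ "p + q"]) (simp add: add_mono)
qed

lemma poly_bounded_mult:
  assumes "poly_bounded S" "poly_bounded T"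
  shows "poly_bounded (\<lambda>n. S n * T n)"
proof -
  obtain p q :: "nat poly" where "\<And>n. S n \<le> poly p n" "\<And>n. T n \<le> poly q n"
    using assms by (auto simp: poly_bounded_def)
  then show ?thesis
    unfolding poly_bounded_def by (intro exI[of _ "p * q"]) (simp add: mult_le_mono)
qed

lemma poly_bounded_compose:
  assumes "poly_bounded S" "poly_bounded T"
  shows "poly_bounded (\<lambda>n. S (T n))"
proof -
  obtain p q :: "nat poly" where "\<And>n. S n \<le> poly p n" "\<And>n. T n \<le> poly q n"
    using assms by (auto simp: poly_bounded_def)
  then show ?thesis
    unfolding poly_bounded_def
    by (intro exI[of _ "pcompose p q"]) (metis le_trans poly_mono_nat poly_pcompose)
qed

lemmas poly_bounded_intros = poly_bounded_const poly_bounded_id poly_bounded_poly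
  poly_bounded_add poly_bounded_mult

section \<open>Programs with inputs, variables and scratch registers\<close>

type_synonym inputs = "nat \<Rightarrow> bool list"
type_synonym env = "nat \<Rightarrow> nat"

definition fits :: "inputs \<Rightarrow> nat \<Rightarrow> bool" where
  "fits I n \<longleftrightarrow> length (I 0) \<le> n \<and> length (I 1) \<le> n"

lemma fits_mono: "fits I m \<Longrightarrow> m \<le> n \<Longrightarrow> fits I n"
  by (auto simp: fits_def)

definition clean :: "nat \<Rightarrow> env \<Rightarrow> bool" where
  "clean b \<sigma> \<longleftrightarrow> \<sigma> 0 = 0 \<and> \<sigma> 1 = 0 \<and> (\<forall>i\<ge>b. \<sigma> i = 0)"

text \<open>Infinitely many variable indices get registers below \<open>b\<close>, so some of them
  share a register. This is harmless because programs restore the variables that they read.\<close>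

definition layout :: "(nat \<Rightarrow> nat) \<Rightarrow> nat \<Rightarrow> bool" where
  "layout \<rho> b \<longleftrightarrow> (\<forall>k. 2 \<le> \<rho> k \<and> \<rho> k < b)"

text \<open>Variable \<open>k\<close> lives in register \<open>\<rho> k\<close>; the registers from \<open>b\<close> on are free, and the
  result is left in register \<open>b\<close>. Registers 0 and 1 are the heads on the input tapes.\<close>

definition computes ::
  "com \<Rightarrow> (nat \<Rightarrow> nat) \<Rightarrow> nat \<Rightarrow> (inputs \<Rightarrow> env \<Rightarrow> nat) \<Rightarrow> (nat \<Rightarrow> nat) \<Rightarrow> bool" where
  "computes c \<rho> b f T \<longleftrightarrow> (\<forall>I \<sigma> w n. fits I n \<longrightarrow> clean b \<sigma> \<longrightarrow> (\<forall>k. \<sigma> (\<rho> k) \<le> n) \<longrightarrow>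
     runs I c (\<sigma>, w) (T n) (\<sigma>(b := f I (\<lambda>k. \<sigma> (\<rho> k))), w))"

definition value_bound :: "(inputs \<Rightarrow> env \<Rightarrow> nat) \<Rightarrow> (nat \<Rightarrow> nat) \<Rightarrow> bool" where
  "value_bound f v \<longleftrightarrow> (\<forall>I e n. fits I n \<longrightarrow> (\<forall>k. e k \<le> n) \<longrightarrow> f I e \<le> v n)"

text \<open>A program is required for every layout, so that a binder can place its variable in a
  fresh register and shift the scratch area. The value bound is there because loops take time
  proportional to the values that they run through.\<close>

definition definable :: "(inputs \<Rightarrow> env \<Rightarrow> nat) \<Rightarrow> bool" where
  "definable f \<longleftrightarrow> (\<exists>v. poly_bounded v \<and> value_bound f v) \<and>
     (\<forall>\<rho> b. layout \<rho> b \<longrightarrow> (\<exists>c T. poly_bounded T \<and> computes c \<rho> b f T))"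

definition emits ::
  "com \<Rightarrow> (nat \<Rightarrow> nat) \<Rightarrow> nat \<Rightarrow> (inputs \<Rightarrow> env \<Rightarrow> bool list) \<Rightarrow> (nat \<Rightarrow> nat) \<Rightarrow> bool" where
  "emits c \<rho> b f T \<longleftrightarrow> (\<forall>I \<sigma> w n. fits I n \<longrightarrow> clean b \<sigma> \<longrightarrow> (\<forall>k. \<sigma> (\<rho> k) \<le> n) \<longrightarrow>
     runs I c (\<sigma>, w) (T n) (\<sigma>, w @ f I (\<lambda>k. \<sigma> (\<rho> k))))"

definition emittable :: "(inputs \<Rightarrow> env \<Rightarrow> bool list) \<Rightarrow> bool" where
  "emittable f \<longleftrightarrow> (\<forall>\<rho> b. layout \<rho> b \<longrightarrow> (\<exists>c T. poly_bounded T \<and> emits c \<rho> b f T))"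

definition decidable :: "(inputs \<Rightarrow> env \<Rightarrow> bool) \<Rightarrow> bool" where
  "decidable P \<longleftrightarrow> definable (\<lambda>I e. of_bool (P I e))"

lemma definable_value_bound:
  assumes "definable f"
  obtains v where "poly_bounded v" "value_bound f v"
  using assms by (auto simp: definable_def)

lemma definable_program:
  assumes "definable f" "layout \<rho> b"
  obtains c T where "poly_bounded T" "computes c \<rho> b f T"
  using assms unfolding definable_def by blast

lemma emittable_program:
  assumes "emittable f" "layout \<rho> b"
  obtains c T where "poly_bounded T" "emits c \<rho> b f T"
  using assms unfolding emittable_def by blast

lemma layout_Suc: "layout \<rho> b \<Longrightarrow> layout \<rho> (Suc b)"
  by (auto simp: layout_def less_Suc_eq)

lemma layout_bind: "layout \<rho> b \<Longrightarrow> 2 \<le> r \<Longrightarrow> r < b \<Longrightarrow> layout (case_nat r \<rho>) b"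
  by (auto simp: layout_def split: nat.split)

lemma layout_ge_2: "layout \<rho> b \<Longrightarrow> 2 < b"
  unfolding layout_def by (metis le_less_trans)

lemma runs_cong: "runs I c s t s' \<Longrightarrow> s' = s'' \<Longrightarrow> t \<le> t' \<Longrightarrow> runs I c s t' s''"
  using runs_mono by simp

abbreviation nonzero :: "nat \<Rightarrow> bool" where
  "nonzero s \<equiv> s < 3"

lemma view_nonzero: "view I \<sigma> r < 3 \<longleftrightarrow> \<sigma> r \<noteq> 0"
  using symbol_at_le_2[of "I r" "\<sigma> r"] by (auto simp: view_def)

section \<open>Loops that clear, move, copy and subtract registers\<close>

lemma runs_clear:
  "runs I (While r nonzero (Dec r)) (\<sigma>, w) (3 * \<sigma> r + 1) (\<sigma>(r := 0), w)"
proof -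
  let ?S = "\<lambda>i. (\<sigma>(r := \<sigma> r - i), w)"
  have "runs I (While r nonzero (Dec r)) (?S 0) (\<sigma> r * (1 + 2) + 1) (?S (\<sigma> r))"
  proof (rule runs_While)
    fix i
    show "runs I (Dec r) (?S i) 1 (?S (Suc i))"
      using runs_Dec[of I r "\<sigma>(r := \<sigma> r - i)" w] by simp
  qed (auto simp: view_nonzero)
  then have "runs I (While r nonzero (Dec r)) (\<sigma>, w) (\<sigma> r * (1 + 2) + 1) (\<sigma>(r := 0), w)"
    by (simp only: diff_zero fun_upd_triv diff_self_eq_0)
  then show ?thesis by (rule runs_cong) auto
qed

lemma runs_move:
  assumes "a \<noteq> r"
  shows "runs I (While r nonzero (Seq (Dec r) (Inc a))) (\<sigma>, w) (5 * \<sigma> r + 1)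
    (\<sigma>(a := \<sigma> a + \<sigma> r, r := 0), w)"
proof -
  let ?S = "\<lambda>i. (\<sigma>(a := \<sigma> a + i, r := \<sigma> r - i), w)"
  have "runs I (While r nonzero (Seq (Dec r) (Inc a))) (?S 0) (\<sigma> r * (3 + 2) + 1) (?S (\<sigma> r))"
  proof (rule runs_While)
    fix i
    show "runs I (Seq (Dec r) (Inc a)) (?S i) 3 (?S (Suc i))"
      using assms by (intro runs_cong[OF runs_Seq[OF runs_Dec runs_Inc]]) auto
  qed (use assms in \<open>auto simp: view_nonzero\<close>)
  then show ?thesis by (simp add: mult.commute)
qed

text \<open>Reading a register empties it, so the value is moved to two places at once and then
  moved back from one of them.\<close>

lemma runs_copy:
  assumes "a \<noteq> r" "b \<noteq> r" "a \<noteq> b" "\<sigma> a = 0" "\<sigma> b = 0"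
  shows "runs I (Seq (While r nonzero (Seq (Dec r) (Seq (Inc a) (Inc b))))
      (While b nonzero (Seq (Dec b) (Inc r)))) (\<sigma>, w) (12 * \<sigma> r + 3) (\<sigma>(a := \<sigma> r), w)"
proof -
  let ?S = "\<lambda>i. (\<sigma>(a := i, b := i, r := \<sigma> r - i), w)"
  have "runs I (While r nonzero (Seq (Dec r) (Seq (Inc a) (Inc b)))) (?S 0)
      (\<sigma> r * (5 + 2) + 1) (?S (\<sigma> r))"
  proof (rule runs_While)
    fix i
    show "runs I (Seq (Dec r) (Seq (Inc a) (Inc b))) (?S i) 5 (?S (Suc i))"
      using assms by (intro runs_cong[OF runs_Seq[OF runs_Dec runs_Seq[OF runs_Inc runs_Inc]]]) auto
  qed (use assms in \<open>auto simp: view_nonzero\<close>)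
  moreover have "?S 0 = (\<sigma>, w)" using assms by auto
  ultimately have "runs I (While r nonzero (Seq (Dec r) (Seq (Inc a) (Inc b)))) (\<sigma>, w)
      (\<sigma> r * 7 + 1) (?S (\<sigma> r))" by simp
  moreover have "runs I (While b nonzero (Seq (Dec b) (Inc r))) (?S (\<sigma> r)) (5 * \<sigma> r + 1)
      (\<sigma>(a := \<sigma> r), w)"
    using assms by (intro runs_cong[OF runs_move]) (auto simp: fun_eq_iff)
  ultimately show ?thesis
    by (rule runs_cong[OF runs_Seq]) auto
qed

lemma runs_monus:
  assumes "a \<noteq> r"
  shows "runs I (While r nonzero (Seq (Dec r) (Dec a))) (\<sigma>, w) (5 * \<sigma> r + 1)
    (\<sigma>(a := \<sigma> a - \<sigma> r, r := 0), w)"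
proof -
  let ?S = "\<lambda>i. (\<sigma>(a := \<sigma> a - i, r := \<sigma> r - i), w)"
  have "runs I (While r nonzero (Seq (Dec r) (Dec a))) (?S 0) (\<sigma> r * (3 + 2) + 1) (?S (\<sigma> r))"
  proof (rule runs_While)
    fix i
    show "runs I (Seq (Dec r) (Dec a)) (?S i) 3 (?S (Suc i))"
      using assms by (intro runs_cong[OF runs_Seq[OF runs_Dec runs_Dec]]) auto
  qed (use assms in \<open>auto simp: view_nonzero\<close>)
  then show ?thesis by (simp add: mult.commute)
qed

lemma ex_value_bound:
  "value_bound f v \<Longrightarrow> poly_bounded v \<Longrightarrow> \<exists>v. poly_bounded v \<and> value_bound f v"
  by blast

lemma ex_computes:
  "computes c \<rho> b f T \<Longrightarrow> poly_bounded T \<Longrightarrow> \<exists>c T. poly_bounded T \<and> computes c \<rho> b f T"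
  by blast

lemma ex_emits:
  "emits c \<rho> b f T \<Longrightarrow> poly_bounded T \<Longrightarrow> \<exists>c T. poly_bounded T \<and> emits c \<rho> b f T"
  by blast

section \<open>Closure properties of definable functions\<close>

lemma definable_var: "definable (\<lambda>I e. e k)"
  unfolding definable_def
proof (intro conjI allI impI)
  show "\<exists>v. poly_bounded v \<and> value_bound (\<lambda>I e. e k) v"
    by (rule exI[of _ "\<lambda>n. n"]) (auto simp: value_bound_def poly_bounded_id)
  fix \<rho> b assume l: "layout \<rho> b"
  let ?c = "Seq (While (\<rho> k) nonzero (Seq (Dec (\<rho> k)) (Seq (Inc b) (Inc (Suc b)))))
      (While (Suc b) nonzero (Seq (Dec (Suc b)) (Inc (\<rho> k))))"
  have "computes ?c \<rho> b (\<lambda>I e. e k) (\<lambda>n. 12 * n + 3)"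
    unfolding computes_def
  proof (intro allI impI)
    fix I \<sigma> w n
    assume a: "fits I n" "clean b \<sigma>" "\<forall>k. \<sigma> (\<rho> k) \<le> n"
    have "\<rho> k < b" using l by (auto simp: layout_def)
    then have "runs I ?c (\<sigma>, w) (12 * \<sigma> (\<rho> k) + 3) (\<sigma>(b := \<sigma> (\<rho> k)), w)"
      using a by (intro runs_copy) (auto simp: clean_def)
    then show "runs I ?c (\<sigma>, w) (12 * n + 3) (\<sigma>(b := \<sigma> (\<rho> k)), w)"
      using a by (elim runs_cong) auto
  qed
  then show "\<exists>c T. poly_bounded T \<and> computes c \<rho> b (\<lambda>I e. e k) T"
    by (rule ex_computes) (intro poly_bounded_intros)
qed

lemma definable_Suc:
  assumes "definable f"
  shows "definable (\<lambda>I e. Suc (f I e))"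
  unfolding definable_def
proof (intro conjI allI impI)
  obtain v where "poly_bounded v" "value_bound f v" using assms by (rule definable_value_bound)
  then have "poly_bounded (\<lambda>n. v n + 1)" and "value_bound (\<lambda>I e. Suc (f I e)) (\<lambda>n. v n + 1)"
    by (intro poly_bounded_intros, simp, simp add: value_bound_def)
  then show "\<exists>v. poly_bounded v \<and> value_bound (\<lambda>I e. Suc (f I e)) v" by blast
  fix \<rho> b assume "layout \<rho> b"
  with assms obtain c T where c: "poly_bounded T" "computes c \<rho> b f T" by (rule definable_program)
  have "computes (Seq c (Inc b)) \<rho> b (\<lambda>I e. Suc (f I e)) (\<lambda>n. T n + 2)"
    unfolding computes_def
  proof (intro allI impI)
    fix I \<sigma> w n
    assume "fits I n" "clean b \<sigma>" "\<forall>k. \<sigma> (\<rho> k) \<le> n"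
    then have "runs I c (\<sigma>, w) (T n) (\<sigma>(b := f I (\<lambda>k. \<sigma> (\<rho> k))), w)"
      using c by (simp add: computes_def)
    from runs_Seq[OF this runs_Inc]
    show "runs I (Seq c (Inc b)) (\<sigma>, w) (T n + 2) (\<sigma>(b := Suc (f I (\<lambda>k. \<sigma> (\<rho> k)))), w)"
      by (rule runs_cong) auto
  qed
  then show "\<exists>c T. poly_bounded T \<and> computes c \<rho> b (\<lambda>I e. Suc (f I e)) T"
    by (rule ex_computes) (intro poly_bounded_intros c(1))
qed

lemma definable_const: "definable (\<lambda>I e. k)"
proof (induction k)
  case 0
  have "value_bound (\<lambda>I e. 0) (\<lambda>_. 0)" by (simp add: value_bound_def)
  \<comment> \<open>A clean store already holds 0 in the result register.\<close>
  moreover have "computes Skip \<rho> b (\<lambda>I e. 0) (\<lambda>_. 0)" for \<rho> b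
  proof -
    have "\<sigma>(b := 0) = \<sigma>" if "clean b \<sigma>" for \<sigma>
      using that by (auto simp: clean_def)
    then show ?thesis by (simp add: computes_def runs_Skip)
  qed
  ultimately show ?case
    unfolding definable_def by (blast intro: poly_bounded_const)
next
  case (Suc k)
  then show ?case by (rule definable_Suc)
qed

text \<open>The second operand of a binary operation is computed with scratch area
  \<open>Suc b\<close> while the first one waits in register \<open>b\<close>, which no variable
  occupies.\<close>

lemma computes_bind:
  assumes "computes c \<rho> (Suc b) g T" "layout \<rho> b" "fits I n" "clean b \<sigma>" "\<forall>k. \<sigma> (\<rho> k) \<le> n"
  shows "runs I c (\<sigma>(b := x), w) (T n) (\<sigma>(b := x, Suc b := g I (\<lambda>k. \<sigma> (\<rho> k))), w)"
proof -
  have "\<rho> k \<noteq> b" for k using assms(2) by (auto simp: layout_def less_le)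
  then have e: "(\<lambda>k. (\<sigma>(b := x)) (\<rho> k)) = (\<lambda>k. \<sigma> (\<rho> k))" by simp
  have "clean (Suc b) (\<sigma>(b := x))"
    using assms(4) layout_ge_2[OF assms(2)] by (auto simp: clean_def)
  then show ?thesis
    using assms e unfolding computes_def by metis
qed

text \<open>The combining loop has to consume its second register, which leaves the scratch area
  clean. The bound \<open>x + y\<close> fits both uses, sum and truncated difference.\<close>

lemma definable_binop:
  assumes f: "definable f" and g: "definable g"
    and bound: "\<And>x y. h x y \<le> x + y"
    and run: "\<And>I \<sigma> a r w. a \<noteq> r \<Longrightarrow> runs I (c a r) (\<sigma>, w) (5 * \<sigma> r + 1)
      (\<sigma>(a := h (\<sigma> a) (\<sigma> r), r := 0), w)"
  shows "definable (\<lambda>I e. h (f I e) (g I e))"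
  unfolding definable_def
proof (intro conjI allI impI)
  obtain v where v: "poly_bounded v" "value_bound f v" using f by (rule definable_value_bound)
  obtain u where u: "poly_bounded u" "value_bound g u" using g by (rule definable_value_bound)
  have "value_bound (\<lambda>I e. h (f I e) (g I e)) (\<lambda>n. v n + u n)"
    using u v bound unfolding value_bound_def by (meson add_mono le_trans)
  then show "\<exists>v. poly_bounded v \<and> value_bound (\<lambda>I e. h (f I e) (g I e)) v"
    by (rule ex_value_bound) (intro poly_bounded_intros u(1) v(1))
  fix \<rho> b assume l: "layout \<rho> b"
  obtain c1 T where c1: "poly_bounded T" "computes c1 \<rho> b f T"
    using f l by (rule definable_program)
  obtain c2 U where c2: "poly_bounded U" "computes c2 \<rho> (Suc b) g U"
    using g layout_Suc[OF l] by (rule definable_program)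
  let ?c = "Seq c1 (Seq c2 (c b (Suc b)))"
  have "computes ?c \<rho> b (\<lambda>I e. h (f I e) (g I e)) (\<lambda>n. T n + U n + 5 * u n + 3)"
    unfolding computes_def
  proof (intro allI impI)
    fix I \<sigma> w n
    assume a: "fits I n" "clean b \<sigma>" "\<forall>k. \<sigma> (\<rho> k) \<le> n"
    let ?e = "\<lambda>k. \<sigma> (\<rho> k)"
    have "g I ?e \<le> u n" using u a by (simp add: value_bound_def)
    moreover have r: "runs I c1 (\<sigma>, w) (T n) (\<sigma>(b := f I ?e), w)"
      using c1 a by (simp add: computes_def)
    moreover have "\<sigma> (Suc b) = 0" using a by (auto simp: clean_def)
    ultimately show "runs I ?c (\<sigma>, w) (T n + U n + 5 * u n + 3) (\<sigma>(b := h (f I ?e) (g I ?e)), w)"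
      by (intro runs_cong[OF runs_Seq[OF r runs_Seq[OF computes_bind[OF c2(2) l a] run]]])
        (auto simp: fun_eq_iff)
  qed
  then show "\<exists>c T. poly_bounded T \<and> computes c \<rho> b (\<lambda>I e. h (f I e) (g I e)) T"
    by (rule ex_computes) (intro poly_bounded_intros c1(1) c2(1) u(1))
qed

lemma definable_add:
  "definable f \<Longrightarrow> definable g \<Longrightarrow> definable (\<lambda>I e. f I e + g I e)"
  by (rule definable_binop[where h = "(+)"], assumption, assumption, simp) (rule runs_move)

lemma definable_diff:
  "definable f \<Longrightarrow> definable g \<Longrightarrow> definable (\<lambda>I e. f I e - g I e)"
  by (rule definable_binop[where h = "(-)"], assumption, assumption, simp) (rule runs_monus)

lemma definable_if_nonzero:
  assumes p: "definable p" and f: "definable f" and g: "definable g"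
  shows "definable (\<lambda>I e. if p I e \<noteq> 0 then f I e else g I e)"
  unfolding definable_def
proof (intro conjI allI impI)
  obtain v where v: "poly_bounded v" "value_bound f v" using f by (rule definable_value_bound)
  obtain u where u: "poly_bounded u" "value_bound g u" using g by (rule definable_value_bound)
  obtain x where x: "poly_bounded x" "value_bound p x" using p by (rule definable_value_bound)
  have "value_bound (\<lambda>I e. if p I e \<noteq> 0 then f I e else g I e) (\<lambda>n. v n + u n)"
    using u v by (auto simp: value_bound_def intro: trans_le_add1 trans_le_add2)
  then show "\<exists>v. poly_bounded v \<and> value_bound (\<lambda>I e. if p I e \<noteq> 0 then f I e else g I e) v"
    by (rule ex_value_bound) (intro poly_bounded_intros u(1) v(1))
  fix \<rho> b assume l: "layout \<rho> b"
  obtain c T where c: "poly_bounded T" "computes c \<rho> b p T"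
    using p l by (rule definable_program)
  obtain c1 T1 where c1: "poly_bounded T1" "computes c1 \<rho> b f T1"
    using f l by (rule definable_program)
  obtain c2 T2 where c2: "poly_bounded T2" "computes c2 \<rho> b g T2"
    using g l by (rule definable_program)
  let ?c = "Seq c (If b nonzero (Seq (While b nonzero (Dec b)) c1) c2)"
  have "computes ?c \<rho> b (\<lambda>I e. if p I e \<noteq> 0 then f I e else g I e)
      (\<lambda>n. T n + 3 * x n + T1 n + T2 n + 4)"
    unfolding computes_def
  proof (intro allI impI)
    fix I \<sigma> w n
    assume a: "fits I n" "clean b \<sigma>" "\<forall>k. \<sigma> (\<rho> k) \<le> n"
    let ?e = "\<lambda>k. \<sigma> (\<rho> k)"
    let ?\<sigma> = "\<sigma>(b := p I ?e)"
    \<comment> \<open>The nonzero branch first clears register \<open>b\<close>, so it too starts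
      from the clean store \<open>\<sigma>\<close>.\<close>
    have sb: "?\<sigma>(b := 0) = \<sigma>" using a by (auto simp: clean_def fun_eq_iff)
    have px: "p I ?e \<le> x n" using x a by (simp add: value_bound_def)
    have "runs I (if nonzero (view I (fst (?\<sigma>, w)) b) then Seq (While b nonzero (Dec b)) c1 else c2)
        (?\<sigma>, w) (3 * x n + T1 n + T2 n + 2)
        (\<sigma>(b := if p I ?e \<noteq> 0 then f I ?e else g I ?e), w)"
    proof (cases "p I ?e = 0")
      case True
      then have \<sigma>: "?\<sigma> = \<sigma>" "\<sigma> b = 0" using sb by (auto simp: fun_upd_idem_iff)
      have "runs I c2 (\<sigma>, w) (T2 n) (\<sigma>(b := g I ?e), w)"
        using c2(2) a by (simp add: computes_def)
      then have "runs I c2 (\<sigma>, w) (3 * x n + T1 n + T2 n + 2) (\<sigma>(b := g I ?e), w)"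
        by (rule runs_mono) simp
      then show ?thesis
        unfolding view_nonzero \<sigma>(1) using True \<sigma>(2) by simp
    next
      case False
      have "runs I c1 (?\<sigma>(b := 0), w) (T1 n) (\<sigma>(b := f I ?e), w)"
        unfolding sb using c1(2) a by (simp add: computes_def)
      from runs_Seq[OF runs_clear this]
      have "runs I (Seq (While b nonzero (Dec b)) c1) (?\<sigma>, w) (3 * x n + T1 n + T2 n + 2)
          (\<sigma>(b := f I ?e), w)"
        by (rule runs_mono) (use px in simp)
      then show ?thesis
        unfolding view_nonzero using False by simp
    qed
    then have "runs I (If b nonzero (Seq (While b nonzero (Dec b)) c1) c2) (?\<sigma>, w)
        (3 * x n + T1 n + T2 n + 2 + 1)
        (\<sigma>(b := if p I ?e \<noteq> 0 then f I ?e else g I ?e), w)"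
      by (rule runs_If)
    moreover have "runs I c (\<sigma>, w) (T n) (?\<sigma>, w)"
      using c(2) a by (simp add: computes_def)
    ultimately show "runs I ?c (\<sigma>, w) (T n + 3 * x n + T1 n + T2 n + 4)
        (\<sigma>(b := if p I ?e \<noteq> 0 then f I ?e else g I ?e), w)"
      by (rule runs_mono[OF runs_Seq[rotated]]) simp
  qed
  then show "\<exists>c T. poly_bounded T \<and> computes c \<rho> b (\<lambda>I e. if p I e \<noteq> 0 then f I e else g I e) T"
    by (rule ex_computes) (intro poly_bounded_intros c(1) c1(1) c2(1) x(1))
qed

lemma definable_rename:
  assumes "definable f"
  shows "definable (\<lambda>I e. f I (\<lambda>k. e (\<pi> k)))"
  unfolding definable_def
proof (intro conjI allI impI)
  obtain v where "poly_bounded v" "value_bound f v" using assms by (rule definable_value_bound)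
  then show "\<exists>v. poly_bounded v \<and> value_bound (\<lambda>I e. f I (\<lambda>k. e (\<pi> k))) v"
    by (intro exI[of _ v]) (simp add: value_bound_def)
  fix \<rho> b assume "layout \<rho> b"
  then have "layout (\<lambda>k. \<rho> (\<pi> k)) b" by (simp add: layout_def)
  with assms obtain c T where c: "poly_bounded T" "computes c (\<lambda>k. \<rho> (\<pi> k)) b f T"
    by (rule definable_program)
  then show "\<exists>c T. poly_bounded T \<and> computes c \<rho> b (\<lambda>I e. f I (\<lambda>k. e (\<pi> k))) T"
    by (intro exI[of _ c] exI[of _ T]) (simp add: computes_def)
qed

text \<open>Binding is in de Bruijn style: \<open>case_nat r \<rho>\<close> gives register
  \<open>r\<close> to variable 0 and shifts the old variables by one.\<close>

lemma env_bind:
  fixes \<tau> \<sigma> :: env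
  assumes "layout \<rho> b" "\<And>i. i < b \<Longrightarrow> \<tau> i = \<sigma> i"
  shows "(\<lambda>k. \<tau> (case_nat r \<rho> k)) = case_nat (\<tau> r) (\<lambda>k. \<sigma> (\<rho> k))"
  using assms by (auto simp: layout_def fun_eq_iff split: nat.split)

lemma case_nat_le: "x \<le> n \<Longrightarrow> (\<And>k. e k \<le> n) \<Longrightarrow> case_nat x e k \<le> (n :: nat)"
  by (auto split: nat.split)

text \<open>The body sees an environment containing \<open>f I e\<close>, which may exceed
  \<open>n\<close>; hence its bounds are taken at \<open>n + v n\<close>. Its result appears one
  register too high and is moved down.\<close>

lemma definable_let:
  assumes f: "definable f" and g: "definable (\<lambda>I e. g I (\<lambda>k. e (Suc k)) (e 0))"
  shows "definable (\<lambda>I e. g I e (f I e))"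
  unfolding definable_def
proof (intro conjI allI impI)
  obtain v where v: "poly_bounded v" "value_bound f v" using f by (rule definable_value_bound)
  obtain u where u: "poly_bounded u" "value_bound (\<lambda>I e. g I (\<lambda>k. e (Suc k)) (e 0)) u"
    using g by (rule definable_value_bound)
  have g_bound: "g I e (f I e) \<le> u (n + v n)" if "fits I n" "\<forall>k. e k \<le> n" for I e n
  proof -
    have "f I e \<le> v n" using v that by (simp add: value_bound_def)
    then have le: "case_nat (f I e) e k \<le> n + v n" for k
      using that(2) by (intro case_nat_le) (auto intro: trans_le_add1)
    show ?thesis
      using u(2)[unfolded value_bound_def, rule_format, where e = "case_nat (f I e) e", OF fits_mono[OF that(1) le_add1] le]
      by simp
  qed
  then have "value_bound (\<lambda>I e. g I e (f I e)) (\<lambda>n. u (n + v n))"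
    by (simp add: value_bound_def)
  then show "\<exists>v. poly_bounded v \<and> value_bound (\<lambda>I e. g I e (f I e)) v"
    by (rule ex_value_bound) (intro poly_bounded_compose[OF u(1)] poly_bounded_intros v(1))
  fix \<rho> b assume l: "layout \<rho> b"
  obtain c1 T where c1: "poly_bounded T" "computes c1 \<rho> b f T"
    using f l by (rule definable_program)
  have l': "layout (case_nat b \<rho>) (Suc b)"
    using layout_bind[OF layout_Suc[OF l], of b] layout_ge_2[OF l] by simp
  obtain c2 U where c2: "poly_bounded U"
      "computes c2 (case_nat b \<rho>) (Suc b) (\<lambda>I e. g I (\<lambda>k. e (Suc k)) (e 0)) U"
    using g l' by (rule definable_program)
  let ?c = "Seq c1 (Seq c2 (Seq (While b nonzero (Dec b))
      (While (Suc b) nonzero (Seq (Dec (Suc b)) (Inc b)))))"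
  have "computes ?c \<rho> b (\<lambda>I e. g I e (f I e))
      (\<lambda>n. T n + U (n + v n) + 3 * v n + 5 * u (n + v n) + 5)"
    unfolding computes_def
  proof (intro allI impI)
    fix I \<sigma> w n
    assume a: "fits I n" "clean b \<sigma>" "\<forall>k. \<sigma> (\<rho> k) \<le> n"
    let ?e = "\<lambda>k. \<sigma> (\<rho> k)"
    let ?x = "f I ?e" and ?y = "g I ?e (f I ?e)"
    have x: "?x \<le> v n" using v a by (simp add: value_bound_def)
    have y: "?y \<le> u (n + v n)" using g_bound a by simp
    have r1: "runs I c1 (\<sigma>, w) (T n) (\<sigma>(b := ?x), w)"
      using c1 a by (simp add: computes_def)
    have r2: "runs I c2 (\<sigma>(b := ?x), w) (U (n + v n)) (\<sigma>(b := ?x, Suc b := ?y), w)"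
    proof -
      have env: "(\<lambda>k. (\<sigma>(b := ?x)) (case_nat b \<rho> k)) = case_nat ?x ?e"
        using env_bind[OF l, of "\<sigma>(b := ?x)" \<sigma> b] by simp
      have \<rho>: "\<rho> k \<noteq> b" for k using l by (simp add: layout_def less_imp_neq)
      have cl: "clean (Suc b) (\<sigma>(b := ?x))"
        using a(2) layout_ge_2[OF l] by (auto simp: clean_def)
      have le: "case_nat ?x ?e k \<le> n + v n" for k
        using a(3) x by (intro case_nat_le) (auto intro: trans_le_add1)
      show ?thesis
        using c2(2)[unfolded computes_def, rule_format, where \<sigma> = "\<sigma>(b := ?x)" and w = w,
            OF fits_mono[OF a(1) le_add1] cl ord_eq_le_trans[OF fun_cong[OF env] le]] \<rho>
        by simp
    qed
    have r3: "runs I (Seq (While b nonzero (Dec b))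
        (While (Suc b) nonzero (Seq (Dec (Suc b)) (Inc b)))) (\<sigma>(b := ?x, Suc b := ?y), w)
        (3 * ?x + 1 + (5 * ?y + 1) + 1) (\<sigma>(b := ?y), w)"
      using a(2) by (intro runs_cong[OF runs_Seq[OF runs_clear runs_move]])
        (auto simp: clean_def fun_eq_iff)
    have "runs I ?c (\<sigma>, w)
        (T n + (U (n + v n) + (3 * ?x + 1 + (5 * ?y + 1) + 1) + 1) + 1) (\<sigma>(b := ?y), w)"
      by (rule runs_Seq[OF r1 runs_Seq[OF r2 r3]])
    then show "runs I ?c (\<sigma>, w) (T n + U (n + v n) + 3 * v n + 5 * u (n + v n) + 5)
        (\<sigma>(b := ?y), w)"
      by (rule runs_mono) (use x y in simp)
  qed
  then show "\<exists>c T. poly_bounded T \<and> computes c \<rho> b (\<lambda>I e. g I e (f I e)) T"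
    by (rule ex_computes) (intro poly_bounded_intros poly_bounded_compose[OF u(1)]
        poly_bounded_compose[OF c2(1)] c1(1) v(1))
qed

text \<open>Registers \<open>b\<close>, \<open>b + 1\<close>, \<open>b + 2\<close>,
  \<open>b + 3\<close> hold the partial sum, the number of rounds left, the bound index and the
  current summand. There are two counters because the loop test wants one that falls to zero and the
  body one that rises.\<close>

lemma definable_sum:
  assumes f: "definable f" and g: "definable (\<lambda>I e. g I (\<lambda>k. e (Suc k)) (e 0))"
  shows "definable (\<lambda>I e. \<Sum>i < f I e. g I e i)"
  unfolding definable_def
proof (intro conjI allI impI)
  obtain v where v: "poly_bounded v" "value_bound f v" using f by (rule definable_value_bound)
  obtain u where u: "poly_bounded u" "value_bound (\<lambda>I e. g I (\<lambda>k. e (Suc k)) (e 0)) u"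
    using g by (rule definable_value_bound)
  have g_bound: "g I e i \<le> u (n + v n)" if "fits I n" "\<forall>k. e k \<le> n" "i < f I e" for I e n i
  proof -
    have "f I e \<le> v n" using v that by (simp add: value_bound_def)
    then have le: "case_nat i e k \<le> n + v n" for k
      using that(2,3) by (intro case_nat_le) (auto intro: trans_le_add1)
    show ?thesis
      using u(2)[unfolded value_bound_def, rule_format, where e = "case_nat i e", OF fits_mono[OF that(1) le_add1] le]
      by simp
  qed
  have "value_bound (\<lambda>I e. \<Sum>i < f I e. g I e i) (\<lambda>n. v n * u (n + v n))"
    unfolding value_bound_def
  proof (intro allI impI)
    fix I n and e :: env assume a: "fits I n" "\<forall>k. e k \<le> n"
    have "(\<Sum>i < f I e. g I e i) \<le> f I e * u (n + v n)"
      using sum_bounded_above[of "{..<f I e}" "g I e" "u (n + v n)"] g_bound[OF a] by simp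
    also have "\<dots> \<le> v n * u (n + v n)"
      using v a by (simp add: value_bound_def)
    finally show "(\<Sum>i < f I e. g I e i) \<le> v n * u (n + v n)" .
  qed
  then show "\<exists>v. poly_bounded v \<and> value_bound (\<lambda>I e. \<Sum>i < f I e. g I e i) v"
    by (rule ex_value_bound) (intro poly_bounded_intros poly_bounded_compose[OF u(1)] v(1))
  fix \<rho> b assume l: "layout \<rho> b"
  have l1: "layout \<rho> (b + 1)" and l3: "layout \<rho> (b + 3)"
    using l trans_less_add1 unfolding layout_def by blast+
  have b: "2 < b" using l by (rule layout_ge_2)
  obtain c1 T where c1: "poly_bounded T" "computes c1 \<rho> (b + 1) f T"
    using f l1 by (rule definable_program)
  have l': "layout (case_nat (b + 2) \<rho>) (b + 3)"
    using l3 by (rule layout_bind) auto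
  obtain c2 U where c2: "poly_bounded U"
      "computes c2 (case_nat (b + 2) \<rho>) (b + 3) (\<lambda>I e. g I (\<lambda>k. e (Suc k)) (e 0)) U"
    using g l' by (rule definable_program)
  let ?body = "Seq (Dec (b + 1)) (Seq c2
      (Seq (While (b + 3) nonzero (Seq (Dec (b + 3)) (Inc b))) (Inc (b + 2))))"
  let ?c = "Seq c1 (Seq (While (b + 1) nonzero ?body) (While (b + 2) nonzero (Dec (b + 2))))"
  let ?t = "\<lambda>n. U (n + v n) + 5 * u (n + v n) + 6"
  have "computes ?c \<rho> b (\<lambda>I e. \<Sum>i < f I e. g I e i)
      (\<lambda>n. T n + v n * (?t n + 2) + 3 * v n + 4)"
    unfolding computes_def
  proof (intro allI impI)
    fix I \<sigma> w n
    assume a: "fits I n" "clean b \<sigma>" "\<forall>k. \<sigma> (\<rho> k) \<le> n"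
    let ?e = "\<lambda>k. \<sigma> (\<rho> k)"
    define m where "m = f I ?e"
    have m: "m \<le> v n" unfolding m_def using v a by (simp add: value_bound_def)
    define S where "S i = \<sigma>(b := \<Sum>j<i. g I ?e j, b + 1 := m - i, b + 2 := i)" for i
    have zero: "\<sigma> i = 0" if "b \<le> i" for i using a(2) that by (simp add: clean_def)
    have "clean (b + 1) \<sigma>" using a(2) by (simp add: clean_def)
    then have "runs I c1 (\<sigma>, w) (T n) (\<sigma>(b + 1 := m), w)"
      using c1(2) a unfolding computes_def m_def by blast
    moreover have "\<sigma>(b + 1 := m) = S 0" by (auto simp: S_def zero fun_eq_iff)
    ultimately have start: "runs I c1 (\<sigma>, w) (T n) (S 0, w)" by simp
    have loop: "runs I (While (b + 1) nonzero ?body) (S 0, w) (m * (?t n + 2) + 1) (S m, w)"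
    proof (rule runs_While[where S = "\<lambda>i. (S i, w)"])
      fix i assume i: "i < m"
      show "nonzero (view I (fst (S i, w)) (b + 1))"
        unfolding view_nonzero using i by (simp add: S_def)
      let ?\<tau> = "(S i)(b + 1 := m - Suc i)"
      have dec: "runs I (Dec (b + 1)) (S i, w) 1 (?\<tau>, w)"
        by (rule runs_cong[OF runs_Dec]) (auto simp: S_def)
      have env: "(\<lambda>k. ?\<tau> (case_nat (b + 2) \<rho> k)) = case_nat i ?e"
        using env_bind[OF l, of ?\<tau> \<sigma> "b + 2"] by (simp add: S_def)
      have body: "runs I c2 (?\<tau>, w) (U (n + v n)) (?\<tau>(b + 3 := g I ?e i), w)"
      proof -
        have \<rho>: "\<rho> k \<noteq> b \<and> \<rho> k \<noteq> Suc b \<and> \<rho> k \<noteq> Suc (Suc b)" for k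
          using l by (simp add: layout_def less_imp_neq less_SucI)
        have cl: "clean (b + 3) ?\<tau>"
          using a(2) b by (auto simp: clean_def S_def)
        have le: "case_nat i ?e k \<le> n + v n" for k
          using a(3) i m by (intro case_nat_le) (auto intro: trans_le_add1)
        show ?thesis
          using c2(2)[unfolded computes_def, rule_format, where \<sigma> = ?\<tau> and w = w,
              OF fits_mono[OF a(1) le_add1] cl ord_eq_le_trans[OF fun_cong[OF env] le]] \<rho>
          by (simp add: S_def)
      qed
      have gi: "g I ?e i \<le> u (n + v n)"
        using g_bound a i by (simp add: m_def)
      have "runs I ?body (S i, w)
          (1 + (U (n + v n) + (5 * g I ?e i + 1 + 1 + 1) + 1) + 1) (S (Suc i), w)"
        by (intro runs_cong[OF runs_Seq[OF dec runs_Seq[OF body runs_Seq[OF runs_move runs_Inc]]]])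
          (auto simp: S_def fun_eq_iff zero)
      then show "runs I ?body (S i, w) (?t n) (S (Suc i), w)"
        by (rule runs_mono) (use gi in simp)
    next
      show "\<not> nonzero (view I (fst (S m, w)) (b + 1))"
        unfolding view_nonzero by (simp add: S_def)
    qed
    have fin: "runs I (While (b + 2) nonzero (Dec (b + 2))) (S m, w) (3 * m + 1)
        (\<sigma>(b := \<Sum>i<m. g I ?e i), w)"
      by (intro runs_cong[OF runs_clear]) (auto simp: S_def zero fun_eq_iff)
    have "runs I ?c (\<sigma>, w) (T n + (m * (?t n + 2) + 1 + (3 * m + 1) + 1) + 1)
        (\<sigma>(b := \<Sum>i<m. g I ?e i), w)"
      by (rule runs_Seq[OF start runs_Seq[OF loop fin]])
    moreover have "m * (?t n + 2) \<le> v n * (?t n + 2)" using m by (rule mult_le_mono1)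
    ultimately show "runs I ?c (\<sigma>, w) (T n + v n * (?t n + 2) + 3 * v n + 4)
        (\<sigma>(b := \<Sum>i<f I ?e. g I ?e i), w)"
      unfolding m_def[symmetric] using m by (elim runs_mono) linarith
  qed
  then show "\<exists>c T. poly_bounded T \<and> computes c \<rho> b (\<lambda>I e. \<Sum>i < f I e. g I e i) T"
    by (rule ex_computes) (intro poly_bounded_intros poly_bounded_compose[OF u(1)]
        poly_bounded_compose[OF c2(1)] c1(1) v(1))
qed

section \<open>Access to the input words\<close>

lemma definable_length:
  assumes r: "r < 2"
  shows "definable (\<lambda>I e. length (I r))"
  unfolding definable_def
proof (intro conjI allI impI)
  have len: "length (I r) \<le> n" if "fits I n" for I n
    using r that by (auto simp: fits_def less_2_cases_iff)
  then have "value_bound (\<lambda>I e. length (I r)) (\<lambda>n. n)"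
    by (simp add: value_bound_def)
  then show "\<exists>v. poly_bounded v \<and> value_bound (\<lambda>I e. length (I r)) v"
    by (rule ex_value_bound) (rule poly_bounded_id)
  fix \<rho> b assume l: "layout \<rho> b"
  \<comment> \<open>Reduction modulo 3 removes the mark of cell 0; the remaining value 0 is the
    blank behind the input.\<close>
  let ?P = "\<lambda>s :: nat. s mod 3 \<noteq> 0"
  let ?c = "Seq (While r ?P (Seq (Inc r) (Inc b))) (While r nonzero (Dec r))"
  have "computes ?c \<rho> b (\<lambda>I e. length (I r)) (\<lambda>n. 8 * n + 3)"
    unfolding computes_def
  proof (intro allI impI)
    fix I \<sigma> n and w :: "bool list"
    assume a: "fits I n" "clean b \<sigma>"
    have b: "r \<noteq> b" "\<sigma> r = 0" "\<sigma> b = 0"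
      using layout_ge_2[OF l] r a(2) by (auto simp: clean_def less_2_cases_iff)
    let ?S = "\<lambda>i. (\<sigma>(r := i, b := i), w)"
    have P: "?P (view I \<tau> r) \<longleftrightarrow> \<tau> r < length (I r)" for \<tau>
    proof -
      have "view I \<tau> r mod 3 = symbol_at (I r) (\<tau> r)"
        using symbol_at_le_2[of "I r" "\<tau> r"] by (auto simp: view_def)
      then show ?thesis using symbol_at_eq_0_iff[of "I r" "\<tau> r"] by auto
    qed
    have "runs I (While r ?P (Seq (Inc r) (Inc b))) (?S 0) (length (I r) * (3 + 2) + 1)
        (?S (length (I r)))"
    proof (rule runs_While)
      fix i
      show "runs I (Seq (Inc r) (Inc b)) (?S i) 3 (?S (Suc i))"
        using b by (intro runs_cong[OF runs_Seq[OF runs_Inc runs_Inc]]) auto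
    next
      fix i assume "i < length (I r)"
      then show "?P (view I (fst (?S i)) r)" unfolding P using b by simp
    next
      show "\<not> ?P (view I (fst (?S (length (I r)))) r)" unfolding P using b by simp
    qed
    moreover have "?S 0 = (\<sigma>, w)" using b by auto
    ultimately have "runs I (While r ?P (Seq (Inc r) (Inc b))) (\<sigma>, w)
        (length (I r) * (3 + 2) + 1) (?S (length (I r)))" by simp
    from runs_Seq[OF this runs_clear]
    show "runs I ?c (\<sigma>, w) (8 * n + 3) (\<sigma>(b := length (I r)), w)"
      by (rule runs_cong) (use b len[OF a(1)] in \<open>auto simp: fun_eq_iff\<close>)
  qed
  then show "\<exists>c T. poly_bounded T \<and> computes c \<rho> b (\<lambda>I e. length (I r)) T"
    by (rule ex_computes) (intro poly_bounded_intros)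
qed

text \<open>The position is transferred from the result register to the input head, which then scans
  the wanted cell. Afterwards the head returns to cell 0, as a clean store demands.\<close>

lemma definable_read:
  assumes r: "r < 2" and f: "definable f"
  shows "definable (\<lambda>I e. symbol_at (I r) (f I e))"
  unfolding definable_def
proof (intro conjI allI impI)
  have "value_bound (\<lambda>I e. symbol_at (I r) (f I e)) (\<lambda>n. 2)"
    by (simp add: value_bound_def symbol_at_le_2)
  then show "\<exists>v. poly_bounded v \<and> value_bound (\<lambda>I e. symbol_at (I r) (f I e)) v"
    by (rule ex_value_bound) (rule poly_bounded_const)
  obtain v where v: "poly_bounded v" "value_bound f v" using f by (rule definable_value_bound)
  fix \<rho> b assume l: "layout \<rho> b"
  obtain c T where c: "poly_bounded T" "computes c \<rho> b f T"
    using f l by (rule definable_program)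
  let ?p = "If r (\<lambda>s. s mod 3 = 0) Skip (If r (\<lambda>s. s mod 3 = 1) (Inc b) (Seq (Inc b) (Inc b)))"
  let ?c = "Seq c (Seq (While b nonzero (Seq (Dec b) (Inc r))) (Seq ?p (While r nonzero (Dec r))))"
  have "computes ?c \<rho> b (\<lambda>I e. symbol_at (I r) (f I e)) (\<lambda>n. T n + 8 * v n + 10)"
    unfolding computes_def
  proof (intro allI impI)
    fix I \<sigma> w n
    assume a: "fits I n" "clean b \<sigma>" "\<forall>k. \<sigma> (\<rho> k) \<le> n"
    let ?x = "f I (\<lambda>k. \<sigma> (\<rho> k))"
    have x: "?x \<le> v n" using v a by (simp add: value_bound_def)
    have b: "r \<noteq> b" "\<sigma> r = 0" "\<sigma> b = 0"
      using layout_ge_2[OF l] r a(2) by (auto simp: clean_def less_2_cases_iff)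
    have m: "view I \<tau> r mod 3 = symbol_at (I r) (\<tau> r)" for \<tau>
      using symbol_at_le_2[of "I r" "\<tau> r"] by (auto simp: view_def)
    have "runs I c (\<sigma>, w) (T n) (\<sigma>(b := ?x), w)"
      using c a by (simp add: computes_def)
    moreover have "runs I (While b nonzero (Seq (Dec b) (Inc r))) (\<sigma>(b := ?x), w) (5 * ?x + 1)
        (\<sigma>(r := ?x), w)"
      using b by (intro runs_cong[OF runs_move]) (auto simp: fun_eq_iff)
    moreover have "runs I ?p (\<sigma>(r := ?x), w) (3 + 1 + 1) (\<sigma>(r := ?x, b := symbol_at (I r) ?x), w)"
    proof -
      let ?\<tau> = "\<sigma>(r := ?x)"
      consider "symbol_at (I r) ?x = 0" | "symbol_at (I r) ?x = 1" | "symbol_at (I r) ?x = 2"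
        using symbol_at_le_2[of "I r" ?x] by linarith
      then show ?thesis
      proof cases
        case 1
        then have "runs I Skip (?\<tau>, w) (3 + 1) (?\<tau>(b := symbol_at (I r) ?x), w)"
          using b by (intro runs_cong[OF runs_Skip[of _ _ 0]]) (auto simp: fun_eq_iff)
        then show ?thesis by (intro runs_If) (simp add: m 1)
      next
        case 2
        then have "runs I (Inc b) (?\<tau>, w) 3 (?\<tau>(b := symbol_at (I r) ?x), w)"
          using b by (intro runs_cong[OF runs_Inc]) (auto simp: fun_eq_iff)
        then have "runs I (If r (\<lambda>s. s mod 3 = 1) (Inc b) (Seq (Inc b) (Inc b)))
            (?\<tau>, w) (3 + 1) (?\<tau>(b := symbol_at (I r) ?x), w)"
          by (intro runs_If) (simp add: m 2)
        then show ?thesis by (intro runs_If) (simp add: m 2)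
      next
        case 3
        then have "runs I (Seq (Inc b) (Inc b)) (?\<tau>, w) 3 (?\<tau>(b := symbol_at (I r) ?x), w)"
          using b by (intro runs_cong[OF runs_Seq[OF runs_Inc runs_Inc]]) (auto simp: fun_eq_iff)
        then have "runs I (If r (\<lambda>s. s mod 3 = 1) (Inc b) (Seq (Inc b) (Inc b)))
            (?\<tau>, w) (3 + 1) (?\<tau>(b := symbol_at (I r) ?x), w)"
          by (intro runs_If) (simp add: m 3)
        then show ?thesis by (intro runs_If) (simp add: m 3)
      qed
    qed
    moreover have "runs I (While r nonzero (Dec r)) (\<sigma>(r := ?x, b := symbol_at (I r) ?x), w) (3 * ?x + 1)
        (\<sigma>(b := symbol_at (I r) ?x), w)"
      using b by (intro runs_cong[OF runs_clear]) (auto simp: fun_eq_iff)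
    ultimately have "runs I ?c (\<sigma>, w)
        (T n + (5 * ?x + 1 + (3 + 1 + 1 + (3 * ?x + 1) + 1) + 1) + 1) (\<sigma>(b := symbol_at (I r) ?x), w)"
      by (intro runs_Seq)
    then show "runs I ?c (\<sigma>, w) (T n + 8 * v n + 10) (\<sigma>(b := symbol_at (I r) ?x), w)"
      by (rule runs_mono) (use x in simp)
  qed
  then show "\<exists>c T. poly_bounded T \<and> computes c \<rho> b (\<lambda>I e. symbol_at (I r) (f I e)) T"
    by (rule ex_computes) (intro poly_bounded_intros c(1) v(1))
qed

section \<open>Derived arithmetic, decidable predicates and bounded quantifiers\<close>

lemma definable_shift: "definable f \<Longrightarrow> definable (\<lambda>I e. f I (\<lambda>k. e (Suc k)))"
  by (rule definable_rename)

text \<open>Substitution by binding the argument: a function of the inputs and one number need only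
  be treated at variable 0.\<close>

lemma definable_app:
  assumes "definable (\<lambda>I e. h I (e 0))" "definable f"
  shows "definable (\<lambda>I e. h I (f I e))"
  using definable_let[of f "\<lambda>I e x. h I x"] assms by simp

lemma definable_mult:
  assumes "definable f" "definable g"
  shows "definable (\<lambda>I e. f I e * g I e)"
  using definable_sum[OF assms(1), of "\<lambda>I e i. g I e"] definable_shift[OF assms(2)] by simp

lemma definable_of_bool: "decidable P \<Longrightarrow> definable (\<lambda>I e. of_bool (P I e))"
  by (simp add: decidable_def)

lemma definable_if:
  assumes "decidable P" "definable f" "definable g"
  shows "definable (\<lambda>I e. if P I e then f I e else g I e)"
  using definable_if_nonzero[OF assms(1)[unfolded decidable_def] assms(2,3)]
  by (simp cong: if_cong)

lemma decidable_nonzero: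
  assumes "definable f"
  shows "decidable (\<lambda>I e. f I e \<noteq> 0)"
  using definable_if_nonzero[OF assms definable_const[of 1] definable_const[of 0]]
  by (simp add: decidable_def of_bool_def)

lemma decidable_not:
  assumes "decidable P"
  shows "decidable (\<lambda>I e. \<not> P I e)"
proof -
  have "(\<lambda>I e. of_bool (\<not> P I e)) = (\<lambda>I e. if P I e then 0 else 1 :: nat)"
    by (auto simp: fun_eq_iff)
  then show ?thesis
    using definable_if[OF assms definable_const[of 0] definable_const[of 1]]
    by (simp only: decidable_def)
qed

lemma decidable_conj:
  assumes "decidable P" "decidable Q"
  shows "decidable (\<lambda>I e. P I e \<and> Q I e)"
  using definable_mult[OF assms[unfolded decidable_def]]
  by (simp add: decidable_def of_bool_conj)

lemma decidable_disj:
  assumes "decidable P" "decidable Q"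
  shows "decidable (\<lambda>I e. P I e \<or> Q I e)"
  using decidable_not[OF decidable_conj[OF assms[THEN decidable_not]]] by simp

lemma decidable_imp:
  assumes "decidable P" "decidable Q"
  shows "decidable (\<lambda>I e. P I e \<longrightarrow> Q I e)"
  using decidable_disj[OF decidable_not[OF assms(1)] assms(2)] by (simp only: imp_conv_disj)

lemma decidable_const: "decidable (\<lambda>I e. B)"
  by (simp add: decidable_def definable_const)

lemma decidable_le:
  assumes "definable f" "definable g"
  shows "decidable (\<lambda>I e. f I e \<le> g I e)"
  using decidable_not[OF decidable_nonzero[OF definable_diff[OF assms]]] by simp

lemma decidable_less:
  assumes "definable f" "definable g"
  shows "decidable (\<lambda>I e. f I e < g I e)"
  using decidable_not[OF decidable_le[OF assms(2,1)]] by (simp add: not_le)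

lemma decidable_eq:
  assumes "definable f" "definable g"
  shows "decidable (\<lambda>I e. f I e = g I e)"
  using decidable_conj[OF decidable_le[OF assms] decidable_le[OF assms(2,1)]]
  by (simp add: eq_iff)

text \<open>The number of witnesses below the bound is a definable sum, and it is nonzero iff there
  is one.\<close>

lemma decidable_ex_less:
  assumes "definable f" "decidable (\<lambda>I e. P I (\<lambda>k. e (Suc k)) (e 0))"
  shows "decidable (\<lambda>I e. \<exists>i < f I e. P I e i)"
proof -
  have "definable (\<lambda>I e. \<Sum>i < f I e. of_bool (P I e i))"
    using assms by (intro definable_sum) (simp_all add: decidable_def)
  then have "decidable (\<lambda>I e. (\<Sum>i < f I e. of_bool (P I e i)) \<noteq> (0 :: nat))"
    by (rule decidable_nonzero)
  moreover have "(\<Sum>i<m. of_bool (Q i)) \<noteq> (0 :: nat) \<longleftrightarrow> (\<exists>i<m. Q i)" for m :: nat and Q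
    by (auto simp del: sum_of_bool_eq)
  ultimately show ?thesis by (simp only:)
qed

lemma decidable_all_less:
  assumes "definable f" "decidable (\<lambda>I e. P I (\<lambda>k. e (Suc k)) (e 0))"
  shows "decidable (\<lambda>I e. \<forall>i < f I e. P I e i)"
  using decidable_not[OF decidable_ex_less[OF assms(1) decidable_not[OF assms(2)]]] by simp

text \<open>The number \<open>K\<close> of cases is fixed, so the predicates \<open>P r\<close> need
  not be uniform in \<open>r\<close>. This handles lookups in the finite tables of a fixed
  machine.\<close>

lemma decidable_cases:
  assumes "\<And>r. r < K \<Longrightarrow> decidable (P r)" "definable f"
  shows "decidable (\<lambda>I e. f I e < K \<and> P (f I e) I e)"
  using assms(1)
proof (induction K)
  case 0
  then show ?case by (simp add: decidable_const)
next
  case (Suc K)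
  have "decidable (\<lambda>I e. f I e < K \<and> P (f I e) I e \<or> f I e = K \<and> P K I e)"
    using Suc assms(2)
    by (intro decidable_disj[OF Suc.IH] decidable_conj decidable_eq definable_const) auto
  moreover have "(f I e < Suc K \<and> P (f I e) I e) \<longleftrightarrow>
      (f I e < K \<and> P (f I e) I e \<or> f I e = K \<and> P K I e)" for I e
    by (auto simp: less_Suc_eq)
  ultimately show ?case by simp
qed

lemma definable_poly:
  assumes "definable f"
  shows "definable (\<lambda>I e. poly p (f I e))"
proof (induction p)
  case 0
  then show ?case by (simp add: definable_const)
next
  case (pCons a p)
  then show ?case by (simp add: definable_add definable_const definable_mult assms)
qed

text \<open>The quotient counts the positive multiples of \<open>d\<close> up to \<open>m\<close>,
  whose multipliers are at most \<open>m\<close>.\<close>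

lemma div_eq_sum: "0 < d \<Longrightarrow> m div d = (\<Sum>i<m. of_bool (Suc i * d \<le> m))" for m d :: nat
proof -
  assume d: "0 < d"
  have "{i. i < m \<and> Suc i * d \<le> m} = {..<m div d}"
  proof -
    have "Suc i * d \<le> m \<longleftrightarrow> i < m div d" for i
      using d by (metis Suc_le_eq less_eq_div_iff_mult_less_eq)
    moreover have "m div d \<le> m" by simp
    ultimately show ?thesis by (auto intro: less_le_trans)
  qed
  then have "card ({..<m} \<inter> {i. Suc i * d \<le> m}) = m div d"
    by (simp add: lessThan_def Collect_conj_eq[symmetric])
  then show ?thesis by (simp del: mult_Suc)
qed

lemma definable_div:
  assumes "definable f" "definable g"
  shows "definable (\<lambda>I e. f I e div g I e)"
proof -
  \<comment> \<open>The guard reproduces the convention \<open>m div 0 = 0\<close>; for divisor 0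
    the sum would be \<open>m\<close>.\<close>
  have "definable (\<lambda>I e. if 0 < g I e then \<Sum>i<f I e. of_bool (Suc i * g I e \<le> f I e) else 0)"
    by (intro definable_if definable_sum decidable_less decidable_le definable_of_bool definable_mult
        definable_Suc definable_var definable_shift[OF assms(1)] definable_shift[OF assms(2)]
        definable_const assms)
  moreover have "(if 0 < d then \<Sum>i<m. of_bool (Suc i * d \<le> m) else 0) = m div d" for m d :: nat
    using div_eq_sum[of d m] by simp
  ultimately show ?thesis by (simp only:)
qed

lemma definable_mod:
  assumes "definable f" "definable g"
  shows "definable (\<lambda>I e. f I e mod g I e)"
  using definable_diff[OF assms(1) definable_mult[OF assms(2) definable_div[OF assms]]]
  by (simp add: minus_mult_div_eq_mod)

lemmas definable_intros =
  definable_var definable_const definable_add definable_diff definable_mult definable_if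
  definable_of_bool definable_sum definable_div definable_mod definable_Suc
  decidable_conj decidable_disj decidable_not decidable_imp decidable_le decidable_less decidable_eq
  decidable_ex_less decidable_all_less

section \<open>Emittable words\<close>

lemma emittable_Nil: "emittable (\<lambda>I e. [])"
proof -
  have "emits Skip \<rho> b (\<lambda>I e. []) (\<lambda>n. 0)" for \<rho> b
    by (simp add: emits_def runs_Skip)
  then show ?thesis unfolding emittable_def using poly_bounded_const by blast
qed

lemma emittable_bit: "emittable (\<lambda>I e. [x])"
proof -
  have "emits (Out x) \<rho> b (\<lambda>I e. [x]) (\<lambda>n. 1)" for \<rho> b
    using runs_Out by (simp add: emits_def)
  then show ?thesis unfolding emittable_def using poly_bounded_const by blast
qed

lemma emittable_append:
  assumes f: "emittable f" and g: "emittable g"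
  shows "emittable (\<lambda>I e. f I e @ g I e)"
  unfolding emittable_def
proof (intro allI impI)
  fix \<rho> b assume l: "layout \<rho> b"
  obtain c1 T where c1: "poly_bounded T" "emits c1 \<rho> b f T"
    using f l by (rule emittable_program)
  obtain c2 U where c2: "poly_bounded U" "emits c2 \<rho> b g U"
    using g l by (rule emittable_program)
  have "emits (Seq c1 c2) \<rho> b (\<lambda>I e. f I e @ g I e) (\<lambda>n. T n + U n + 1)"
    unfolding emits_def
  proof (intro allI impI)
    fix I \<sigma> w n
    assume a: "fits I n" "clean b \<sigma>" "\<forall>k. \<sigma> (\<rho> k) \<le> n"
    have r1: "runs I c1 (\<sigma>, w) (T n) (\<sigma>, w @ f I (\<lambda>k. \<sigma> (\<rho> k)))"
      using c1(2) a by (simp add: emits_def)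
    have r2: "runs I c2 (\<sigma>, v) (U n) (\<sigma>, v @ g I (\<lambda>k. \<sigma> (\<rho> k)))" for v
      using c2(2) a by (simp add: emits_def)
    show "runs I (Seq c1 c2) (\<sigma>, w) (T n + U n + 1)
        (\<sigma>, w @ f I (\<lambda>k. \<sigma> (\<rho> k)) @ g I (\<lambda>k. \<sigma> (\<rho> k)))"
      using runs_Seq[OF r1 r2] by simp
  qed
  then show "\<exists>c T. poly_bounded T \<and> emits c \<rho> b (\<lambda>I e. f I e @ g I e) T"
    by (rule ex_emits) (intro poly_bounded_intros c1(1) c2(1))
qed

lemma emittable_if:
  assumes p: "decidable P" and f: "emittable f" and g: "emittable g"
  shows "emittable (\<lambda>I e. if P I e then f I e else g I e)"
  unfolding emittable_def
proof (intro allI impI)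
  fix \<rho> b assume l: "layout \<rho> b"
  obtain c T where c: "poly_bounded T" "computes c \<rho> b (\<lambda>I e. of_bool (P I e)) T"
    using p[unfolded decidable_def] l by (rule definable_program)
  obtain c1 T1 where c1: "poly_bounded T1" "emits c1 \<rho> b f T1"
    using f l by (rule emittable_program)
  obtain c2 T2 where c2: "poly_bounded T2" "emits c2 \<rho> b g T2"
    using g l by (rule emittable_program)
  let ?c = "Seq c (If b nonzero (Seq (Dec b) c1) c2)"
  have "emits ?c \<rho> b (\<lambda>I e. if P I e then f I e else g I e) (\<lambda>n. T n + T1 n + T2 n + 4)"
    unfolding emits_def
  proof (intro allI impI)
    fix I \<sigma> w n
    assume a: "fits I n" "clean b \<sigma>" "\<forall>k. \<sigma> (\<rho> k) \<le> n"
    let ?e = "\<lambda>k. \<sigma> (\<rho> k)"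
    have r: "runs I c (\<sigma>, w) (T n) (\<sigma>(b := of_bool (P I ?e)), w)"
      using c(2) a by (simp add: computes_def)
    have b: "\<sigma> b = 0" using a(2) by (simp add: clean_def)
    have "runs I (If b nonzero (Seq (Dec b) c1) c2) (\<sigma>(b := of_bool (P I ?e)), w)
        (T1 n + T2 n + 2 + 1) (\<sigma>, w @ (if P I ?e then f I ?e else g I ?e))"
    proof (rule runs_If, unfold view_nonzero, cases "P I ?e")
      case True
      have "runs I c1 (\<sigma>, w) (T1 n) (\<sigma>, w @ f I ?e)"
        using c1(2) a by (simp add: emits_def)
      moreover have "runs I (Dec b) (\<sigma>(b := of_bool (P I ?e)), w) 1 (\<sigma>, w)"
        using b True by (intro runs_cong[OF runs_Dec]) auto
      ultimately have "runs I (Seq (Dec b) c1) (\<sigma>(b := of_bool (P I ?e)), w) (1 + T1 n + 1)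
          (\<sigma>, w @ f I ?e)"
        by (rule runs_Seq[rotated])
      then have "runs I (Seq (Dec b) c1) (\<sigma>(b := of_bool (P I ?e)), w) (T1 n + T2 n + 2)
          (\<sigma>, w @ f I ?e)"
        by (rule runs_mono) simp
      then show "runs I (if fst (\<sigma>(b := of_bool (P I ?e)), w) b \<noteq> 0 then Seq (Dec b) c1 else c2)
          (\<sigma>(b := of_bool (P I ?e)), w) (T1 n + T2 n + 2)
          (\<sigma>, w @ (if P I ?e then f I ?e else g I ?e))"
        using True by simp
    next
      case False
      have "runs I c2 (\<sigma>, w) (T2 n) (\<sigma>, w @ g I ?e)"
        using c2(2) a by (simp add: emits_def)
      then have "runs I c2 (\<sigma>, w) (T1 n + T2 n + 2) (\<sigma>, w @ g I ?e)"
        by (rule runs_mono) simp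
      moreover have "\<sigma>(b := of_bool (P I ?e)) = \<sigma>" using False b by auto
      ultimately show "runs I (if fst (\<sigma>(b := of_bool (P I ?e)), w) b \<noteq> 0 then Seq (Dec b) c1 else c2)
          (\<sigma>(b := of_bool (P I ?e)), w) (T1 n + T2 n + 2)
          (\<sigma>, w @ (if P I ?e then f I ?e else g I ?e))"
        using False b by simp
    qed
    from runs_Seq[OF r this]
    show "runs I ?c (\<sigma>, w) (T n + T1 n + T2 n + 4) (\<sigma>, w @ (if P I ?e then f I ?e else g I ?e))"
      by (rule runs_mono) simp
  qed
  then show "\<exists>c T. poly_bounded T \<and> emits c \<rho> b (\<lambda>I e. if P I e then f I e else g I e) T"
    by (rule ex_emits) (intro poly_bounded_intros c(1) c1(1) c2(1))
qed

text \<open>The loop is the one for sums, except that its body writes to the output, so no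
  accumulator is kept.\<close>

lemma emittable_concat:
  assumes f: "definable f" and g: "emittable (\<lambda>I e. g I (\<lambda>k. e (Suc k)) (e 0))"
  shows "emittable (\<lambda>I e. concat (map (g I e) [0..<f I e]))"
  unfolding emittable_def
proof (intro allI impI)
  obtain v where v: "poly_bounded v" "value_bound f v" using f by (rule definable_value_bound)
  fix \<rho> b assume l: "layout \<rho> b"
  have b: "2 < b" using l by (rule layout_ge_2)
  obtain c1 T where c1: "poly_bounded T" "computes c1 \<rho> b f T"
    using f l by (rule definable_program)
  have l': "layout (case_nat (b + 1) \<rho>) (b + 2)"
    using l b trans_less_add1 by (intro layout_bind) (unfold layout_def, blast, simp_all)
  obtain c2 U where c2: "poly_bounded U"
      "emits c2 (case_nat (b + 1) \<rho>) (b + 2) (\<lambda>I e. g I (\<lambda>k. e (Suc k)) (e 0)) U"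
    using g l' by (rule emittable_program)
  let ?body = "Seq (Dec b) (Seq c2 (Inc (b + 1)))"
  let ?c = "Seq c1 (Seq (While b nonzero ?body) (While (b + 1) nonzero (Dec (b + 1))))"
  let ?t = "\<lambda>n. U (n + v n) + 4"
  have "emits ?c \<rho> b (\<lambda>I e. concat (map (g I e) [0..<f I e]))
      (\<lambda>n. T n + v n * (?t n + 2) + 3 * v n + 4)"
    unfolding emits_def
  proof (intro allI impI)
    fix I \<sigma> w n
    assume a: "fits I n" "clean b \<sigma>" "\<forall>k. \<sigma> (\<rho> k) \<le> n"
    let ?e = "\<lambda>k. \<sigma> (\<rho> k)"
    define m where "m = f I ?e"
    have m: "m \<le> v n" unfolding m_def using v a by (simp add: value_bound_def)
    define R where "R i = \<sigma>(b := m - i, b + 1 := i)" for i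
    define W where "W i = w @ concat (map (g I ?e) [0..<i])" for i
    have zero: "\<sigma> i = 0" if "b \<le> i" for i using a(2) that by (simp add: clean_def)
    have "runs I c1 (\<sigma>, w) (T n) (\<sigma>(b := m), w)"
      using c1(2) a unfolding computes_def m_def by blast
    moreover have "\<sigma>(b := m) = R 0" by (auto simp: R_def zero fun_eq_iff)
    moreover have "W 0 = w" by (simp add: W_def)
    ultimately have start: "runs I c1 (\<sigma>, w) (T n) (R 0, W 0)" by simp
    have loop: "runs I (While b nonzero ?body) (R 0, W 0) (m * (?t n + 2) + 1) (R m, W m)"
    proof (rule runs_While[where S = "\<lambda>i. (R i, W i)"])
      fix i assume i: "i < m"
      show "nonzero (view I (fst (R i, W i)) b)"
        unfolding view_nonzero using i by (simp add: R_def)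
      let ?\<tau> = "(R i)(b := m - Suc i)"
      have dec: "runs I (Dec b) (R i, W i) 1 (?\<tau>, W i)"
        by (rule runs_cong[OF runs_Dec]) (auto simp: R_def)
      have env: "(\<lambda>k. ?\<tau> (case_nat (b + 1) \<rho> k)) = case_nat i ?e"
        using env_bind[OF l, of ?\<tau> \<sigma> "b + 1"] by (simp add: R_def)
      have body: "runs I c2 (?\<tau>, W i) (U (n + v n)) (?\<tau>, W i @ g I ?e i)"
      proof -
        have \<rho>: "\<rho> k \<noteq> b \<and> \<rho> k \<noteq> Suc b" for k
          using l by (simp add: layout_def less_imp_neq less_SucI)
        have cl: "clean (b + 2) ?\<tau>"
          using a(2) b by (auto simp: clean_def R_def)
        have le: "case_nat i ?e k \<le> n + v n" for k
          using a(3) i m by (intro case_nat_le) (auto intro: trans_le_add1)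
        show ?thesis
          using c2(2)[unfolded emits_def, rule_format, where \<sigma> = ?\<tau> and w = "W i",
              OF fits_mono[OF a(1) le_add1] cl ord_eq_le_trans[OF fun_cong[OF env] le]] \<rho>
          by (simp add: R_def)
      qed
      have "runs I ?body (R i, W i) (1 + (U (n + v n) + 1 + 1) + 1) (R (Suc i), W (Suc i))"
        by (intro runs_cong[OF runs_Seq[OF dec runs_Seq[OF body runs_Inc]]])
          (auto simp: R_def W_def fun_eq_iff)
      then show "runs I ?body (R i, W i) (?t n) (R (Suc i), W (Suc i))"
        by (rule runs_mono) simp
    next
      show "\<not> nonzero (view I (fst (R m, W m)) b)"
        unfolding view_nonzero by (simp add: R_def)
    qed
    have fin: "runs I (While (b + 1) nonzero (Dec (b + 1))) (R m, W m) (3 * m + 1) (\<sigma>, W m)"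
      by (intro runs_cong[OF runs_clear]) (auto simp: R_def zero fun_eq_iff)
    have "runs I ?c (\<sigma>, w) (T n + (m * (?t n + 2) + 1 + (3 * m + 1) + 1) + 1) (\<sigma>, W m)"
      by (rule runs_Seq[OF start runs_Seq[OF loop fin]])
    moreover have "m * (?t n + 2) \<le> v n * (?t n + 2)" using m by (rule mult_le_mono1)
    ultimately show "runs I ?c (\<sigma>, w) (T n + v n * (?t n + 2) + 3 * v n + 4)
        (\<sigma>, w @ concat (map (g I ?e) [0..<f I ?e]))"
      unfolding m_def[symmetric] W_def using m by (elim runs_mono) linarith
  qed
  then show "\<exists>c T. poly_bounded T \<and> emits c \<rho> b (\<lambda>I e. concat (map (g I e) [0..<f I e])) T"
    by (rule ex_emits) (intro poly_bounded_intros poly_bounded_compose[OF c2(1)] c1(1) v(1))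
qed

lemma emittable_enc_nat:
  assumes "definable f"
  shows "emittable (\<lambda>I e. enc_nat (f I e))"
proof -
  have "emittable (\<lambda>I e. concat (map (\<lambda>_. [True]) [0..<f I e]) @ [False])"
    by (intro emittable_append emittable_concat emittable_bit assms)
  moreover have "concat (map (\<lambda>_. [True]) [0..<m]) = replicate m True" for m
    by (induction m) (auto simp: replicate_append_same)
  ultimately show ?thesis by (simp add: enc_nat_def)
qed

lemma emittable_tm:
  assumes "emittable f"
  obtains M and p :: "nat poly" where "wf_tm M" "2 \<le> tm_tapes M"
    "\<And>ws. length ws \<le> 2 \<Longrightarrow>
       tm_outputs M ws (f (\<lambda>i. if i < length ws then ws ! i else []) (\<lambda>_. 0))
         (poly p (sum_list (map length ws)))"
proof -
  \<comment> \<open>At the top level no variable is bound: all indices share register 2, which holds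
    0.\<close>
  have "layout (\<lambda>_. 2) 3" by (simp add: layout_def)
  with assms obtain c T where c: "poly_bounded T" "emits c (\<lambda>_. 2) 3 f T"
    by (rule emittable_program)
  obtain p :: "nat poly" where p: "\<And>n. T n \<le> poly p n"
    using c(1) by (auto simp: poly_bounded_def)
  \<comment> \<open>At least two register tapes, so that both inputs fit even if the program does
    not mention them.\<close>
  define k where "k = Suc (Suc (Max (insert 0 (regs c))))"
  have "r < k" if "r \<in> regs c" for r
    using that finite_regs[of c] by (simp add: k_def less_Suc_eq_le le_SucI Max_ge)
  from com_tm_outputs[OF this] obtain M where M: "wf_tm M" "tm_tapes M = Suc k"
    "\<And>ws \<sigma> w t. length ws \<le> k \<Longrightarrow>
       runs (\<lambda>i. if i < length ws then ws ! i else []) c (\<lambda>_. 0, []) t (\<sigma>, w) \<Longrightarrow>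
       tm_outputs M ws w (Suc t)"
    by blast
  \<comment> \<open>The added 1 in the time bound pays for the marking step.\<close>
  have "tm_outputs M ws (f (\<lambda>i. if i < length ws then ws ! i else []) (\<lambda>_. 0))
         (poly (p + 1) (sum_list (map length ws)))" if ws: "length ws \<le> 2" for ws
  proof -
    let ?I = "\<lambda>i. if i < length ws then ws ! i else []"
    let ?n = "sum_list (map length ws)"
    have "length (ws ! i) \<le> ?n" if "i < length ws" for i
      using that by (auto intro!: member_le_sum_list)
    then have "fits ?I ?n" by (simp add: fits_def)
    then have "runs ?I c (\<lambda>_. 0, []) (T ?n) (\<lambda>_. 0, [] @ f ?I (\<lambda>_. 0))"
      using c(2)[unfolded emits_def, rule_format, of ?I ?n "\<lambda>_. 0" "[]"] by (simp add: clean_def)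
    then have "runs ?I c (\<lambda>_. 0, []) (poly p ?n) (\<lambda>_. 0, f ?I (\<lambda>_. 0))"
      using p by (simp add: runs_mono)
    then have "tm_outputs M ws (f ?I (\<lambda>_. 0)) (Suc (poly p ?n))"
      using ws by (intro M(3)) (auto simp: k_def)
    then show ?thesis by simp
  qed
  then show thesis
    using that[of M "p + 1"] M by (simp add: k_def)
qed

lemma polytime_funI:
  assumes "emittable (\<lambda>I e. f (I 0))"
  shows "polytime_fun f"
proof -
  obtain M and p :: "nat poly" where M: "wf_tm M" "\<And>ws. length ws \<le> 2 \<Longrightarrow>
       tm_outputs M ws (f (if 0 < length ws then ws ! 0 else []))
         (poly p (sum_list (map length ws)))"
    using emittable_tm[OF assms] by metis
  show ?thesis
    unfolding polytime_fun_def using M(1) M(2)[of "[_]"] by auto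
qed

lemma polytime_relI:
  assumes "decidable (\<lambda>I e. r (I 0) (I 1))"
  shows "polytime_rel r"
proof -
  have "emittable (\<lambda>I e. if r (I 0) (I 1) then [True] else [False])"
    by (intro emittable_if emittable_bit assms)
  moreover have "(if b then [True] else [False]) = [b]" for b by simp
  ultimately have "emittable (\<lambda>I e. [r (I 0) (I 1)])" by (simp only:)
  then show ?thesis
  proof (rule emittable_tm)
    fix M and p :: "nat poly"
    assume M: "wf_tm M" "2 \<le> tm_tapes M"
      "\<And>ws. length ws \<le> 2 \<Longrightarrow>
         tm_outputs M ws [r (if 0 < length ws then ws ! 0 else []) (if 1 < length ws then ws ! 1 else [])]
           (poly p (sum_list (map length ws)))"
    have "tm_outputs M [x, u] [r x u] (poly p (length x + length u))" for x u
      using M(3)[of "[x, u]"] by simp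
    with M(1,2) show ?thesis unfolding polytime_rel_def by blast
  qed
qed

section \<open>The formula\<close>

text \<open>Variables 0, 1, 2 are c, v, s, and 3 is auxiliary. \<open>IExists 3 (Eq x 3)\<close>
  says that x is constant in the team, so the implication between two constancies, being evaluated
  on all subteams, is a dependence. The conclusion says that some element is not a value of variable
  0.\<close>

definition csp_form :: form where
  "csp_form = Impl (Impl (IExists 3 (Eq 1 3)) (IExists 3 (Eq 2 3))) (IExists 3 (Impl (Eq 0 3) Bot))"

text \<open>\<open>A\<close> is a set of row indices rather than of rows, since the list that codes
  a team may contain repetitions.\<close>

definition csp_sat ::
  "nat \<Rightarrow> nat \<Rightarrow> (nat \<Rightarrow> nat) \<Rightarrow> (nat \<Rightarrow> nat) \<Rightarrow> (nat \<Rightarrow> nat) \<Rightarrow> bool" where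
  "csp_sat n l c v s \<longleftrightarrow> (\<exists>A \<subseteq> {..<l}.
     (\<forall>a\<in>A. \<forall>b\<in>A. v a = v b \<longrightarrow> s a = s b) \<and> (\<forall>d<n. \<exists>a\<in>A. c a = d))"

lemma csp_sat_cong:
  assumes "\<And>a. a < l \<Longrightarrow> c a = c' a \<and> v a = v' a \<and> s a = s' a"
  shows "csp_sat n l c v s \<longleftrightarrow> csp_sat n l c' v' s'"
proof -
  have "csp_sat n l c v s \<Longrightarrow> csp_sat n l c' v' s'"
    if eq: "\<And>a. a < l \<Longrightarrow> c a = c' a \<and> v a = v' a \<and> s a = s' a" for c v s c' v' s'
  proof -
    assume "csp_sat n l c v s"
    then obtain A where A: "A \<subseteq> {..<l}" "\<forall>a\<in>A. \<forall>b\<in>A. v a = v b \<longrightarrow> s a = s b"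
      "\<forall>d<n. \<exists>a\<in>A. c a = d" unfolding csp_sat_def by blast
    have eq: "c a = c' a" "v a = v' a" "s a = s' a" if "a \<in> A" for a
      using eq[of a] that A(1) by auto
    have "\<forall>a\<in>A. \<forall>b\<in>A. v' a = v' b \<longrightarrow> s' a = s' b" using A(2) eq(2,3) by metis
    moreover have "\<forall>d<n. \<exists>a\<in>A. c' a = d" using A(3) eq(1) by fastforce
    ultimately show ?thesis unfolding csp_sat_def using A(1) by blast
  qed
  from this[of c c' v v' s s'] this[of c' c v' v s' s] assms show ?thesis by auto
qed

lemma support_constancy:
  assumes "x \<noteq> z"
  shows "support M Y (IExists z (Eq x z)) \<longleftrightarrow> (\<exists>d \<in> universe M. \<forall>g \<in> Y. the (g x) = d)"
  using assms by (auto simp: team_upd_def)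

text \<open>On a two-element subteam constancy compares two assignments, which turns the implication
  into dependence. Conversely, any member of a nonempty subteam supplies the constant; the empty
  subteam takes it from the nonempty universe.\<close>

lemma support_dependence:
  assumes "x \<noteq> z" "y \<noteq> z" and U: "universe M \<noteq> {}"
    and Y: "\<And>g. g \<in> Y \<Longrightarrow> the (g x) \<in> universe M \<and> the (g y) \<in> universe M"
  shows "support M Y (Impl (IExists z (Eq x z)) (IExists z (Eq y z))) \<longleftrightarrow>
    (\<forall>g\<in>Y. \<forall>h\<in>Y. the (g x) = the (h x) \<longrightarrow> the (g y) = the (h y))"
    (is "?L \<longleftrightarrow> ?R")
proof
  assume L: ?L
  show ?R
  proof (intro ballI impI)
    fix g h assume gh: "g \<in> Y" "h \<in> Y" "the (g x) = the (h x)"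
    then have "support M {g, h} (IExists z (Eq x z))"
      unfolding support_constancy[OF assms(1)] using Y[of g] by auto
    moreover have "{g, h} \<subseteq> Y" using gh by simp
    ultimately have "support M {g, h} (IExists z (Eq y z))"
      using L by (simp only: support.simps(6))
    then show "the (g y) = the (h y)"
      unfolding support_constancy[OF assms(2)] by auto
  qed
next
  assume R: ?R
  show ?L
    unfolding support.simps(6) support_constancy[OF assms(1)] support_constancy[OF assms(2)]
  proof (intro allI impI)
    fix Z assume Z: "Z \<subseteq> Y" and c: "\<exists>d\<in>universe M. \<forall>g\<in>Z. the (g x) = d"
    show "\<exists>d\<in>universe M. \<forall>g\<in>Z. the (g y) = d"
    proof (cases "Z = {}")
      case True
      then show ?thesis using U by auto
    next
      case False
      then obtain h where h: "h \<in> Z" by blast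
      have "the (g y) = the (h y)" if "g \<in> Z" for g
        using that h c Z R by (metis subsetD)
      then show ?thesis using h Z Y by blast
    qed
  qed
qed

text \<open>Once \<open>d\<close> is fixed, a single assignment with value \<open>d\<close> at
  \<open>x\<close> yields a singleton violating the implication to \<open>Bot\<close>, so the
  implication says that there is none.\<close>

lemma support_missing_value:
  assumes "x \<noteq> z"
  shows "support M Y (IExists z (Impl (Eq x z) Bot)) \<longleftrightarrow>
    (\<exists>d \<in> universe M. \<forall>g \<in> Y. the (g x) \<noteq> d)"
proof -
  have "(\<forall>Z \<subseteq> team_upd Y z d. (\<forall>g\<in>Z. the (g x) = the (g z)) \<longrightarrow> Z = {}) \<longleftrightarrow>
      (\<forall>g\<in>Y. the (g x) \<noteq> d)" (is "?L \<longleftrightarrow> ?R") for d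
  proof
    assume L: ?L
    show ?R
    proof
      fix g assume "g \<in> Y"
      then show "the (g x) \<noteq> d"
        using L[rule_format, of "{g(z \<mapsto> d)}"] assms by (auto simp: team_upd_def)
    qed
  next
    assume R: ?R
    show ?L
    proof (intro allI impI)
      fix Z assume Z: "Z \<subseteq> team_upd Y z d" "\<forall>g\<in>Z. the (g x) = the (g z)"
      show "Z = {}"
        using Z R assms by (fastforce simp: team_upd_def)
    qed
  qed
  then show ?thesis by simp
qed

lemma support_csp_form:
  assumes M: "universe M = {..<n}" "0 < n" and X: "X = set gs"
    and gs: "\<And>g x. g \<in> set gs \<Longrightarrow> x \<in> {0, 1, 2} \<Longrightarrow> the (g x) < n"
  shows "support M X csp_form \<longleftrightarrow> \<not> csp_sat n (length gs)
    (\<lambda>a. the ((gs ! a) 0)) (\<lambda>a. the ((gs ! a) 1)) (\<lambda>a. the ((gs ! a) 2))"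
proof -
  have "support M X csp_form \<longleftrightarrow> \<not> (\<exists>Y \<subseteq> X.
      (\<forall>g\<in>Y. \<forall>h\<in>Y. the (g 1) = the (h 1) \<longrightarrow> the (g 2) = the (h 2)) \<and>
      (\<forall>d<n. \<exists>g\<in>Y. the (g 0) = d))"
  proof -
    have dep: "support M Y (Impl (IExists 3 (Eq 1 3)) (IExists 3 (Eq 2 3))) \<longleftrightarrow>
        (\<forall>g\<in>Y. \<forall>h\<in>Y. the (g 1) = the (h 1) \<longrightarrow> the (g 2) = the (h 2))" if "Y \<subseteq> X" for Y
    proof (rule support_dependence)
      show "universe M \<noteq> {}" using M by auto
      show "the (g 1) \<in> universe M \<and> the (g 2) \<in> universe M" if "g \<in> Y" for g
        using that \<open>Y \<subseteq> X\<close> gs[of g] X M(1) by auto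
    qed simp_all
    have miss: "support M Y (IExists 3 (Impl (Eq 0 3) Bot)) \<longleftrightarrow>
        \<not> (\<forall>d<n. \<exists>g\<in>Y. the (g 0) = d)" for Y
      using support_missing_value[of 0 3 M Y] M by auto
    have "support M X csp_form \<longleftrightarrow> (\<forall>Y \<subseteq> X.
        support M Y (Impl (IExists 3 (Eq 1 3)) (IExists 3 (Eq 2 3))) \<longrightarrow>
        support M Y (IExists 3 (Impl (Eq 0 3) Bot)))"
      unfolding csp_form_def by (rule support.simps(6))
    then show ?thesis
      unfolding miss using dep by metis
  qed
  also have "(\<exists>Y \<subseteq> X.
      (\<forall>g\<in>Y. \<forall>h\<in>Y. the (g 1) = the (h 1) \<longrightarrow> the (g 2) = the (h 2)) \<and>
      (\<forall>d<n. \<exists>g\<in>Y. the (g 0) = d)) \<longleftrightarrow> csp_sat n (length gs)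
    (\<lambda>a. the ((gs ! a) 0)) (\<lambda>a. the ((gs ! a) 1)) (\<lambda>a. the ((gs ! a) 2))" (is "?L \<longleftrightarrow> ?R")
  proof
    assume ?L
    then obtain Y where Y: "Y \<subseteq> X"
      "\<forall>g\<in>Y. \<forall>h\<in>Y. the (g 1) = the (h 1) \<longrightarrow> the (g 2) = the (h 2)"
      "\<forall>d<n. \<exists>g\<in>Y. the (g 0) = d" by blast
    have "\<exists>a\<in>{a. a < length gs \<and> gs ! a \<in> Y}. the ((gs ! a) 0) = d" if d: "d < n" for d
    proof -
      obtain g where g: "g \<in> Y" "the (g 0) = d" using Y(3) d by blast
      then obtain a where "a < length gs" "gs ! a = g"
        using Y(1) X by (metis in_set_conv_nth subsetD)
      then show ?thesis using g by auto
    qed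
    moreover have "{a. a < length gs \<and> gs ! a \<in> Y} \<subseteq> {..<length gs}" by auto
    ultimately show ?R
      unfolding csp_sat_def using Y(2)
      by (intro exI[of _ "{a. a < length gs \<and> gs ! a \<in> Y}"] conjI) blast+
  next
    assume ?R
    then obtain A where A: "A \<subseteq> {..<length gs}"
      "\<forall>a\<in>A. \<forall>b\<in>A. the ((gs ! a) 1) = the ((gs ! b) 1) \<longrightarrow> the ((gs ! a) 2) = the ((gs ! b) 2)"
      "\<forall>d<n. \<exists>a\<in>A. the ((gs ! a) 0) = d" unfolding csp_sat_def by blast
    moreover have "(\<lambda>a. gs ! a) ` A \<subseteq> X" using A(1) X by auto
    ultimately show ?L
      by (intro exI[of _ "(\<lambda>a. gs ! a) ` A"] conjI) blast+
  qed
  finally show ?thesis .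
qed

section \<open>Instances\<close>

text \<open>Over the empty vocabulary the whole code of a structure with its team is a sequence of
  unary numbers and can be parsed as one tuple.\<close>

definition instance_word :: "nat \<Rightarrow> nat list \<Rightarrow> nat list list \<Rightarrow> bool list" where
  "instance_word n vs rows = enc_tuple (n # length vs # vs @ length rows # concat rows)"

definition instance_ok :: "nat \<Rightarrow> nat list \<Rightarrow> nat list list \<Rightarrow> bool" where
  "instance_ok n vs rows \<longleftrightarrow> 0 < n \<and> sorted_wrt (<) vs \<and> {0, 1, 2} \<subseteq> set vs \<and>
     (\<forall>r\<in>set rows. length r = length vs \<and> set r \<subseteq> {..<n})"

definition rows_sat :: "nat \<Rightarrow> nat list list \<Rightarrow> bool" where
  "rows_sat n rows \<longleftrightarrow>
     csp_sat n (length rows) (\<lambda>a. rows ! a ! 0) (\<lambda>a. rows ! a ! 1) (\<lambda>a. rows ! a ! 2)"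

lemma enc_tuple_Nil [simp]: "enc_tuple [] = []"
  by (simp add: enc_tuple_def)

lemma enc_tuple_Cons [simp]: "enc_tuple (k # ks) = enc_nat k @ enc_tuple ks"
  by (simp add: enc_tuple_def)

lemma enc_tuple_append [simp]: "enc_tuple (ks @ ls) = enc_tuple ks @ enc_tuple ls"
  by (simp add: enc_tuple_def)

lemma enc_tuple_concat: "enc_tuple (concat rows) = concat (map enc_tuple rows)"
  by (induction rows) auto

lemma sorted_wrt_less_nth:
  fixes vs :: "nat list"
  assumes "sorted_wrt (<) vs" "i < length vs"
  shows "i \<le> vs ! i"
  using assms(2)
proof (induction i)
  case (Suc i)
  then have "vs ! i < vs ! Suc i" using assms(1) by (simp add: sorted_wrt_nth_less)
  then show ?case using Suc by simp
qed simp

text \<open>In a strictly increasing list entry \<open>i\<close> is at least \<open>i\<close>, so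
  the variables 0, 1, 2 can only stand at positions 0, 1, 2. The first three columns are thus c, v,
  s whatever other variables the team has.\<close>

lemma instance_ok_vars:
  assumes "instance_ok n vs rows"
  shows "3 \<le> length vs" "vs ! 0 = 0" "vs ! 1 = 1" "vs ! 2 = 2"
proof -
  have vs: "sorted_wrt (<) vs" "{0, 1, 2} \<subseteq> set vs"
    using assms by (auto simp: instance_ok_def)
  have ex: "\<exists>i \<le> x. i < length vs \<and> vs ! i = x" if "x \<in> {0, 1, 2}" for x
  proof -
    have "x \<in> set vs" using that vs(2) by blast
    then obtain i where i: "i < length vs" "vs ! i = x" by (meson in_set_conv_nth)
    with sorted_wrt_less_nth[OF vs(1) i(1)] show ?thesis by auto
  qed
  have v0: "0 < length vs \<and> vs ! 0 = 0" using ex[of 0] by simp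
  have v1: "1 < length vs \<and> vs ! 1 = 1" using ex[of 1] v0 by (auto simp: le_Suc_eq)
  have v2: "2 < length vs \<and> vs ! 2 = 2" using ex[of 2] v0 v1 by (auto simp: le_Suc_eq numeral_2_eq_2)
  show "3 \<le> length vs" "vs ! 0 = 0" "vs ! 1 = 1" "vs ! 2 = 2" using v0 v1 v2 by auto
qed

lemma instance_word_encodes:
  assumes "universe M = {..<n}" "finite V"
  shows "encodes [] (instance_word n (sorted_list_of_set V)
      (map (\<lambda>g. map (\<lambda>x. the (g x)) (sorted_list_of_set V)) gs)) M V (set gs)"
  unfolding encodes_def
  by (intro exI[of _ n] exI[of _ "[]"] exI[of _ gs])
    (use assms in \<open>simp add: instance_word_def enc_list_def enc_tuple_concat o_def
       enc_tuple_def[of "sorted_list_of_set V"]\<close>)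

lemma encodes_instance_word:
  assumes "encodes [] w M V X"
  obtains n gs where "universe M = {..<n}" "set gs = X"
    "w = instance_word n (sorted_list_of_set V)
      (map (\<lambda>g. map (\<lambda>x. the (g x)) (sorted_list_of_set V)) gs)"
  using assms unfolding encodes_def
  by (auto simp: instance_word_def enc_list_def enc_tuple_concat o_def
       enc_tuple_def[of "sorted_list_of_set V"])

text \<open>Rows of the right length over a strictly increasing list of variables become assignments
  through \<open>map_of\<close>, so well-formed lists of numbers and encoded teams
  correspond.\<close>

lemma mc_problem_instance:
  "w \<in> mc_problem [] csp_form \<longleftrightarrow>
    (\<exists>n vs rows. instance_ok n vs rows \<and> w = instance_word n vs rows \<and> \<not> rows_sat n rows)"
proof
  assume "w \<in> mc_problem [] csp_form"
  then obtain M :: "nat struct" and V X where a: "is_struct [] M" "is_team M V X" "fv csp_form \<subseteq> V"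
    "encodes [] w M V X" "support M X csp_form"
    by (auto simp: mc_problem_def)
  obtain n gs where n: "universe M = {..<n}" and gs: "set gs = X"
    and w: "w = instance_word n (sorted_list_of_set V)
      (map (\<lambda>g. map (\<lambda>x. the (g x)) (sorted_list_of_set V)) gs)"
    using a(4) by (rule encodes_instance_word)
  let ?vs = "sorted_list_of_set V"
  let ?rows = "map (\<lambda>g. map (\<lambda>x. the (g x)) ?vs) gs"
  have fin: "finite V" and V: "{0, 1, 2} \<subseteq> V"
    using a(2,3) by (auto simp: is_team_def csp_form_def)
  have val: "the (g x) < n" if "g \<in> set gs" "x \<in> V" for g x
  proof -
    have "x \<in> dom g" "ran g \<subseteq> {..<n}"
      using that a(2) gs n by (auto simp: is_team_def)
    then show ?thesis by (auto simp: ran_def dom_def)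
  qed
  have pos: "0 < n" using a(1) n by (auto simp: is_struct_def)
  have ok: "instance_ok n ?vs ?rows"
    using fin V val pos by (auto simp: instance_ok_def)
  have "\<not> csp_sat n (length gs)
    (\<lambda>a. the ((gs ! a) 0)) (\<lambda>a. the ((gs ! a) 1)) (\<lambda>a. the ((gs ! a) 2))"
    using a(5) V val by (subst support_csp_form[OF n pos gs[symmetric], symmetric]) auto
  then have "\<not> rows_sat n ?rows"
    unfolding rows_sat_def using instance_ok_vars[OF ok]
    by (subst (asm) csp_sat_cong[where c' = "\<lambda>a. ?rows ! a ! 0" and v' = "\<lambda>a. ?rows ! a ! 1"
          and s' = "\<lambda>a. ?rows ! a ! 2"]) auto
  then show "\<exists>n vs rows. instance_ok n vs rows \<and> w = instance_word n vs rows \<and> \<not> rows_sat n rows"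
    using ok w by blast
next
  assume "\<exists>n vs rows. instance_ok n vs rows \<and> w = instance_word n vs rows \<and> \<not> rows_sat n rows"
  then obtain n vs rows where ok: "instance_ok n vs rows" and w: "w = instance_word n vs rows"
    and sat: "\<not> rows_sat n rows" by blast
  note vars = instance_ok_vars[OF ok]
  have dist: "distinct vs" and sorted: "sorted vs"
    using ok by (auto simp: instance_ok_def strict_sorted_iff)
  have vs: "sorted_list_of_set (set vs) = vs"
    using dist sorted by (simp add: sorted_list_of_set.idem_if_sorted_distinct)
  define gs where "gs = map (\<lambda>r. map_of (zip vs r)) rows"
  define M :: "nat struct" where "M = \<lparr> universe = {..<n}, interp = (\<lambda>_. {}) \<rparr>"
  have row: "map (\<lambda>x. the (map_of (zip vs r) x)) vs = r" if "r \<in> set rows" for r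
  proof (rule nth_equalityI)
    have "length r = length vs" using that ok by (auto simp: instance_ok_def)
    then show "length (map (\<lambda>x. the (map_of (zip vs r) x)) vs) = length r" by simp
    fix i assume "i < length (map (\<lambda>x. the (map_of (zip vs r) x)) vs)"
    then show "map (\<lambda>x. the (map_of (zip vs r) x)) vs ! i = r ! i"
      using dist \<open>length r = length vs\<close> by (simp add: map_of_zip_nth)
  qed
  then have rows: "map (\<lambda>g. map (\<lambda>x. the (g x)) vs) gs = rows"
    by (simp add: gs_def o_def map_idI)
  have "encodes [] w M (set vs) (set gs)"
    using instance_word_encodes[of M n "set vs" gs] by (simp add: vs rows w M_def)
  moreover have team: "is_team M (set vs) (set gs)"
  proof -
    have "dom (map_of (zip vs r)) = set vs \<and> ran (map_of (zip vs r)) \<subseteq> {..<n}"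
      if "r \<in> set rows" for r
      using that ok dist by (auto simp: instance_ok_def ran_map_of_zip)
    then show ?thesis by (auto simp: is_team_def M_def gs_def)
  qed
  moreover have "is_struct [] M" using ok by (auto simp: is_struct_def M_def instance_ok_def)
  moreover have "fv csp_form \<subseteq> set vs" using ok by (auto simp: instance_ok_def csp_form_def)
  moreover have "support M (set gs) csp_form"
  proof -
    have val: "the (g x) < n" if "g \<in> set gs" "x \<in> set vs" for g x
    proof -
      have "x \<in> dom g" "ran g \<subseteq> {..<n}"
        using that team by (auto simp: is_team_def M_def)
      then show ?thesis by (auto simp: ran_def dom_def)
    qed
    have entry: "rows ! a ! i = the ((gs ! a) (vs ! i))" if "a < length gs" "i < length vs" for a i
      using that arg_cong[OF rows, of "\<lambda>r. r ! a ! i"] by simp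
    have "rows ! a ! 0 = the ((gs ! a) 0) \<and> rows ! a ! 1 = the ((gs ! a) 1) \<and>
        rows ! a ! 2 = the ((gs ! a) 2)" if "a < length gs" for a
      using entry[OF that, of 0] entry[OF that, of 1] entry[OF that, of 2] vars by fastforce
    moreover have "length rows = length gs" by (simp add: gs_def)
    ultimately have "\<not> csp_sat n (length gs)
      (\<lambda>a. the ((gs ! a) 0)) (\<lambda>a. the ((gs ! a) 1)) (\<lambda>a. the ((gs ! a) 2))"
      using sat vars unfolding rows_sat_def
      by (subst (asm) csp_sat_cong[where c' = "\<lambda>a. the ((gs ! a) 0)" and v' = "\<lambda>a. the ((gs ! a) 1)"
          and s' = "\<lambda>a. the ((gs ! a) 2)"]) simp_all
    moreover have "{0, 1, 2} \<subseteq> set vs" "0 < n" using ok by (auto simp: instance_ok_def)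
    ultimately show ?thesis
      using val by (subst support_csp_form[of M n "set gs" gs]) (auto simp: M_def)
  qed
  ultimately show "w \<in> mc_problem [] csp_form"
    unfolding mc_problem_def by blast
qed

section \<open>Membership in coNP\<close>

definition zeros :: "bool list \<Rightarrow> nat \<Rightarrow> nat" where
  "zeros w p = (\<Sum>i<p. of_bool (symbol_at w i = 1))"

text \<open>The \<open>k\<close>-th number of a word is the number of ones that have exactly \<open>k\<close> zeros before them.\<close>

definition field :: "bool list \<Rightarrow> nat \<Rightarrow> nat" where
  "field w k = (\<Sum>p<length w. of_bool (symbol_at w p = 2 \<and> zeros w p = k))"

lemma sum_lessThan_add:
  fixes f :: "nat \<Rightarrow> nat"
  shows "(\<Sum>i<a + b. f i) = (\<Sum>i<a. f i) + (\<Sum>i<b. f (a + i))"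
  by (induction b) auto

lemma symbol_at_enc_nat:
  "p < n \<Longrightarrow> symbol_at (enc_nat n @ w) p = 2"
  "symbol_at (enc_nat n @ w) n = 1"
  "symbol_at (enc_nat n @ w) (Suc n + p) = symbol_at w p"
  by (simp_all add: symbol_at_def enc_nat_def nth_append)

lemma zeros_enc_nat_le: "p \<le> n \<Longrightarrow> zeros (enc_nat n @ w) p = 0"
  by (simp add: zeros_def symbol_at_enc_nat)

lemma zeros_enc_nat_add: "zeros (enc_nat n @ w) (Suc n + p) = Suc (zeros w p)"
proof -
  have "zeros (enc_nat n @ w) (Suc n + p) =
      zeros (enc_nat n @ w) n + 1 + (\<Sum>i<p. of_bool (symbol_at (enc_nat n @ w) (Suc n + i) = 1))"
    unfolding zeros_def sum_lessThan_add[of _ "Suc n" p] by (simp add: symbol_at_enc_nat(2))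
  then show ?thesis
    unfolding symbol_at_enc_nat(3) zeros_enc_nat_le[OF order_refl] by (simp add: zeros_def)
qed

text \<open>The first number contributes exactly one zero before every later position, so removing
  it lowers all later field indices by one.\<close>

lemma field_enc_nat:
  "field (enc_nat n @ w) 0 = n"
  "field (enc_nat n @ w) (Suc k) = field w k"
proof -
  let ?w = "enc_nat n @ w"
  have len: "length ?w = Suc n + length w" by (simp add: enc_nat_def)
  have "field ?w j = (\<Sum>p<n. of_bool (j = 0)) +
      (\<Sum>p<length w. of_bool (symbol_at w p = 2 \<and> Suc (zeros w p) = j))" for j
  proof -
    have "field ?w j = (\<Sum>p<n. of_bool (symbol_at ?w p = 2 \<and> zeros ?w p = j)) +
        of_bool (symbol_at ?w n = 2 \<and> zeros ?w n = j) +
        (\<Sum>p<length w. of_bool (symbol_at ?w (Suc n + p) = 2 \<and> zeros ?w (Suc n + p) = j))"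
      unfolding field_def len sum_lessThan_add[of _ "Suc n"] sum.lessThan_Suc by (rule refl)
    moreover have "(\<Sum>p<n. of_bool (symbol_at ?w p = 2 \<and> zeros ?w p = j)) = (\<Sum>p<n. of_bool (j = 0) :: nat)"
      by (rule sum.cong) (auto simp: symbol_at_enc_nat(1) zeros_enc_nat_le)
    ultimately show ?thesis
      unfolding symbol_at_enc_nat(2,3) zeros_enc_nat_add by simp
  qed
  note eq = this
  show "field ?w 0 = n" using eq[of 0] by simp
  show "field ?w (Suc k) = field w k" using eq[of "Suc k"] by (simp add: field_def)
qed

lemma field_enc_tuple: "k < length fs \<Longrightarrow> field (enc_tuple fs) k = fs ! k"
proof (induction fs arbitrary: k)
  case (Cons n fs)
  then show ?case by (cases k) (simp_all add: field_enc_nat)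
qed simp

lemma zeros_enc_tuple: "zeros (enc_tuple fs) (length (enc_tuple fs)) = length fs"
proof (induction fs)
  case Nil
  then show ?case by (simp add: zeros_def)
next
  case (Cons n fs)
  then show ?case
    using zeros_enc_nat_add[of n "enc_tuple fs" "length (enc_tuple fs)"] by (simp add: enc_nat_def)
qed

text \<open>Read from the right, a zero starts a new number 0 and a one increments the number behind
  it. Only ones with no zero behind them cannot be parsed.\<close>

lemma enc_tuple_surj: "w = [] \<or> \<not> last w \<Longrightarrow> \<exists>fs. w = enc_tuple fs"
proof (induction w)
  case Nil
  then show ?case by (intro exI[of _ "[]"]) simp
next
  case (Cons x w)
  then have "w = [] \<or> \<not> last w" by (auto split: if_splits)
  then obtain fs where fs: "w = enc_tuple fs" using Cons.IH by blast
  show ?case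
  proof (cases x)
    case False
    then show ?thesis using fs by (intro exI[of _ "0 # fs"]) (simp add: enc_nat_def)
  next
    case True
    then have "w \<noteq> []" using Cons.prems by auto
    then obtain n fs' where "fs = n # fs'" using fs by (cases fs) auto
    then show ?thesis using fs True by (intro exI[of _ "Suc n # fs'"]) (simp add: enc_nat_def)
  qed
qed

lemma enc_tuple_last: "fs \<noteq> [] \<Longrightarrow> enc_tuple fs \<noteq> [] \<and> \<not> last (enc_tuple fs)"
proof (induction fs)
  case (Cons n fs)
  then show ?case by (cases "fs = []") (auto simp: enc_nat_def)
qed simp

text \<open>Field 0 is the size of the universe, field 1 the number m of variables, the next m
  fields are the variables, field \<open>2 + m\<close> is the number of rows, and the rest are
  entries. Only bounded quantifiers occur, which makes the condition decidable.\<close>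

definition fields_ok :: "nat \<Rightarrow> (nat \<Rightarrow> nat) \<Rightarrow> bool" where
  "fields_ok N F \<longleftrightarrow> 0 < F 0 \<and> 3 \<le> F 1 \<and> N = 3 + F 1 + F (2 + F 1) * F 1 \<and>
     (\<forall>j<3. F (2 + j) = j) \<and> (\<forall>j<F 1 - 1. F (2 + j) < F (3 + j)) \<and>
     (\<forall>k<F (2 + F 1) * F 1. F (3 + F 1 + k) < F 0)"

lemma map_upt_add: "map f [0..<a + b] = map f [0..<a] @ map (\<lambda>j. f (a + j)) [0..<b]"
  by (induction b) (auto simp: add.assoc)

lemma concat_rows: "concat (map (\<lambda>a. map (\<lambda>j. h (a * m + j)) [0..<m]) [0..<l]) = map h [0..<l * m]"
proof (induction l)
  case (Suc l)
  have "[0..<Suc l * m] = [0..<l * m + m]" by (simp add: add.commute)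
  then show ?case using Suc by (simp add: map_upt_add)
qed simp

lemma concat_nth_uniform:
  assumes "\<And>r. r \<in> set rows \<Longrightarrow> length r = m" "a < length rows" "j < m"
  shows "concat rows ! (a * m + j) = rows ! a ! j"
  using assms
proof (induction rows arbitrary: a)
  case (Cons r rows)
  then show ?case by (cases a) (auto simp: nth_append)
qed simp

lemma length_concat_uniform:
  "(\<And>r. r \<in> set rows \<Longrightarrow> length r = m) \<Longrightarrow> length (concat rows) = length rows * m"
  by (induction rows) auto

lemma fields_ok_instance:
  assumes "fields_ok N F"
  obtains n vs rows where "instance_ok n vs rows"
    "map F [0..<N] = n # length vs # vs @ length rows # concat rows"
proof -
  let ?m = "F 1" and ?l = "F (2 + F 1)"
  let ?vs = "map (\<lambda>j. F (2 + j)) [0..<?m]"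
  let ?rows = "map (\<lambda>a. map (\<lambda>j. F (3 + ?m + (a * ?m + j))) [0..<?m]) [0..<?l]"
  have N: "N = 2 + (?m + (1 + ?l * ?m))" using assms by (simp add: fields_ok_def)
  have concat: "concat ?rows = map (\<lambda>k. F (3 + ?m + k)) [0..<?l * ?m]"
    by (rule concat_rows)
  have "map F [0..<N] = map F [0..<2] @ ?vs @ map (\<lambda>j. F (2 + (?m + j))) [0..<1] @
      map (\<lambda>j. F (2 + (?m + (1 + j)))) [0..<?l * ?m]"
    unfolding N map_upt_add by simp
  then have eq: "map F [0..<N] = F 0 # length ?vs # ?vs @ length ?rows # concat ?rows"
    unfolding concat by (simp add: numeral_2_eq_2 numeral_3_eq_3)
  have lt: "F (3 + ?m + (a * ?m + j)) < F 0" if "a < ?l" "j < ?m" for a j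
  proof -
    have "a * ?m + j < Suc a * ?m" using that(2) by simp
    also have "\<dots> \<le> ?l * ?m" using that(1) by (intro mult_le_mono1) simp
    finally show ?thesis using assms by (simp add: fields_ok_def)
  qed
  have "sorted_wrt (<) ?vs"
    unfolding sorted_wrt_iff_nth_Suc_transp[OF transp_on_less]
    using assms by (auto simp: fields_ok_def numeral_3_eq_3 numeral_2_eq_2)
  moreover have "{0, 1, 2} \<subseteq> set ?vs"
  proof -
    have "x \<in> set ?vs" if "x < 3" for x
    proof -
      have "F (2 + x) = x" "x < ?m" using that assms by (auto simp: fields_ok_def)
      then show ?thesis by (auto intro!: image_eqI[of _ _ x])
    qed
    then show ?thesis by auto
  qed
  ultimately have "instance_ok (F 0) ?vs ?rows"
    unfolding instance_ok_def using lt assms by (auto simp: fields_ok_def)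
  then show thesis using eq by (rule that)
qed

lemma instance_fields:
  assumes ok: "instance_ok n vs rows"
    and fs: "fs = n # length vs # vs @ length rows # concat rows"
    and F: "\<And>k. k < length fs \<Longrightarrow> F k = fs ! k"
  shows "fields_ok (length fs) F" "F 0 = n" "F 1 = length vs" "F (2 + F 1) = length rows"
    "\<And>a j. a < length rows \<Longrightarrow> j < length vs \<Longrightarrow> F (3 + F 1 + a * F 1 + j) = rows ! a ! j"
proof -
  let ?m = "length vs"
  have r: "length r = ?m" if "r \<in> set rows" for r using that ok by (simp add: instance_ok_def)
  have lc: "length (concat rows) = length rows * ?m" using r by (rule length_concat_uniform)
  then have len: "length fs = 3 + ?m + length rows * ?m" by (simp add: fs)
  show F0: "F 0 = n" using F[of 0] by (simp add: fs)
  show F1: "F 1 = ?m" using F[of 1] by (simp add: fs)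
  have Fv: "F (2 + j) = vs ! j" if "j < ?m" for j
    using that F[of "2 + j"] by (simp add: fs nth_append)
  show Fl: "F (2 + F 1) = length rows"
    unfolding F1 using F[of "2 + ?m"] by (simp add: fs nth_append)
  have Fr: "F (3 + ?m + k) = concat rows ! k" if "k < length rows * ?m" for k
    using that F[of "3 + ?m + k"] len by (simp add: fs nth_append numeral_3_eq_3)
  have idx: "a * ?m + j < length rows * ?m" if "a < length rows" "j < ?m" for a j
  proof -
    have "a * ?m + j < Suc a * ?m" using that(2) by simp
    also have "\<dots> \<le> length rows * ?m" using that(1) by (intro mult_le_mono1) simp
    finally show ?thesis .
  qed
  show "F (3 + F 1 + a * F 1 + j) = rows ! a ! j" if "a < length rows" "j < ?m" for a j
    using Fr[OF idx[OF that]] concat_nth_uniform[OF r that] unfolding F1 by (simp add: add.assoc)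
  note vars = instance_ok_vars[OF ok]
  have "\<forall>j<3. F (2 + j) = j"
  proof (intro allI impI)
    fix j :: nat assume "j < 3"
    then have "j = 0 \<or> j = 1 \<or> j = 2" by auto
    then show "F (2 + j) = j" using Fv[of j] vars by fastforce
  qed
  moreover have "\<forall>j<?m - 1. F (2 + j) < F (3 + j)"
  proof (intro allI impI)
    fix j assume j: "j < ?m - 1"
    then have "vs ! j < vs ! Suc j"
      using ok by (intro sorted_wrt_nth_less[of "(<)" vs]) (auto simp: instance_ok_def)
    then show "F (2 + j) < F (3 + j)"
      using Fv[of j] Fv[of "Suc j"] j by (simp add: numeral_3_eq_3 numeral_2_eq_2)
  qed
  moreover have "concat rows ! k < n" if "k < length rows * ?m" for k
  proof -
    have "concat rows ! k \<in> set (concat rows)" using that lc by (intro nth_mem) simp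
    then show ?thesis using ok by (auto simp: instance_ok_def)
  qed
  ultimately show "fields_ok (length fs) F"
    unfolding fields_ok_def F0 Fl unfolding F1
    using len vars(1) ok Fr by (simp add: instance_ok_def)
qed

text \<open>The final zero excludes trailing ones that belong to no number. The empty word is
  excluded as well, since \<open>symbol_at\<close> yields the blank there.\<close>

definition word_ok :: "bool list \<Rightarrow> bool" where
  "word_ok w \<longleftrightarrow> symbol_at w (length w - 1) = 1 \<and> fields_ok (zeros w (length w)) (field w)"

definition entry :: "bool list \<Rightarrow> nat \<Rightarrow> nat \<Rightarrow> nat" where
  "entry w j a = field w (3 + field w 1 + a * field w 1 + j)"

definition num_rows :: "bool list \<Rightarrow> nat" where
  "num_rows w = field w (2 + field w 1)"

lemma instance_word_ok:
  assumes ok: "instance_ok n vs rows" and w: "w = instance_word n vs rows"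
  shows "word_ok w \<and> (rows_sat n rows \<longleftrightarrow>
      csp_sat (field w 0) (num_rows w) (entry w 0) (entry w 1) (entry w 2))"
proof -
  define fs where "fs = n # length vs # vs @ length rows # concat rows"
  have w': "w = enc_tuple fs" by (simp only: w instance_word_def fs_def)
  have "field w k = fs ! k" if "k < length fs" for k
    unfolding w' using that by (rule field_enc_tuple)
  note F = instance_fields[OF ok fs_def this]
  have "symbol_at w (length w - 1) = 1"
  proof -
    have "w \<noteq> [] \<and> \<not> last w" unfolding w' by (rule enc_tuple_last) (simp add: fs_def)
    then show ?thesis unfolding symbol_at_eq_1_iff using last_conv_nth[of w] by auto
  qed
  moreover have "zeros w (length w) = length fs"
    unfolding w' by (rule zeros_enc_tuple)
  ultimately have "word_ok w" using F(1) by (simp add: word_ok_def)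
  moreover have "csp_sat n (length rows) (\<lambda>a. rows ! a ! 0) (\<lambda>a. rows ! a ! 1) (\<lambda>a. rows ! a ! 2)
      \<longleftrightarrow> csp_sat n (length rows) (entry w 0) (entry w 1) (entry w 2)"
    using F(5)[of _ 0] F(5)[of _ 1] F(5)[of _ 2] instance_ok_vars(1)[OF ok]
    by (intro csp_sat_cong) (force simp: entry_def)
  ultimately show ?thesis
    using F(2,4) by (simp add: rows_sat_def num_rows_def)
qed

text \<open>A well-formed word can be rebuilt from its fields, so membership becomes a condition on
  \<open>field\<close> and \<open>zeros\<close> alone.\<close>

lemma mc_problem_word:
  "w \<in> mc_problem [] csp_form \<longleftrightarrow>
    word_ok w \<and> \<not> csp_sat (field w 0) (num_rows w) (entry w 0) (entry w 1) (entry w 2)"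
proof -
  have "\<exists>n vs rows. instance_ok n vs rows \<and> w = instance_word n vs rows" if ok: "word_ok w"
  proof -
    have "w \<noteq> [] \<and> \<not> last w"
      using ok last_conv_nth[of w] unfolding word_ok_def symbol_at_eq_1_iff by (cases "w = []") auto
    then obtain fs where fs: "w = enc_tuple fs" using enc_tuple_surj by blast
    have "length fs = zeros w (length w)"
      unfolding fs by (rule zeros_enc_tuple[symmetric])
    then have "fs = map (field w) [0..<zeros w (length w)]"
      by (intro nth_equalityI) (auto simp: fs field_enc_tuple)
    moreover obtain n vs rows where "instance_ok n vs rows"
      "map (field w) [0..<zeros w (length w)] = n # length vs # vs @ length rows # concat rows"
      using ok fields_ok_instance unfolding word_ok_def by blast
    ultimately show ?thesis
      unfolding instance_word_def using fs by metis
  qed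
  with instance_word_ok show ?thesis unfolding mc_problem_instance by blast
qed

lemma instance_word_mc_problem:
  assumes "instance_ok n vs rows"
  shows "instance_word n vs rows \<in> mc_problem [] csp_form \<longleftrightarrow> \<not> rows_sat n rows"
  using instance_word_ok[OF assms refl] mc_problem_word by blast

text \<open>Bit \<open>a\<close> of \<open>u\<close> tells whether row \<open>a\<close> is chosen;
  rows beyond the end of \<open>u\<close> count as not chosen.\<close>

definition check :: "bool list \<Rightarrow> bool list \<Rightarrow> bool" where
  "check w u \<longleftrightarrow>
     (\<forall>a<num_rows w. \<forall>b<num_rows w. symbol_at u a = 2 \<and> symbol_at u b = 2 \<and> entry w 1 a = entry w 1 b \<longrightarrow>
        entry w 2 a = entry w 2 b) \<and>
     (\<forall>d<field w 0. \<exists>a<num_rows w. symbol_at u a = 2 \<and> entry w 0 a = d)"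

lemma csp_sat_check:
  "csp_sat (field w 0) (num_rows w) (entry w 0) (entry w 1) (entry w 2) \<longleftrightarrow>
    (\<exists>u. length u \<le> num_rows w \<and> check w u)"
proof
  assume "csp_sat (field w 0) (num_rows w) (entry w 0) (entry w 1) (entry w 2)"
  then obtain A where A: "A \<subseteq> {..<num_rows w}"
    "\<forall>a\<in>A. \<forall>b\<in>A. entry w 1 a = entry w 1 b \<longrightarrow> entry w 2 a = entry w 2 b"
    "\<forall>d<field w 0. \<exists>a\<in>A. entry w 0 a = d" unfolding csp_sat_def by blast
  define u where "u = map (\<lambda>a. a \<in> A) [0..<num_rows w]"
  have "symbol_at u a = 2 \<longleftrightarrow> a \<in> A" for a
    using A(1) by (auto simp: symbol_at_eq_2_iff u_def)
  then have "check w u" unfolding check_def using A by blast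
  then show "\<exists>u. length u \<le> num_rows w \<and> check w u"
    by (intro exI[of _ u]) (simp add: u_def)
next
  assume "\<exists>u. length u \<le> num_rows w \<and> check w u"
  then obtain u where "check w u" by blast
  then show "csp_sat (field w 0) (num_rows w) (entry w 0) (entry w 1) (entry w 2)"
    unfolding check_def csp_sat_def by (intro exI[of _ "{a. a < num_rows w \<and> symbol_at u a = 2}"]) blast
qed

text \<open>A field counts positions of the word. As the number of rows is a field, this bounds the
  length of the certificate.\<close>

lemma field_le_length: "field w k \<le> length w"
  unfolding field_def
  using sum_bounded_above[of "{..<length w}" "\<lambda>p. of_bool (symbol_at w p = 2 \<and> zeros w p = k)" "1::nat"]
  by simp

lemmas definable_input0 = definable_length[of 0, simplified] definable_read[of 0, simplified]

lemma definable_input1: "definable f \<Longrightarrow> definable (\<lambda>I e. symbol_at (I 1) (f I e))"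
  by (rule definable_read) simp_all

lemma definable_zeros:
  assumes "definable f"
  shows "definable (\<lambda>I e. zeros (I 0) (f I e))"
  by (rule definable_app[OF _ assms]) (unfold zeros_def, intro definable_intros definable_input0)

lemma definable_field:
  assumes "definable f"
  shows "definable (\<lambda>I e. field (I 0) (f I e))"
  by (rule definable_app[OF _ assms])
    (unfold field_def, intro definable_intros definable_input0 definable_zeros)

lemma definable_entry:
  assumes "definable f"
  shows "definable (\<lambda>I e. entry (I 0) j (f I e))"
  by (rule definable_app[OF _ assms])
    (unfold entry_def, intro definable_intros definable_field)

lemma definable_num_rows: "definable (\<lambda>I e. num_rows (I 0))"
  unfolding num_rows_def by (intro definable_intros definable_field)

lemma decidable_word_ok: "decidable (\<lambda>I e. word_ok (I 0))"
  unfolding word_ok_def fields_ok_def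
  by (intro definable_intros definable_field definable_zeros definable_input0)

lemma decidable_check: "decidable (\<lambda>I e. check (I 0) (I 1))"
  unfolding check_def
  by (intro definable_intros definable_field definable_entry definable_num_rows
      definable_input1)

theorem csp_in_coNP: "mc_problem [] csp_form \<in> coNP"
proof -
  \<comment> \<open>The complement of the problem contains all malformed words, so these are
    accepted with any certificate.\<close>
  define r where "r w u \<longleftrightarrow> \<not> word_ok w \<or> check w u" for w u
  have "decidable (\<lambda>I e. r (I 0) (I 1))"
    unfolding r_def by (intro definable_intros decidable_word_ok decidable_check)
  then have "polytime_rel r" by (rule polytime_relI)
  moreover have "w \<in> - mc_problem [] csp_form \<longleftrightarrow>
      (\<exists>u. length u \<le> poly [:0, 1:] (length w) \<and> r w u)" for w
  proof -
    have "w \<in> - mc_problem [] csp_form \<longleftrightarrow>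
        \<not> word_ok w \<or> (\<exists>u. length u \<le> num_rows w \<and> check w u)"
      by (simp only: Compl_iff mc_problem_word csp_sat_check de_Morgan_conj not_not)
    also have "\<dots> \<longleftrightarrow> (\<exists>u. length u \<le> length w \<and> r w u)"
    proof
      assume "\<not> word_ok w \<or> (\<exists>u. length u \<le> num_rows w \<and> check w u)"
      then show "\<exists>u. length u \<le> length w \<and> r w u"
      proof
        assume "\<not> word_ok w"
        then show ?thesis by (intro exI[of _ "[]"]) (simp add: r_def)
      next
        assume "\<exists>u. length u \<le> num_rows w \<and> check w u"
        then show ?thesis
          using field_le_length unfolding r_def num_rows_def by (meson le_trans)
      qed
    next
      assume "\<exists>u. length u \<le> length w \<and> r w u"
      then obtain u where "r w u" by blast
      \<comment> \<open>The given certificate may be longer than the number of rows.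
        \<open>check\<close> ignores the surplus bits, so passing through \<open>csp_sat\<close>
        yields a short one.\<close>
      moreover have "csp_sat (field w 0) (num_rows w) (entry w 0) (entry w 1) (entry w 2)"
        if "check w u"
        using that unfolding check_def csp_sat_def
        by (intro exI[of _ "{a. a < num_rows w \<and> symbol_at u a = 2}"]) blast
      ultimately show "\<not> word_ok w \<or> (\<exists>u. length u \<le> num_rows w \<and> check w u)"
        unfolding r_def csp_sat_check by blast
    qed
    finally show ?thesis by simp
  qed
  ultimately show ?thesis unfolding coNP_def NP_def by blast
qed

section \<open>Clauses over a grid of variables\<close>

text \<open>The order of the rows is that of three nested loops, so that a program can emit them
  directly.\<close>

definition csp_rows :: "nat \<Rightarrow> (nat \<Rightarrow> nat \<Rightarrow> nat \<Rightarrow> bool) \<Rightarrow> nat list list" where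
  "csp_rows n P = concat (map (\<lambda>c. concat (map (\<lambda>v. concat (map (\<lambda>s.
     if P c v s then [[c, v, s]] else []) [0..<n])) [0..<n])) [0..<n])"

lemma set_csp_rows: "set (csp_rows n P) = {[c, v, s] | c v s. c < n \<and> v < n \<and> s < n \<and> P c v s}"
  by (auto simp: csp_rows_def split: if_splits)

lemma length_csp_rows: "length (csp_rows n P) = (\<Sum>c<n. \<Sum>v<n. \<Sum>s<n. of_bool (P c v s))"
proof -
  have "sum_list (map f [0..<n]) = (\<Sum>i<n. f i)" for f :: "nat \<Rightarrow> nat"
    by (simp add: interv_sum_list_conv_sum_set_nat atLeast0LessThan)
  then show ?thesis
    by (simp add: csp_rows_def length_concat o_def if_distrib[of length] of_bool_def
        del: sum_of_bool_eq cong: if_cong)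
qed

lemma enc_csp_rows:
  "enc_tuple (concat (csp_rows n P)) = concat (map (\<lambda>c. concat (map (\<lambda>v. concat (map (\<lambda>s.
     if P c v s then enc_nat c @ enc_nat v @ enc_nat s else []) [0..<n])) [0..<n])) [0..<n])"
proof -
  have "enc_tuple (concat (concat Rs)) = concat (map (\<lambda>R. enc_tuple (concat R)) Rs)" for Rs
    by (induction Rs) auto
  moreover have "enc_tuple (concat (if P c v s then [[c, v, s]] else [])) =
      (if P c v s then enc_nat c @ enc_nat v @ enc_nat s else [])" for c v s
    by simp
  ultimately show ?thesis
    by (simp only: csp_rows_def map_map o_def)
qed

text \<open>A consistent choice of rows is a partial valuation, which is extended arbitrarily to
  \<open>f\<close>; conversely, all rows that agree with \<open>f\<close> form a consistent
  choice.\<close>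

lemma rows_sat_csp_rows:
  "rows_sat n (csp_rows n P) \<longleftrightarrow> (\<exists>f. \<forall>c<n. \<exists>v<n. f v < n \<and> P c v (f v))"
proof
  let ?R = "csp_rows n P"
  assume "rows_sat n ?R"
  then obtain A where A: "A \<subseteq> {..<length ?R}"
    "\<forall>a\<in>A. \<forall>b\<in>A. ?R ! a ! 1 = ?R ! b ! 1 \<longrightarrow> ?R ! a ! 2 = ?R ! b ! 2"
    "\<forall>d<n. \<exists>a\<in>A. ?R ! a ! 0 = d"
    unfolding rows_sat_def csp_sat_def by blast
  define f where "f v = ?R ! (SOME a. a \<in> A \<and> ?R ! a ! 1 = v) ! 2" for v
  have f: "f (?R ! a ! 1) = ?R ! a ! 2" if "a \<in> A" for a
  proof -
    have "(SOME b. b \<in> A \<and> ?R ! b ! 1 = ?R ! a ! 1) \<in> A \<and>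
        ?R ! (SOME b. b \<in> A \<and> ?R ! b ! 1 = ?R ! a ! 1) ! 1 = ?R ! a ! 1"
      by (rule someI[of _ a]) (use that in simp)
    then show ?thesis unfolding f_def using A(2) that by blast
  qed
  show "\<exists>f. \<forall>c<n. \<exists>v<n. f v < n \<and> P c v (f v)"
  proof (intro exI[of _ f] allI impI)
    fix c assume "c < n"
    then obtain a where a: "a \<in> A" "?R ! a ! 0 = c" using A(3) by blast
    have "?R ! a \<in> set ?R" using a(1) A(1) by auto
    then obtain v s where r: "?R ! a = [c, v, s]" "v < n" "s < n" "P c v s"
      using a(2) unfolding set_csp_rows by auto
    then have "f v = s" using f[OF a(1)] by simp
    then show "\<exists>v<n. f v < n \<and> P c v (f v)" using r by blast
  qed
next
  let ?R = "csp_rows n P"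
  assume "\<exists>f. \<forall>c<n. \<exists>v<n. f v < n \<and> P c v (f v)"
  then obtain f where f: "\<And>c. c < n \<Longrightarrow> \<exists>v<n. f v < n \<and> P c v (f v)" by blast
  let ?A = "{a. a < length ?R \<and> ?R ! a ! 2 = f (?R ! a ! 1)}"
  have "\<exists>a\<in>?A. ?R ! a ! 0 = c" if "c < n" for c
  proof -
    obtain v where "v < n" "f v < n" "P c v (f v)" using f \<open>c < n\<close> by blast
    then have "[c, v, f v] \<in> set ?R" using that by (auto simp: set_csp_rows)
    then obtain a where "a < length ?R" "?R ! a = [c, v, f v]" by (meson in_set_conv_nth)
    then show ?thesis by (intro bexI[of _ a]) auto
  qed
  moreover have "\<forall>a\<in>?A. \<forall>b\<in>?A. ?R ! a ! 1 = ?R ! b ! 1 \<longrightarrow> ?R ! a ! 2 = ?R ! b ! 2"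
    by auto
  moreover have "?A \<subseteq> {..<length ?R}" by auto
  ultimately show "rows_sat n ?R"
    unfolding rows_sat_def csp_sat_def by blast
qed

text \<open>A clause consists of a guard and of literals \<open>(\<kappa>, i, t, P)\<close>, which say that the value of the
  variable \<open>(\<kappa>, i, t)\<close> satisfies \<open>P\<close>.\<close>

type_synonym clause = "bool \<times> (nat \<times> nat \<times> nat \<times> (nat \<Rightarrow> bool)) list"

text \<open>A true guard makes every variable with every value a literal, so the clause holds
  trivially. This neutralizes indices without a constraint, which cannot be omitted because every
  element of the universe is a clause.\<close>

definition literal_of :: "clause \<Rightarrow> nat \<Rightarrow> nat \<Rightarrow> nat \<Rightarrow> nat \<Rightarrow> bool" where
  "literal_of cl \<kappa> i t s \<longleftrightarrow> fst cl \<or> (\<exists>(\<kappa>', i', t', P) \<in> set (snd cl). \<kappa> = \<kappa>' \<and> i = i' \<and> t = t' \<and> P s)"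

definition clause_sat :: "(nat \<Rightarrow> nat \<Rightarrow> nat \<Rightarrow> nat) \<Rightarrow> clause \<Rightarrow> bool" where
  "clause_sat val cl \<longleftrightarrow> fst cl \<or> (\<exists>(\<kappa>, i, t, P) \<in> set (snd cl). P (val \<kappa> i t))"

text \<open>Clause and variable numbers are both mixed-radix codes
  \<open>(\<kappa> * b + i) * b + t\<close> of triples.\<close>

definition grid_literal :: "(nat \<Rightarrow> nat \<Rightarrow> nat \<Rightarrow> clause) \<Rightarrow> nat \<Rightarrow> nat \<Rightarrow> nat \<Rightarrow> nat \<Rightarrow> bool" where
  "grid_literal cl b c v s \<longleftrightarrow>
     literal_of (cl (c div b div b) (c div b mod b) (c mod b)) (v div b div b) (v div b mod b) (v mod b) s"

lemma grid_decode:
  fixes b :: nat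
  assumes "i < b" "t < b"
  shows "((\<kappa> * b + i) * b + t) div b div b = \<kappa>" "((\<kappa> * b + i) * b + t) div b mod b = i"
    "((\<kappa> * b + i) * b + t) mod b = t"
  using assms by simp_all

lemma grid_bound:
  fixes b :: nat
  assumes "\<kappa> < K" "i < b" "t < b"
  shows "(\<kappa> * b + i) * b + t < K * b * b"
proof -
  have "\<kappa> * b + i < K * b"
    using assms(1,2) by (metis (no_types, lifting) add.commute add_less_cancel_right assms(1) less_le_trans
        mult_Suc mult_le_mono1 Suc_leI)
  then have "Suc (\<kappa> * b + i) * b \<le> K * b * b" by (intro mult_le_mono1) simp
  then show ?thesis using assms(3) by simp
qed

lemma rows_sat_grid:
  assumes "rows_sat (K * b * b) (csp_rows (K * b * b) (grid_literal cl b))"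
  obtains val where "\<And>r i t. r < K \<Longrightarrow> i < b \<Longrightarrow> t < b \<Longrightarrow> clause_sat val (cl r i t)"
proof -
  let ?n = "K * b * b"
  obtain f where f: "\<And>c. c < ?n \<Longrightarrow> \<exists>v<?n. f v < ?n \<and> grid_literal cl b c v (f v)"
    using assms unfolding rows_sat_csp_rows by blast
  define val where "val \<kappa> i t = f ((\<kappa> * b + i) * b + t)" for \<kappa> i t
  have val: "val (v div b div b) (v div b mod b) (v mod b) = f v" for v
    by (simp add: val_def)
  have "clause_sat val (cl r i t)" if r: "r < K" and i: "i < b" and t: "t < b" for r i t
  proof -
    obtain v where "grid_literal cl b ((r * b + i) * b + t) v (f v)"
      using f[OF grid_bound[OF r i t]] by blast
    then have "literal_of (cl r i t) (v div b div b) (v div b mod b) (v mod b) (f v)"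
      unfolding grid_literal_def grid_decode[OF i t] .
    then show ?thesis
      unfolding literal_of_def clause_sat_def using val[of v] by fastforce
  qed
  then show thesis by (rule that)
qed

text \<open>Rows contain only elements of the universe. Hence the variables of unguarded clauses
  must have codes below \<open>K * b * b\<close>, and the valuation must take its values
  there.\<close>

lemma grid_rows_sat:
  assumes sat: "\<And>r i t. r < K \<Longrightarrow> i < b \<Longrightarrow> t < b \<Longrightarrow> clause_sat val (cl r i t)"
    and range: "\<And>r i t \<kappa>' i' t' P. r < K \<Longrightarrow> i < b \<Longrightarrow> t < b \<Longrightarrow> \<not> fst (cl r i t) \<Longrightarrow>
      (\<kappa>', i', t', P) \<in> set (snd (cl r i t)) \<Longrightarrow> \<kappa>' < K \<and> i' < b \<and> t' < b"
    and val: "\<And>\<kappa> i t. val \<kappa> i t < K * b * b"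
  shows "rows_sat (K * b * b) (csp_rows (K * b * b) (grid_literal cl b))"
  unfolding rows_sat_csp_rows
proof (intro exI[of _ "\<lambda>v. val (v div b div b) (v div b mod b) (v mod b)"] allI impI)
  let ?n = "K * b * b" and ?f = "\<lambda>v. val (v div b div b) (v div b mod b) (v mod b)"
  fix c assume c: "c < ?n"
  then have b: "0 < b" by (cases b) auto
  let ?cl = "cl (c div b div b) (c div b mod b) (c mod b)"
  have r: "c div b div b < K" "c div b mod b < b" "c mod b < b"
    using c b by (auto simp: less_mult_imp_div_less)
  show "\<exists>v<?n. ?f v < ?n \<and> grid_literal cl b c v (?f v)"
  proof (cases "fst ?cl")
    case True
    then have "grid_literal cl b c 0 (?f 0)" by (simp add: grid_literal_def literal_of_def)
    moreover have "0 < ?n" using c by linarith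
    ultimately show ?thesis using val by blast
  next
    case False
    then obtain \<kappa> i t P where l: "(\<kappa>, i, t, P) \<in> set (snd ?cl)" "P (val \<kappa> i t)"
      using sat[OF r] unfolding clause_sat_def by fastforce
    have ran: "\<kappa> < K" "i < b" "t < b" using range[OF r False l(1)] by auto
    let ?v = "(\<kappa> * b + i) * b + t"
    have "?f ?v = val \<kappa> i t" unfolding grid_decode[OF ran(2,3)] ..
    moreover have "grid_literal cl b c ?v (val \<kappa> i t)"
      unfolding grid_literal_def grid_decode[OF ran(2,3)] literal_of_def using l by fastforce
    ultimately show ?thesis
      using grid_bound[OF ran] val by (intro exI[of _ ?v]) simp
  qed
qed

section \<open>Hardness\<close>

datatype rule =
    Init_State
  | Init_Head nat
  | Init_Cell nat
  | Certificate
  | Scan nat nat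
  | Write nat nat
  | Move nat nat
  | Keep nat nat
  | Next nat
  | Accept

locale verifier =
  fixes M :: tm and p q :: "nat poly"
  assumes wf: "wf_tm M" and tapes: "2 \<le> tm_tapes M"
begin

text \<open>Making the halting state idle explicitly lets every step be described by \<open>delta\<close>.\<close>

definition delta :: "nat \<Rightarrow> nat list \<Rightarrow> nat \<times> (nat \<times> dir) list" where
  "delta s ss = (if s = tm_halt M then (s, map (\<lambda>a. (a, Stay)) ss) else tm_delta M s ss)"

definition local_views :: "(nat \<times> nat list) set" where
  "local_views = {(s, ss). s < tm_states M \<and> length ss = tm_tapes M \<and> set ss \<subseteq> {..<tm_symbols M}}"

text \<open>The state and all scanned symbols together form one value, so a transition needs a
  single premise for them whatever the number of tapes.\<close>

definition views :: "(nat \<times> nat list) list" where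
  "views = (SOME xs. set xs = local_views)"

lemma set_views: "set views = local_views"
proof -
  have "local_views = {..<tm_states M} \<times> {ss. set ss \<subseteq> {..<tm_symbols M} \<and> length ss = tm_tapes M}"
    by (auto simp: local_views_def)
  then have "finite local_views" by (simp add: finite_lists_length_eq)
  then obtain xs where "set xs = local_views" using finite_list by blast
  then show ?thesis unfolding views_def by (rule someI)
qed

section \<open>The run of the verifier, tape by tape\<close>

definition config :: "bool list \<Rightarrow> bool list \<Rightarrow> nat \<Rightarrow> config" where
  "config x u t = (tm_step M ^^ t) (tm_init M [x, u])"

definition state :: "bool list \<Rightarrow> bool list \<Rightarrow> nat \<Rightarrow> nat" where
  "state x u t = fst (config x u t)"

definition head :: "bool list \<Rightarrow> bool list \<Rightarrow> nat \<Rightarrow> nat \<Rightarrow> int" where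
  "head x u t j = fst (snd (config x u t) ! j)"

definition cell :: "bool list \<Rightarrow> bool list \<Rightarrow> nat \<Rightarrow> nat \<Rightarrow> tape" where
  "cell x u t j = snd (snd (config x u t) ! j)"

definition scanned :: "bool list \<Rightarrow> bool list \<Rightarrow> nat \<Rightarrow> nat list" where
  "scanned x u t = map (\<lambda>j. cell x u t j (head x u t j)) [0..<tm_tapes M]"

lemma delta_wf:
  assumes "(s, ss) \<in> local_views"
  shows "fst (delta s ss) < tm_states M" "length (snd (delta s ss)) = tm_tapes M"
    "fst ` set (snd (delta s ss)) \<subseteq> {..<tm_symbols M}"
proof -
  have "case tm_delta M s ss of (q', acts) \<Rightarrow> q' < tm_states M \<and> length acts = tm_tapes M \<and>
      fst ` set acts \<subseteq> {..<tm_symbols M}"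
    using assms wf unfolding local_views_def wf_tm_def by auto
  then show "fst (delta s ss) < tm_states M" "length (snd (delta s ss)) = tm_tapes M"
    "fst ` set (snd (delta s ss)) \<subseteq> {..<tm_symbols M}"
    using assms by (auto simp: delta_def local_views_def image_image split: prod.splits)
qed

text \<open>These facts are proved together: a step is described by \<open>delta\<close> only if the
  current view is well-formed, and well-formedness at the next time needs that description.\<close>

lemma length_config: "length (snd (config x u t)) = tm_tapes M"
  and view_in_local_views: "(state x u t, scanned x u t) \<in> local_views"
  and cell_bound: "j < tm_tapes M \<Longrightarrow> cell x u t j i < tm_symbols M"
  and state_Suc: "state x u (Suc t) = fst (delta (state x u t) (scanned x u t))"
  and head_Suc: "j < tm_tapes M \<Longrightarrow> head x u (Suc t) j =
    head x u t j + offset (snd (snd (delta (state x u t) (scanned x u t)) ! j))"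
  and cell_Suc: "j < tm_tapes M \<Longrightarrow> cell x u (Suc t) j =
    (cell x u t j)(head x u t j := fst (snd (delta (state x u t) (scanned x u t)) ! j))"
proof -
  let ?inv = "\<lambda>t. length (snd (config x u t)) = tm_tapes M \<and> state x u t < tm_states M \<and>
    (\<forall>j<tm_tapes M. \<forall>i. cell x u t j i < tm_symbols M)"
  have scan: "map (\<lambda>(h, tp). tp h) (snd (config x u t)) = scanned x u t" if "?inv t" for t
    using that by (intro nth_equalityI) (auto simp: scanned_def cell_def head_def split: prod.split)
  have view: "(state x u t, scanned x u t) \<in> local_views" if "?inv t" for t
    using that by (auto simp: local_views_def scanned_def)
  have step: "state x u (Suc t) = fst (delta (state x u t) (scanned x u t)) \<and>
      length (snd (config x u (Suc t))) = tm_tapes M \<and>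
      (\<forall>j<tm_tapes M. head x u (Suc t) j =
         head x u t j + offset (snd (snd (delta (state x u t) (scanned x u t)) ! j)) \<and>
       cell x u (Suc t) j =
         (cell x u t j)(head x u t j := fst (snd (delta (state x u t) (scanned x u t)) ! j)))"
    if inv: "?inv t" for t
  proof (cases "state x u t = tm_halt M")
    case True
    then have "config x u (Suc t) = config x u t"
      by (auto simp: config_def tm_step_def state_def split: prod.split)
    then show ?thesis
      using inv True by (auto simp: state_def head_def cell_def delta_def scanned_def)
  next
    case False
    obtain s ts where c: "config x u t = (s, ts)" by (cases "config x u t")
    have scan': "map (\<lambda>(h, tp). tp h) ts = scanned x u t" using scan[OF inv] c by simp
    obtain q' acts where d: "tm_delta M s (scanned x u t) = (q', acts)"
      by (cases "tm_delta M s (scanned x u t)")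
    have dl: "delta (state x u t) (scanned x u t) = (q', acts)"
      using False c d by (simp add: delta_def state_def)
    then have len: "length acts = tm_tapes M" "length ts = tm_tapes M"
      using delta_wf(2)[OF view[OF inv]] inv c by simp_all
    have "config x u (Suc t) = tm_step M (config x u t)" by (simp add: config_def)
    also have "\<dots> = (q', map2 (\<lambda>(s, d) (h, tp). (h + offset d, tp(h := s))) acts ts)"
      unfolding c tm_step_def using False c d scan' by (simp add: state_def)
    finally have c': "config x u (Suc t) = (q', map2 (\<lambda>(s, d) (h, tp). (h + offset d, tp(h := s))) acts ts)" .
    show ?thesis
      unfolding dl unfolding state_def head_def cell_def c c'
      using len by (auto simp: split_beta)
  qed
  have inv: "?inv t" for t
  proof (induction t)
    case 0
    have "tape_of w i < tm_symbols M" for w i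
      using wf bit_symbol_bounds[of "w ! nat i"] by (auto simp: tape_of_def wf_tm_def)
    then show ?case
      using wf by (auto simp: config_def state_def cell_def tm_init_def wf_tm_def)
  next
    case (Suc t)
    note s = step[OF Suc] and d = delta_wf[OF view[OF Suc]]
    have "fst (snd (delta (state x u t) (scanned x u t)) ! j) < tm_symbols M" if "j < tm_tapes M" for j
      using d(2,3) that by (metis image_subset_iff lessThan_iff nth_mem)
    then show ?case using s d(1) Suc by auto
  qed
  show "length (snd (config x u t)) = tm_tapes M" using inv by blast
  show "(state x u t, scanned x u t) \<in> local_views" using view inv by blast
  show "j < tm_tapes M \<Longrightarrow> cell x u t j i < tm_symbols M" using inv by blast
  show "state x u (Suc t) = fst (delta (state x u t) (scanned x u t))" using step inv by blast
  show "j < tm_tapes M \<Longrightarrow> head x u (Suc t) j =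
    head x u t j + offset (snd (snd (delta (state x u t) (scanned x u t)) ! j))"
    using step inv by blast
  show "j < tm_tapes M \<Longrightarrow> cell x u (Suc t) j =
    (cell x u t j)(head x u t j := fst (snd (delta (state x u t) (scanned x u t)) ! j))"
    using step inv by blast
qed

lemma state_0: "state x u 0 = tm_start M"
  by (simp add: state_def config_def tm_init_def)

lemma head_0: "j < tm_tapes M \<Longrightarrow> head x u 0 j = 0"
  by (simp add: head_def config_def tm_init_def)

lemma cell_0:
  "j < tm_tapes M \<Longrightarrow> cell x u 0 j = tape_of (if j = 0 then x else if j = 1 then u else [])"
  by (auto simp: cell_def config_def tm_init_def less_2_cases_iff)

text \<open>A head moves by at most one cell per step, so a window of \<open>time x\<close> cells on
  either side of cell 0 contains all head positions up to that time.\<close>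

lemma head_bound: "j < tm_tapes M \<Longrightarrow> \<bar>head x u t j\<bar> \<le> int t"
proof (induction t)
  case 0
  then show ?case by (simp add: head_0)
next
  case (Suc t)
  let ?d = "offset (snd (snd (delta (state x u t) (scanned x u t)) ! j))"
  have "\<bar>offset d\<bar> \<le> 1" for d by (cases d) auto
  then have "\<bar>?d\<bar> \<le> 1" .
  then show ?case
    using Suc abs_triangle_ineq[of "head x u t j" ?d] by (simp add: head_Suc)
qed

section \<open>Tableau variables and clauses\<close>

definition cert_bound :: "bool list \<Rightarrow> nat" where
  "cert_bound x = poly q (length x)"

text \<open>The summand \<open>cert_bound x\<close> makes the window reach the first cell behind the
  longest certificate.\<close>

definition time :: "bool list \<Rightarrow> nat" where
  "time x = poly p (length x + cert_bound x) + length x + cert_bound x"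

text \<open>Shifted head positions lie between 0 and \<open>2 * time x\<close>. That the width is at
  least 2 is used when the values are fitted into the universe.\<close>

definition width :: "bool list \<Rightarrow> nat" where
  "width x = 2 * time x + 2"

text \<open>The variables are \<open>(j, i, t)\<close> for the content of cell \<open>i\<close> of tape \<open>j\<close> at time \<open>t\<close>,
  \<open>(k + j, 0, t)\<close> for the head position on tape \<open>j\<close>, and \<open>(2 k, 0, t)\<close> for the index in
  \<open>views\<close> of the state together with the scanned symbols, where \<open>k\<close> is the number of tapes.
  Positions are shifted by \<open>time x\<close> to make them natural numbers.\<close>

definition init_cell :: "bool list \<Rightarrow> nat \<Rightarrow> nat \<Rightarrow> nat \<Rightarrow> bool" where
  "init_cell x j i s \<longleftrightarrow>
     (if j = 0 then s = (if i < time x then 0 else symbol_at x (i - time x))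
      else if j = 1 then s \<le> 2 \<and> (i < time x \<or> time x + cert_bound x \<le> i \<longrightarrow> s = 0)
      else s = 0)"

definition next_state :: "nat \<Rightarrow> nat" where
  "next_state \<alpha> = fst (case_prod delta (views ! \<alpha>))"

definition written :: "nat \<Rightarrow> nat \<Rightarrow> nat" where
  "written \<alpha> j = fst (snd (case_prod delta (views ! \<alpha>)) ! j)"

text \<open>The added 1 makes the move a natural number; the literal
  \<open>Suc s = i + shift \<alpha> j\<close> compensates for it.\<close>

definition shift :: "nat \<Rightarrow> nat \<Rightarrow> nat" where
  "shift \<alpha> j = nat (1 + offset (snd (snd (case_prod delta (views ! \<alpha>)) ! j)))"

text \<open>Each rule is an implication with negated premises first and the conclusion last; the
  guard switches it off at times and cells where it does not apply. Tape 1 is left open by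
  \<open>Init_Cell\<close> inside the certificate window, and \<open>Certificate\<close> lets only
  blanks follow a blank. \<open>Accept\<close> inspects one cell, as symbol 2 is the output bit
  True.\<close>

fun rule_clause :: "rule \<Rightarrow> bool list \<Rightarrow> nat \<Rightarrow> nat \<Rightarrow> clause" where
  "rule_clause Init_State x i t = (t \<noteq> 0,
     [(2 * tm_tapes M, 0, 0, \<lambda>s. s < length views \<and> fst (views ! s) = tm_start M)])"
| "rule_clause (Init_Head j) x i t = (t \<noteq> 0, [(tm_tapes M + j, 0, 0, \<lambda>s. s = time x)])"
| "rule_clause (Init_Cell j) x i t = (t \<noteq> 0, [(j, i, 0, init_cell x j i)])"
| "rule_clause Certificate x i t = (t \<noteq> 0 \<or> i < time x \<or> width x \<le> Suc i,
     [(1, i, 0, \<lambda>s. s \<noteq> 0), (1, Suc i, 0, \<lambda>s. s = 0)])"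
| "rule_clause (Scan j a) x i t = (time x < t,
     [(tm_tapes M + j, 0, t, \<lambda>s. s \<noteq> i), (j, i, t, \<lambda>s. s \<noteq> a),
      (2 * tm_tapes M, 0, t, \<lambda>s. s < length views \<and> snd (views ! s) ! j = a)])"
| "rule_clause (Write j \<alpha>) x i t = (time x \<le> t,
     [(tm_tapes M + j, 0, t, \<lambda>s. s \<noteq> i), (2 * tm_tapes M, 0, t, \<lambda>s. s \<noteq> \<alpha>),
      (j, i, Suc t, \<lambda>s. s = written \<alpha> j)])"
| "rule_clause (Move j \<alpha>) x i t = (time x \<le> t,
     [(tm_tapes M + j, 0, t, \<lambda>s. s \<noteq> i), (2 * tm_tapes M, 0, t, \<lambda>s. s \<noteq> \<alpha>),
      (tm_tapes M + j, 0, Suc t, \<lambda>s. Suc s = i + shift \<alpha> j)])"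
| "rule_clause (Keep j a) x i t = (time x \<le> t,
     [(tm_tapes M + j, 0, t, \<lambda>s. s = i), (j, i, t, \<lambda>s. s \<noteq> a), (j, i, Suc t, \<lambda>s. s = a)])"
| "rule_clause (Next \<alpha>) x i t = (time x \<le> t,
     [(2 * tm_tapes M, 0, t, \<lambda>s. s \<noteq> \<alpha>),
      (2 * tm_tapes M, 0, Suc t, \<lambda>s. s < length views \<and> fst (views ! s) = next_state \<alpha>)])"
| "rule_clause Accept x i t = (t \<noteq> time x, [(tm_tapes M - 1, time x, time x, \<lambda>s. s = 2)])"

definition rules :: "rule list" where
  "rules = [Init_State, Certificate, Accept] @ map Init_Head [0..<tm_tapes M] @
     map Init_Cell [0..<tm_tapes M] @ map Next [0..<length views] @
     [Scan j a. j \<leftarrow> [0..<tm_tapes M], a \<leftarrow> [0..<tm_symbols M]] @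
     [Keep j a. j \<leftarrow> [0..<tm_tapes M], a \<leftarrow> [0..<tm_symbols M]] @
     [Write j \<alpha>. j \<leftarrow> [0..<tm_tapes M], \<alpha> \<leftarrow> [0..<length views]] @
     [Move j \<alpha>. j \<leftarrow> [0..<tm_tapes M], \<alpha> \<leftarrow> [0..<length views]]"

lemma set_rules:
  "set rules = {Init_State, Certificate, Accept} \<union> Init_Head ` {..<tm_tapes M} \<union>
     Init_Cell ` {..<tm_tapes M} \<union> Next ` {..<length views} \<union>
     {Scan j a | j a. j < tm_tapes M \<and> a < tm_symbols M} \<union>
     {Keep j a | j a. j < tm_tapes M \<and> a < tm_symbols M} \<union>
     {Write j \<alpha> | j \<alpha>. j < tm_tapes M \<and> \<alpha> < length views} \<union>
     {Move j \<alpha> | j \<alpha>. j < tm_tapes M \<and> \<alpha> < length views}"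
  by (auto simp: rules_def)

lemma rule_clause_range:
  assumes "\<rho> \<in> set rules" "i < width x" "t < width x" "\<not> fst (rule_clause \<rho> x i t)"
    "(\<kappa>', i', t', P) \<in> set (snd (rule_clause \<rho> x i t))"
  shows "\<kappa>' \<le> 2 * tm_tapes M \<and> i' < width x \<and> t' < width x"
  by (cases \<rho>; insert assms tapes; auto simp: set_rules width_def)

section \<open>Runs versus satisfying valuations\<close>

lemma views_index:
  obtains \<alpha> where "\<alpha> < length views" "views ! \<alpha> = (state x u t, scanned x u t)"
  using view_in_local_views[of x u t] set_views by (metis in_set_conv_nth)

text \<open>Every clause states a local fact about the run, so the valuation that records the run
  satisfies all of them.\<close>

lemma accepting_run_satisfies:
  assumes u: "length u \<le> cert_bound x"
    and acc: "cell x u (time x) (tm_tapes M - 1) 0 = 2"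
  obtains val where "\<And>\<rho> i t. \<rho> \<in> set rules \<Longrightarrow> clause_sat val (rule_clause \<rho> x i t)"
    "\<And>\<kappa> i t. val \<kappa> i t < tm_symbols M + length views + width x"
proof -
  let ?T = "time x" and ?k = "tm_tapes M"
  define index where "index t = (SOME \<alpha>. \<alpha> < length views \<and> views ! \<alpha> = (state x u t, scanned x u t))" for t
  have index: "index t < length views" "views ! index t = (state x u t, scanned x u t)" for t
  proof -
    have "\<exists>\<alpha>. \<alpha> < length views \<and> views ! \<alpha> = (state x u t, scanned x u t)"
      using views_index[of x u t] by blast
    from someI_ex[OF this]
    show "index t < length views" "views ! index t = (state x u t, scanned x u t)"
      by (auto simp: index_def)
  qed
  \<comment> \<open>Variables for later times occur only in clauses with a true guard; the value 0
    keeps them within the bound.\<close>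
  define val where "val \<kappa> i t =
    (if ?T < t then 0 else if \<kappa> < ?k then cell x u t \<kappa> (int i - int ?T)
     else if \<kappa> < 2 * ?k then nat (head x u t (\<kappa> - ?k) + int ?T) else index t)" for \<kappa> i t
  have val_cell: "val j i t = cell x u t j (int i - int ?T)" if "j < ?k" "t \<le> ?T" for j i t
    using that by (simp add: val_def)
  have val_head: "val (?k + j) i t = nat (head x u t j + int ?T)" if "j < ?k" "t \<le> ?T" for j i t
    using that by (simp add: val_def)
  have val_index: "val (2 * ?k) i t = index t" if "t \<le> ?T" for i t
    using that by (simp add: val_def)
  have pos: "int ?T - int t \<le> head x u t j + int ?T" "head x u t j + int ?T \<le> int ?T + int t"
    if "j < ?k" for t j
    using head_bound[OF that, of x u t] by auto
  have k: "0 < ?k" "1 < ?k" using tapes by auto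
  have cell0: "val j i 0 = symbol_at (if j = 0 then x else if j = 1 then u else []) (i - ?T)"
    if "j < ?k" "?T \<le> i" for i j
  proof -
    have eq: "int i - int ?T = int (i - ?T)" using that by simp
    show ?thesis unfolding val_cell[OF that(1) le0] cell_0[OF that(1)] eq tape_of_nat ..
  qed
  have cell0': "val j i 0 = 0" if "j < ?k" "i < ?T" for i j
    using that by (simp add: val_cell cell_0 tape_of_def)
  have sat: "clause_sat val (rule_clause \<rho> x i t)" if \<rho>: "\<rho> \<in> set rules" for \<rho> i t
  proof (cases \<rho>)
    case Init_State
    then show ?thesis
      using index[of 0] by (auto simp: clause_sat_def val_index state_0)
  next
    case (Init_Head j)
    then have "j < ?k" using \<rho> by (auto simp: set_rules)
    then show ?thesis using Init_Head by (auto simp: clause_sat_def val_head head_0)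
  next
    case (Init_Cell j)
    then have j: "j < ?k" using \<rho> by (auto simp: set_rules)
    have "init_cell x j i (val j i 0)"
    proof (cases "i < ?T")
      case True
      then show ?thesis using cell0'[OF j] by (simp add: init_cell_def)
    next
      case False
      then show ?thesis
        using cell0[OF j, of i] u symbol_at_le_2[of u]
        by (auto simp: init_cell_def symbol_at_eq_0_iff)
    qed
    then show ?thesis using Init_Cell by (simp add: clause_sat_def)
  next
    case Certificate
    have "val 1 i 0 \<noteq> 0 \<or> val 1 (Suc i) 0 = 0" if "?T \<le> i"
      using cell0[OF k(2), of i] cell0[OF k(2), of "Suc i"] that by (auto simp: symbol_at_eq_0_iff)
    then show ?thesis using Certificate by (auto simp: clause_sat_def)
  next
    case (Scan j a)
    then have j: "j < ?k" using \<rho> by (auto simp: set_rules)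
    have "snd (views ! val (2 * ?k) 0 t) ! j = a"
      if t: "t \<le> ?T" and h: "val (?k + j) 0 t = i" and c: "val j i t = a"
    proof -
      have "int i - int ?T = head x u t j" using val_head[OF j t, of 0] h pos(1)[OF j, of t] t by auto
      then show ?thesis using c j val_cell[OF j t] val_index[OF t] by (simp add: index scanned_def)
    qed
    moreover have "t \<le> ?T \<Longrightarrow> val (2 * ?k) 0 t < length views" by (simp add: val_index index)
    ultimately show ?thesis using Scan by (cases "t \<le> ?T") (auto simp: clause_sat_def)
  next
    case (Write j \<alpha>)
    then have j: "j < ?k" using \<rho> by (auto simp: set_rules)
    have "val j i (Suc t) = written \<alpha> j"
      if t: "t < ?T" and h: "val (?k + j) 0 t = i" and \<alpha>: "val (2 * ?k) 0 t = \<alpha>"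
    proof -
      have t': "t \<le> ?T" "Suc t \<le> ?T" using t by auto
      have "int i - int ?T = head x u t j" using val_head[OF j t'(1), of 0] h pos(1)[OF j, of t] t by auto
      moreover have "\<alpha> = index t" using \<alpha> val_index[OF t'(1)] by simp
      ultimately show ?thesis
        using val_cell[OF j t'(2)] by (simp add: cell_Suc[OF j] written_def index)
    qed
    then show ?thesis using Write by (cases "t < ?T") (auto simp: clause_sat_def)
  next
    case (Move j \<alpha>)
    then have j: "j < ?k" using \<rho> by (auto simp: set_rules)
    have "Suc (val (?k + j) 0 (Suc t)) = i + shift \<alpha> j"
      if t: "t < ?T" and h: "val (?k + j) 0 t = i" and \<alpha>: "val (2 * ?k) 0 t = \<alpha>"
    proof -
      have t': "t \<le> ?T" "Suc t \<le> ?T" using t by auto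
      let ?d = "offset (snd (snd (delta (state x u t) (scanned x u t)) ! j))"
      have "- 1 \<le> offset d" for d by (cases d) auto
      then have "- 1 \<le> ?d" .
      \<comment> \<open>Strictly before \<open>time x\<close> the shifted head is at least 1, so a
        move to the left is not truncated by \<open>nat\<close>.\<close>
      moreover have "1 \<le> head x u t j + int ?T" using t pos(1)[OF j, of t] by auto
      moreover have "i = nat (head x u t j + int ?T)" using val_head[OF j t'(1), of 0] h by simp
      moreover have "\<alpha> = index t" using \<alpha> val_index[OF t'(1)] by simp
      then have "shift \<alpha> j = nat (1 + ?d)" by (simp add: shift_def index)
      moreover have "val (?k + j) 0 (Suc t) = nat (head x u t j + ?d + int ?T)"
        using val_head[OF j t'(2), of 0] by (simp add: head_Suc[OF j])
      ultimately show ?thesis by linarith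
    qed
    then show ?thesis using Move by (cases "t < ?T") (auto simp: clause_sat_def)
  next
    case (Keep j a)
    then have j: "j < ?k" using \<rho> by (auto simp: set_rules)
    have "val j i (Suc t) = val j i t" if t: "t < ?T" and h: "val (?k + j) 0 t \<noteq> i"
    proof -
      have t': "t \<le> ?T" "Suc t \<le> ?T" using t by auto
      have "int i - int ?T \<noteq> head x u t j" using val_head[OF j t'(1), of 0] h by auto
      then show ?thesis
        using val_cell[OF j t'(1)] val_cell[OF j t'(2)] by (simp add: cell_Suc[OF j])
    qed
    then show ?thesis using Keep by (cases "t < ?T") (auto simp: clause_sat_def)
  next
    case (Next \<alpha>)
    then show ?thesis
      using index(1)[of "Suc t"] by (auto simp: clause_sat_def val_index not_le index next_state_def state_Suc)
  next
    case Accept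
    then show ?thesis using acc k by (auto simp: clause_sat_def val_cell)
  qed
  have bound: "val \<kappa> i t < tm_symbols M + length views + width x" for \<kappa> i t
  proof -
    consider "?T < t" | "t \<le> ?T" "\<kappa> < ?k" | "t \<le> ?T" "?k \<le> \<kappa>" "\<kappa> < 2 * ?k" | "t \<le> ?T" "2 * ?k \<le> \<kappa>"
      by linarith
    then show ?thesis
    proof cases
      case 1
      then show ?thesis by (simp add: val_def width_def)
    next
      case 2
      then show ?thesis using cell_bound[of \<kappa> x u t] by (simp add: val_cell trans_less_add1)
    next
      case 3
      then have "\<kappa> - ?k < ?k" by linarith
      then have "nat (head x u t (\<kappa> - ?k) + int ?T) < width x"
        using pos(2)[of "\<kappa> - ?k" t] 3(1) unfolding width_def by linarith
      then show ?thesis using 3 by (simp add: val_def)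
    next
      case 4
      then show ?thesis using index(1)[of t] by (simp add: val_def)
    qed
  qed
  show thesis using sat bound by (rule that)
qed

text \<open>The valuation at time 0 encodes a certificate, and by induction on time the valuation
  agrees with the run on it. Nothing outside the window is needed: the next content of a cell
  depends only on that cell, the head and the view.\<close>

lemma satisfying_run:
  assumes sat: "\<And>\<rho> i t. \<rho> \<in> set rules \<Longrightarrow> i < width x \<Longrightarrow> t < width x \<Longrightarrow>
    clause_sat val (rule_clause \<rho> x i t)"
  obtains u where "length u \<le> cert_bound x" "cell x u (time x) (tm_tapes M - 1) 0 = 2"
proof -
  let ?T = "time x" and ?k = "tm_tapes M" and ?B = "width x" and ?c = "cert_bound x"
  have k: "0 < ?k" "1 < ?k" using tapes by auto
  have T: "?T < ?B" "?T + ?c < ?B" "0 < ?B" by (auto simp: width_def time_def)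
  have init: "init_cell x j i (val j i 0)" if "j < ?k" "i < ?B" for j i
    using sat[of "Init_Cell j" i 0] that T by (simp add: clause_sat_def set_rules)
  have cert: "val 1 (Suc i) 0 = 0" if "val 1 i 0 = 0" "?T \<le> i" "Suc i < ?B" for i
    using sat[of Certificate i 0] that T by (simp add: clause_sat_def set_rules)
  have "val 1 (?T + ?c) 0 = 0" using init[OF k(2) T(2)] by (simp add: init_cell_def)
  \<comment> \<open>The certificate ends at the first blank from cell 0 on, which exists because
    cell \<open>cert_bound x\<close> is forced to be blank.\<close>
  define m where "m = (LEAST i. val 1 (?T + i) 0 = 0)"
  have m: "val 1 (?T + m) 0 = 0" "m \<le> ?c" and m_less: "\<And>i. i < m \<Longrightarrow> val 1 (?T + i) 0 \<noteq> 0"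
    unfolding m_def using \<open>val 1 (?T + ?c) 0 = 0\<close>
    by (rule LeastI, rule Least_le) (auto dest: not_less_Least)
  define u where "u = map (\<lambda>i. val 1 (?T + i) 0 = 2) [0..<m]"
  have zero: "val 1 (?T + (m + i)) 0 = 0" if "?T + (m + i) < ?B" for i
    using that
  proof (induction i)
    case 0
    then show ?case using m by simp
  next
    case (Suc i)
    then show ?case using cert[of "?T + (m + i)"] by simp
  qed
  have u_val: "val 1 (?T + i) 0 = symbol_at u i" if "?T + i < ?B" for i
  proof (cases "i < m")
    case True
    have "val 1 (?T + i) 0 \<le> 2" using init[OF k(2) that] by (simp add: init_cell_def)
    then have "val 1 (?T + i) 0 = 1 \<or> val 1 (?T + i) 0 = 2" using m_less[OF True] by linarith
    then show ?thesis using True by (auto simp: symbol_at_def u_def)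
  next
    case False
    then show ?thesis using zero[of "i - m"] that by (simp add: symbol_at_def u_def)
  qed
  have start: "val j i 0 = cell x u 0 j (int i - int ?T)" if j: "j < ?k" and i: "i < ?B" for j i
  proof (cases "i < ?T")
    case True
    have "tape_of w (int i - int ?T) = 0" for w using True by (simp add: tape_of_def)
    then show ?thesis using init[OF j i] True j by (auto simp: cell_0 init_cell_def split: if_splits)
  next
    case False
    then have eq: "int i - int ?T = int (i - ?T)" "?T + (i - ?T) = i" by auto
    have "symbol_at [] (i - ?T) = 0" by (simp add: symbol_at_def)
    then show ?thesis
      unfolding cell_0[OF j] eq(1) tape_of_nat
      using init[OF j i] u_val[of "i - ?T"] False i eq(2) by (auto simp: init_cell_def)
  qed
  define A where "A t = val (2 * ?k) 0 t" for t
  \<comment> \<open>Of the view only the state belongs to the invariant; the scanned symbols follow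
    from the \<open>Scan\<close> clauses at each time.\<close>
  let ?inv = "\<lambda>t. A t < length views \<and> fst (views ! A t) = state x u t \<and>
    (\<forall>j<?k. val (?k + j) 0 t = nat (head x u t j + int ?T)) \<and>
    (\<forall>j<?k. \<forall>i<?B. val j i t = cell x u t j (int i - int ?T))"
  have pos: "nat (head x u t j + int ?T) < ?B" "int (nat (head x u t j + int ?T)) - int ?T = head x u t j"
    "int ?T - int t \<le> head x u t j + int ?T"
    if "j < ?k" "t \<le> ?T" for t j
    using head_bound[OF that(1), of x u t] that(2) by (auto simp: width_def)
  have view: "views ! A t = (state x u t, scanned x u t)" if inv: "?inv t" and t: "t \<le> ?T" for t
  proof -
    have "snd (views ! A t) = scanned x u t"
    proof (rule nth_equalityI)
      have "views ! A t \<in> local_views" using inv set_views nth_mem by blast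
      then have len: "length (snd (views ! A t)) = ?k" by (auto simp: local_views_def)
      then show "length (snd (views ! A t)) = length (scanned x u t)" by (simp add: scanned_def)
      fix j assume "j < length (snd (views ! A t))"
      then have j: "j < ?k" using len by simp
      let ?i = "nat (head x u t j + int ?T)" and ?a = "cell x u t j (head x u t j)"
      have "clause_sat val (rule_clause (Scan j ?a) x ?i t)"
        using j t T pos(1)[OF j t] cell_bound[OF j] by (intro sat) (auto simp: set_rules)
      moreover have "val (?k + j) 0 t = ?i" "val j ?i t = ?a"
        using inv j pos[OF j t] by auto
      ultimately have "snd (views ! A t) ! j = ?a"
        using t by (auto simp: clause_sat_def A_def)
      then show "snd (views ! A t) ! j = scanned x u t ! j" using j by (simp add: scanned_def)
    qed
    with inv show ?thesis by (metis prod.collapse)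
  qed
  have inv: "?inv t" if "t \<le> ?T" for t
    using that
  proof (induction t)
    case 0
    have "A 0 < length views \<and> fst (views ! A 0) = state x u 0"
      using sat[of Init_State 0 0] T by (simp add: clause_sat_def set_rules A_def state_0)
    moreover have "val (?k + j) 0 0 = nat (head x u 0 j + int ?T)" if "j < ?k" for j
      using sat[of "Init_Head j" 0 0] T that by (simp add: clause_sat_def set_rules head_0)
    ultimately show ?case using start by blast
  next
    case (Suc t)
    then have t: "t < ?T" "t \<le> ?T" "t < ?B" and IH: "?inv t" using T by auto
    note v = view[OF IH t(2)]
    have \<alpha>: "A t < length views" using IH by blast
    have "A (Suc t) < length views \<and> fst (views ! A (Suc t)) = state x u (Suc t)"
      using sat[of "Next (A t)" 0 t] t \<alpha> T
      by (simp add: clause_sat_def set_rules A_def[symmetric] next_state_def v state_Suc)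
    moreover have "val (?k + j) 0 (Suc t) = nat (head x u (Suc t) j + int ?T)" if j: "j < ?k" for j
    proof -
      let ?i = "nat (head x u t j + int ?T)"
      have "clause_sat val (rule_clause (Move j (A t)) x ?i t)"
        using j t \<alpha> pos(1)[OF j t(2)] by (intro sat) (auto simp: set_rules)
      moreover have "val (?k + j) 0 t = ?i" using IH j by blast
      ultimately have "Suc (val (?k + j) 0 (Suc t)) = ?i + shift (A t) j"
        using t by (auto simp: clause_sat_def A_def[symmetric])
      moreover have "- 1 \<le> offset d" for d by (cases d) auto
      moreover have "1 \<le> head x u t j + int ?T" using pos(3)[OF j t(2)] t(1) by simp
      ultimately show ?thesis
        by (simp add: head_Suc[OF j] shift_def v) (smt (verit) nat_add_distrib Suc_nat_eq_nat_zadd1 of_nat_Suc nat_int int_nat_eq)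
    qed
    moreover have "val j i (Suc t) = cell x u (Suc t) j (int i - int ?T)"
      if j: "j < ?k" and i: "i < ?B" for j i
    proof (cases "i = nat (head x u t j + int ?T)")
      case True
      have "clause_sat val (rule_clause (Write j (A t)) x i t)"
        using j t \<alpha> i by (intro sat) (auto simp: set_rules)
      moreover have "val (?k + j) 0 t = i" using IH j True by blast
      ultimately have "val j i (Suc t) = written (A t) j"
        using t by (auto simp: clause_sat_def A_def[symmetric])
      moreover have "int i - int ?T = head x u t j" unfolding True by (rule pos(2)[OF j t(2)])
      ultimately show ?thesis by (simp add: cell_Suc[OF j] written_def v)
    next
      case False
      have "clause_sat val (rule_clause (Keep j (cell x u t j (int i - int ?T))) x i t)"
        using j t i cell_bound[OF j] by (intro sat) (auto simp: set_rules)
      moreover have "val (?k + j) 0 t \<noteq> i" "val j i t = cell x u t j (int i - int ?T)"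
        using IH i j False by auto
      ultimately have "val j i (Suc t) = cell x u t j (int i - int ?T)"
        using t by (auto simp: clause_sat_def)
      moreover have "int i - int ?T \<noteq> head x u t j" using False by auto
      ultimately show ?thesis by (simp add: cell_Suc[OF j])
    qed
    ultimately show ?case by blast
  qed
  have "val (?k - 1) ?T ?T = 2"
    using sat[of Accept 0 ?T] T by (simp add: clause_sat_def set_rules)
  then have "cell x u ?T (?k - 1) 0 = 2"
    using inv[OF order_refl] T k by auto
  moreover have "length u \<le> ?c" using m(2) by (simp add: u_def)
  ultimately show thesis by (rule that[rotated])
qed

section \<open>The reduction and its correctness\<close>

definition grid_clause :: "bool list \<Rightarrow> nat \<Rightarrow> nat \<Rightarrow> nat \<Rightarrow> clause" where
  "grid_clause x r i t = (if r < length rules then rule_clause (rules ! r) x i t else (True, []))"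

text \<open>The sum covers the rules and the variable kinds 0 to \<open>2 * tm_tapes M\<close>, and
  its last two summands make room for the values, all in one universe.\<close>

definition kinds :: nat where
  "kinds = length rules + Suc (2 * tm_tapes M) + tm_symbols M + length views"

definition size :: "bool list \<Rightarrow> nat" where
  "size x = kinds * width x * width x"

definition reduction :: "bool list \<Rightarrow> bool list" where
  "reduction x = instance_word (size x) [0, 1, 2]
     (csp_rows (size x) (grid_literal (grid_clause x) (width x)))"

lemma reduction_mc_problem:
  "reduction x \<in> mc_problem [] csp_form \<longleftrightarrow>
    \<not> (\<exists>u. length u \<le> cert_bound x \<and> cell x u (time x) (tm_tapes M - 1) 0 = 2)"
proof -
  let ?rows = "csp_rows (size x) (grid_literal (grid_clause x) (width x))"
  have "0 < size x" by (simp add: size_def kinds_def width_def)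
  then have "instance_ok (size x) [0, 1, 2] ?rows"
    by (auto simp: instance_ok_def set_csp_rows)
  then have "reduction x \<in> mc_problem [] csp_form \<longleftrightarrow> \<not> rows_sat (size x) ?rows"
    unfolding reduction_def by (rule instance_word_mc_problem)
  moreover have "rows_sat (size x) ?rows \<longleftrightarrow>
    (\<exists>u. length u \<le> cert_bound x \<and> cell x u (time x) (tm_tapes M - 1) 0 = 2)"
  proof
    assume "rows_sat (size x) ?rows"
    then obtain val where val: "\<And>r i t. r < kinds \<Longrightarrow> i < width x \<Longrightarrow> t < width x \<Longrightarrow>
        clause_sat val (grid_clause x r i t)"
      unfolding size_def using rows_sat_grid[of kinds "width x" "grid_clause x"] by blast
    have "clause_sat val (rule_clause \<rho> x i t)"
      if \<rho>: "\<rho> \<in> set rules" and i: "i < width x" and t: "t < width x" for \<rho> i t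
    proof -
      obtain r where "r < length rules" "rules ! r = \<rho>" using \<rho> by (meson in_set_conv_nth)
      then show ?thesis using val[of r i t] i t by (simp add: grid_clause_def kinds_def)
    qed
    then show "\<exists>u. length u \<le> cert_bound x \<and> cell x u (time x) (tm_tapes M - 1) 0 = 2"
      using satisfying_run by metis
  next
    assume "\<exists>u. length u \<le> cert_bound x \<and> cell x u (time x) (tm_tapes M - 1) 0 = 2"
    then obtain u where u: "length u \<le> cert_bound x" "cell x u (time x) (tm_tapes M - 1) 0 = 2"
      by blast
    from u obtain val where
      val: "\<And>\<rho> i t. \<rho> \<in> set rules \<Longrightarrow> clause_sat val (rule_clause \<rho> x i t)"
        "\<And>\<kappa> i t. val \<kappa> i t < tm_symbols M + length views + width x"
      by (rule accepting_run_satisfies) blast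
    show "rows_sat (size x) ?rows"
      unfolding size_def
    proof (rule grid_rows_sat)
      show "clause_sat val (grid_clause x r i t)" for r i t
        using val(1) by (auto simp: grid_clause_def clause_sat_def[of _ "(True, [])"])
      show "\<kappa>' < kinds \<and> i' < width x \<and> t' < width x"
        if "i < width x" "t < width x" "\<not> fst (grid_clause x r i t)"
          "(\<kappa>', i', t', P) \<in> set (snd (grid_clause x r i t))" for r i t \<kappa>' i' t' P
        using rule_clause_range[of "rules ! r" i x t \<kappa>' i' t' P] that
        by (auto simp: grid_clause_def kinds_def split: if_splits)
      show "val \<kappa> i t < kinds * width x * width x" for \<kappa> i t
      proof -
        \<comment> \<open>\<open>kinds\<close> and \<open>width x\<close> are each at most their
          product, and a width of at least 2 leaves room for two copies of it.\<close>
        have w: "2 \<le> width x" by (simp add: width_def)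
        have "val \<kappa> i t < kinds + width x" using val(2)[of \<kappa> i t] by (simp add: kinds_def)
        also have "\<dots> \<le> kinds * width x + kinds * width x"
          using mult_le_mono2[of 1 "width x" kinds] mult_le_mono1[of 1 kinds "width x"] w
          by (simp add: kinds_def)
        also have "\<dots> = kinds * width x * 2" by simp
        also have "\<dots> \<le> kinds * width x * width x" using w by (intro mult_le_mono2)
        finally show ?thesis .
      qed
    qed
  qed
  ultimately show ?thesis by simp
qed

section \<open>Computing the reduction in polynomial time\<close>

lemma definable_time: "definable (\<lambda>I e. time (I 0))"
  unfolding time_def cert_bound_def by (intro definable_intros definable_poly definable_input0)

lemma definable_cert_bound: "definable (\<lambda>I e. cert_bound (I 0))"
  unfolding cert_bound_def by (intro definable_poly definable_input0)

lemma definable_width: "definable (\<lambda>I e. width (I 0))"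
  unfolding width_def by (intro definable_intros definable_time)

lemma definable_size: "definable (\<lambda>I e. size (I 0))"
  unfolding size_def by (intro definable_intros definable_width)

text \<open>The rule is fixed, so its clause has a known shape with a constant number of literals,
  and conditions on a view index are lookups in a finite table.\<close>

lemma decidable_rule_literal:
  assumes d: "definable i" "definable t" "definable \<kappa>" "definable i'" "definable t'" "definable s"
  shows "decidable (\<lambda>I e. literal_of (rule_clause \<rho> (I 0) (i I e) (t I e)) (\<kappa> I e) (i' I e) (t' I e) (s I e))"
proof -
  have table: "decidable (\<lambda>I e. s I e < length views \<and> Q (s I e))" for Q
    using decidable_cases[of "length views" "\<lambda>r I e. Q r" s] decidable_const d by simp
  \<comment> \<open>The table facts come first: splitting their conjunction would separate
    \<open>views ! s\<close> from the bound that makes it a finite lookup.\<close>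
  note intros = table[of "\<lambda>a. fst (views ! a) = _"] table[of "\<lambda>a. snd (views ! a) ! _ = _"]
    definable_intros decidable_const definable_time definable_width definable_cert_bound
    definable_input0 d
  note unfold = literal_of_def rule_clause.simps fst_conv snd_conv list.set bex_simps
        case_prod_conv init_cell_def
  show ?thesis
  proof (cases \<rho>)
    case Init_State
    show ?thesis unfolding Init_State unfold by (intro intros)
  next
    case (Init_Head j)
    show ?thesis unfolding Init_Head unfold by (intro intros)
  next
    case (Init_Cell j)
    show ?thesis unfolding Init_Cell unfold if_bool_eq_conj by (intro intros)
  next
    case Certificate
    show ?thesis unfolding Certificate unfold by (intro intros)
  next
    case (Scan j a)
    show ?thesis unfolding Scan unfold by (intro intros)
  next
    case (Write j \<alpha>)
    show ?thesis unfolding Write unfold by (intro intros)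
  next
    case (Move j \<alpha>)
    show ?thesis unfolding Move unfold by (intro intros)
  next
    case (Keep j a)
    show ?thesis unfolding Keep unfold by (intro intros)
  next
    case (Next \<alpha>)
    show ?thesis unfolding Next unfold by (intro intros)
  next
    case Accept
    show ?thesis unfolding Accept unfold by (intro intros)
  qed
qed

text \<open>Variables 2, 1, 0 are c, v, s in the order in which three nested loops bind them. The
  rule number is resolved by cases over the fixed list \<open>rules\<close>.\<close>

lemma decidable_grid_literal:
  "decidable (\<lambda>I e. grid_literal (grid_clause (I 0)) (width (I 0)) (e 2) (e 1) (e 0))"
proof -
  let ?b = "\<lambda>I :: inputs. width (I 0)"
  have "decidable (\<lambda>I e. e 2 div ?b I div ?b I < length rules \<and>
      literal_of (rule_clause (rules ! (e 2 div ?b I div ?b I)) (I 0) (e 2 div ?b I mod ?b I) (e 2 mod ?b I))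
        (e 1 div ?b I div ?b I) (e 1 div ?b I mod ?b I) (e 1 mod ?b I) (e 0))"
    by (rule decidable_cases) (intro decidable_rule_literal definable_intros definable_width)+
  then have "decidable (\<lambda>I e. (e 2 div ?b I div ?b I < length rules \<and>
      literal_of (rule_clause (rules ! (e 2 div ?b I div ?b I)) (I 0) (e 2 div ?b I mod ?b I) (e 2 mod ?b I))
        (e 1 div ?b I div ?b I) (e 1 div ?b I mod ?b I) (e 1 mod ?b I) (e 0)) \<or>
      length rules \<le> e 2 div ?b I div ?b I)"
    by (rule decidable_disj) (intro definable_intros definable_width)
  moreover have "grid_literal (grid_clause x) b c v s \<longleftrightarrow> (c div b div b < length rules \<and>
      literal_of (rule_clause (rules ! (c div b div b)) x (c div b mod b) (c mod b))
        (v div b div b) (v div b mod b) (v mod b) s) \<or> length rules \<le> c div b div b" for x b c v s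
    by (auto simp: grid_literal_def grid_clause_def literal_of_def[of "(True, [])"])
  ultimately show ?thesis by simp
qed

text \<open>The number of rows precedes the rows in the code, so it is computed as a triple sum
  before the loops that write them.\<close>

lemma polytime_reduction: "polytime_fun reduction"
proof (rule polytime_funI)
  let ?P = "\<lambda>x. grid_literal (grid_clause x) (width x)"
  have lit: "decidable (\<lambda>I e. ?P (I 0) (e (Suc (Suc 0))) (e (Suc 0)) (e 0))"
    using decidable_grid_literal by (simp add: numeral_2_eq_2)
  have "reduction x = enc_nat (size x) @ enc_nat 3 @ enc_nat 0 @ enc_nat 1 @ enc_nat 2 @
      enc_nat (\<Sum>c<size x. \<Sum>v<size x. \<Sum>s<size x. of_bool (?P x c v s)) @
      concat (map (\<lambda>c. concat (map (\<lambda>v. concat (map (\<lambda>s.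
        if ?P x c v s then enc_nat c @ enc_nat v @ enc_nat s else [])
        [0..<size x])) [0..<size x])) [0..<size x])" for x
    unfolding reduction_def instance_word_def
    by (simp only: enc_tuple_Cons enc_tuple_append enc_tuple_Nil append_Cons append_Nil append_assoc
        enc_csp_rows length_csp_rows) (simp add: numeral_3_eq_3)
  moreover have "emittable (\<lambda>I e. enc_nat (size (I 0)) @ enc_nat 3 @ enc_nat 0 @ enc_nat 1 @ enc_nat 2 @
      enc_nat (\<Sum>c<size (I 0). \<Sum>v<size (I 0). \<Sum>s<size (I 0). of_bool (?P (I 0) c v s)) @
      concat (map (\<lambda>c. concat (map (\<lambda>v. concat (map (\<lambda>s.
        if ?P (I 0) c v s then enc_nat c @ enc_nat v @ enc_nat s else [])
        [0..<size (I 0)])) [0..<size (I 0)])) [0..<size (I 0)]))"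
    by (intro emittable_append emittable_concat emittable_if emittable_enc_nat emittable_Nil
        definable_sum definable_of_bool definable_var definable_const definable_size lit)
  ultimately show "emittable (\<lambda>I e. reduction (I 0))" by simp
qed

end

text \<open>The verifier for the complement of \<open>L\<close> accepts some certificate iff the
  clauses are satisfiable, that is, iff the formula is not supported; the two negations
  cancel.\<close>

theorem csp_coNP_hard:
  assumes "L \<in> coNP"
  shows "polytime_reducible L (mc_problem [] csp_form)"
proof -
  obtain r and q :: "nat poly" where r: "polytime_rel r"
    and L: "\<And>x. x \<in> - L \<longleftrightarrow> (\<exists>u. length u \<le> poly q (length x) \<and> r x u)"
    using assms unfolding coNP_def NP_def by blast
  obtain M and p :: "nat poly" where M: "wf_tm M" "2 \<le> tm_tapes M"
    and out: "\<And>x u. tm_outputs M [x, u] [r x u] (poly p (length x + length u))"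
    using r unfolding polytime_rel_def by blast
  interpret verifier M p q by unfold_locales (fact M)+
  have "r x u \<longleftrightarrow> cell x u (time x) (tm_tapes M - 1) 0 = 2" if u: "length u \<le> cert_bound x" for x u
  proof -
    let ?t = "poly p (length x + length u)"
    have halt: "state x u ?t = tm_halt M" and tape: "snd (last (snd (config x u ?t))) = tape_of [r x u]"
      using out[of x u] by (auto simp: tm_outputs_def state_def config_def split: prod.splits)
    \<comment> \<open>A halted configuration no longer changes, so the output can be read at
      \<open>time x\<close>, which does not depend on the certificate.\<close>
    have "config x u (?t + d) = config x u ?t" for d
    proof (induction d)
      case (Suc d)
      have "config x u (?t + Suc d) = tm_step M (config x u (?t + d))" by (simp add: config_def)
      then show ?case using Suc halt by (auto simp: tm_step_def state_def split: prod.split)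
    qed simp
    moreover have "?t \<le> time x"
      unfolding time_def using poly_mono_nat[of "length x + length u" "length x + cert_bound x" p] u by simp
    ultimately have "config x u (time x) = config x u ?t" by (metis le_add_diff_inverse)
    then have "cell x u (time x) (tm_tapes M - 1) = tape_of [r x u]"
      using tape length_config[of x u ?t] tapes by (simp add: cell_def last_conv_nth flip: length_greater_0_conv)
    then show ?thesis using tape_of_nat[of "[r x u]" 0] by (simp add: symbol_at_def) (cases "r x u"; simp)
  qed
  then have "x \<in> - L \<longleftrightarrow> (\<exists>u. length u \<le> cert_bound x \<and> cell x u (time x) (tm_tapes M - 1) 0 = 2)" for x
    unfolding L by (auto simp: cert_bound_def)
  then have "x \<in> L \<longleftrightarrow> reduction x \<in> mc_problem [] csp_form" for x
    unfolding reduction_mc_problem by blast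
  then show ?thesis
    unfolding polytime_reducible_def using polytime_reduction by blast
qed

theorem theorem3:
  "\<exists>(\<tau> :: vocabulary) (\<phi> :: form). over_voc \<tau> \<phi> \<and> coNP_complete (mc_problem \<tau> \<phi>)"
proof (intro exI conjI)
  show "over_voc [] csp_form" by (simp add: csp_form_def)
  show "coNP_complete (mc_problem [] csp_form)"
    unfolding coNP_complete_def using csp_in_coNP csp_coNP_hard by blast
qed

end
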